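(* Let $p\ge3$ be prime, $l=2(p-1)$, and let $A$ be the dg-algebra (an ${\rm A}_\infty$-algebra with $m_n=0$ for $n\ge3$) and $\mathfrak B=\{\overline{\chi^a\iota^j}:a\in\{0,1\},j\ge0\}$ the basis of $H^*A$ as in the context. Define $\mathbb{F}_p$-linear maps $m'_n:(H^*A)^{\otimes n}\to H^*A$ and $f_n:(H^*A)^{\otimes n}\to A$ ($n\ge1$) on basis tensors $\overline{\chi^{a_1}\iota^{j_1}}\otimes\cdots\otimes\overline{\chi^{a_n}\iota^{j_n}}$ as follows. $m'_n$: if some $a_i=0$, it is $0$ for $n\ne2$, and $m'_2(\overline{\chi^{a_1}\iota^{j_1}}\otimes\overline{\chi^{a_2}\iota^{j_2}})=\overline{\chi^{a_1+a_2}\iota^{j_1+j_2}}$; if all $a_i=1$, it is $0$ for $n\ne p$ and $m'_p(\overline{\chi\iota^{j_1}}\otimes\cdots\otimes\overline{\chi\iota^{j_p}})=(-1)^p\,\overline{\iota^{p-1+j_1+\cdots+j_p}}$. $f_1(\overline{\iota^j})=\iota^j$, $f_1(\overline{\chi\iota^j})=\chi\circ\iota^j$; for $n\in[2,p-1]$, $f_n(\ldots)=0$ if some $a_i=0$ and $f_n(\overline{\chi\iota^{j_1}}\otimes\cdots\otimes\overline{\chi\iota^{j_n}})=(-1)^{n-1}\gamma_n\circ\iota^{j_1+\cdots+j_n}$; $f_n=0$ for $n\ge p$. Then $(H^*A,(m'_n)_{n\ge1})$ is a minimal ${\rm A}_\infty$-algebra (i.e.\ $m'_1=0$), and $(f_n)_{n\ge1}$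 is a quasi-isomorphism of ${\rm A}_\infty$-algebras from $(H^*A,(m'_n)_{n\ge1})$ to $(A,(m_n)_{n\ge1})$; more precisely $f_1$ induces the identity on homology. In particular $m'_n=0$ for all $n\notin\{2,p\}$.
   Context: Graded conventions: all modules are $\mathbb{Z}$-graded over $R=\mathbb{F}_p$; for graded maps $g,h$ and homogeneous $x$, $(g\otimes h)(x\otimes y)=(-1)^{|h||x|}g(x)\otimes h(y)$ (Koszul rule). An ${\rm A}_\infty$-algebra is a graded module $A$ with graded maps $m_k:A^{\otimes k}\to A$ of degree $2-k$ ($k\ge1$) such that for every $k\ge1$: $\sum_{k=r+s+t,\,r,t\ge0,\,s\ge1}(-1)^{rs+t}m_{r+1+t}\circ(1^{\otimes r}\otimes m_s\otimes1^{\otimes t})=0$. It is minimal if $m_1=0$. An ${\rm A}_\infty$-morphism $(A',m')\to(A,m)$ is a family $f_k:A'^{\otimes k}\to A$ of degree $1-k$ with, for every $k\ge1$, $\sum_{k=r+s+t,\,r,t\ge0,\,s\ge1}(-1)^{rs+t}f_{r+1+t}\circ(1^{\otimes r}\otimes m'_s\otimes1^{\otimes t})=\sum_{1\le r\le k,\ i_1+\cdots+i_r=k,\ i_s\ge1}(-1)^v m_r\circ(f_{i_1}\otimes\cdots\otimes f_{i_r})$ with $v=\sum_{1\le t<s\le r}(1-i_s)i_t$; it is a quasi-isomorphism if $f_1$ (a chain map $(A',m'_1)\to(A,m_1)$) is a quasi-isomorphism. Setup: $p\ge3$ prime, $l=2(p-1)$; $\omega(i):=r+1$ if $i=jl+r$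 with $0\le r\le p-2$, $\omega(i):=l-r$ if $p-1\le r\le l-1$. With $\Gamma=\prod_{\lambda\vdash p}\mathbb{Z}_{(p)}^{n_\lambda\times n_\lambda}$ ($n_\lambda$ = Specht module rank), hooks $\lambda^k=(p-k+1,1^{k-1})$, $n^k_{\rm b}=\binom{p-2}{k-1}$, $n^k_{\rm c}=\binom{p-2}{k-2}$, $\Lambda=\{\rho\in\Gamma:\rho^{\lambda^k}_{\rm bb}\equiv\rho^{\lambda^{k+1}}_{\rm cc}\bmod p\ (k\in[1,p-1]),\ \rho^{\lambda^k}_{\rm bc}\equiv0\bmod p\ (k\in[1,p])\}$ (blocks ${\rm cc}$ upper-left $n^k_{\rm c}\times n^k_{\rm c}$, ${\rm bc}$ upper-right $n^k_{\rm c}\times n^k_{\rm b}$, ${\rm bb}$ lower-right $n^k_{\rm b}\times n^k_{\rm b}$), $\mathbb{F}_p\mathfrak{S}_p$ is identified with $\Lambda/p\Lambda$ via the known isomorphism $\mathbb{Z}_{(p)}\mathfrak{S}_p\cong\Lambda$ (trivial module via the $\lambda^1$-component). Matrix units $\eta_{\lambda,i,j}$; $\tilde e_k=\eta_{\lambda^k,n^k_{\rm c}+1,n^k_{\rm c}+1}+\eta_{\lambda^{k+1},1,1}$; $P_k=\tilde e_k\Lambda/p\tilde e_k\Lambda$ ($k\in[1,p-1]$), $e_k$ its identity; $e_{1,1},e_{p-1,p-1},e_{k+1,k}:P_k\to P_{k+1},e_{k,k+1}:P_{k+1}\to P_k$ induced by left multiplication with $p\eta_{\lambda^1,1,1}$,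 $p\eta_{\lambda^p,1,1}$, $\eta_{\lambda^{k+1},n^{k+1}_{\rm c}+1,1}$, $p\eta_{\lambda^{k+1},1,n^{k+1}_{\rm c}+1}$. The projective resolution $\mathcal P$ of the trivial module $\mathbb{F}_p$: $\mathcal P_i=P_{\omega(i)}$ ($i\ge0$), $0$ ($i<0$), $d_i=e_{\omega(i-1),\omega(i)}$ ($i\ge1$). $\operatorname{Hom}^z(C,C')=\prod_i\operatorname{Hom}(C_{i+z},C'_i)$, composition componentwise; $\lfloor g\rfloor^y_x$ ($g:C_x\to C'_y$) has $g$ as $y$-th component, zeros elsewhere. $A=\bigoplus_z\operatorname{Hom}^z_{\mathbb{F}_p\mathfrak{S}_p}(\mathcal P,\mathcal P)$ with $m_1(g)=d\circ g-(-1)^zg\circ d$ ($g\in A^z$, $d=\sum_i\lfloor d_{i+1}\rfloor^i_{i+1}$), $m_2(g\otimes h)=g\circ h$, $m_n=0$ for $n\ge3$; so $H^*A=\operatorname{Ext}^*_{\mathbb{F}_p\mathfrak{S}_p}(\mathbb{F}_p,\mathbb{F}_p)$. $\iota:=\sum_{i\ge0}\lfloor e_{\omega(i)}\rfloor^i_{i+l}\in A^l$; $\chi:=\sum_{i\ge0}(\lfloor e_1\rfloor^{il}_{il+l-1}+\sum_{k=1}^{p-2}\lfloor e_{k+1,k}\rfloor^{il+k}_{il+l-1+k}+\lfloor e_{p-1}\rfloor^{il+p-1}_{il+l-1+p-1}+\sum_{k=1}^{p-2}\lfloor e_{p-k-1,p-k}\rfloor^{il+p-1+k}_{il+l-1+p-1+k})\in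 A^{l-1}$; $\gamma_k:=\sum_{i\ge0}(\lfloor e_k\rfloor^{k-1+li}_{k(l-1)+li}+\lfloor e_{p-k}\rfloor^{k-1+(p-1)+li}_{k(l-1)+(p-1)+li})$ for $k\in[2,p-1]$. Write $\chi^0\iota^j:=\iota^j$, $\chi^1\iota^j:=\chi\circ\iota^j$; these are cycles, and $\{\overline{\chi^a\iota^j}:a\in\{0,1\},j\ge0\}$ is an $\mathbb{F}_p$-basis of $H^*A$, with $|\overline{\iota^j}|=jl$ and $|\overline{\chi\iota^j}|=jl+l-1$. *)

theory Defs
  imports "Berlekamp_Zassenhaus.Finite_Field" "HOL-Library.Poly_Mapping"
    "HOL-Library.Product_Lexorder" "HOL-Library.FuncSet"
begin

definition is_partition :: "nat \<Rightarrow> nat list \<Rightarrow> bool" where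
  "is_partition n lam \<longleftrightarrow> sorted_wrt (\<ge>) lam \<and> 0 \<notin> set lam \<and> sum_list lam = n"

definition young_cells :: "nat list \<Rightarrow> (nat \<times> nat) set" where
  "young_cells lam = {(i, j). i < length lam \<and> j < lam ! i}"

definition SYT :: "nat list \<Rightarrow> (nat \<times> nat \<Rightarrow> nat) set" where
  "SYT lam = {T. bij_betw T (young_cells lam) {1..sum_list lam}
     \<and> (\<forall>i j. (i, j + 1) \<in> young_cells lam \<longrightarrow> T (i, j) < T (i, j + 1))
     \<and> (\<forall>i j. (i + 1, j) \<in> young_cells lam \<longrightarrow> T (i, j) < T (i + 1, j))
     \<and> (\<forall>c. c \<notin> young_cells lam \<longrightarrow> T c = 0)}"

definition specht_rank :: "nat list \<Rightarrow> nat" where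
  "specht_rank lam = card (SYT lam)"

text \<open>An element of Gamma: a family of matrices indexed by partitions lam of p,
  entries indexed 1-based by 1..n_lam; all other values are zero.\<close>
type_synonym gam = "nat list \<Rightarrow> nat \<Rightarrow> nat \<Rightarrow> rat"

definition Zloc :: "nat \<Rightarrow> rat set" where
  "Zloc p = {q. \<not> int p dvd snd (quotient_of q)}"

definition congp :: "nat \<Rightarrow> rat \<Rightarrow> rat \<Rightarrow> bool" where
  "congp p x y \<longleftrightarrow> (x - y) / of_nat p \<in> Zloc p"

definition Gam :: "nat \<Rightarrow> gam set" where
  "Gam p = {rho. \<forall>lam i j. rho lam i j \<in> Zloc p \<and>
     (\<not> (is_partition p lam \<and> 1 \<le> i \<and> i \<le> specht_rank lam \<and> 1 \<le> j \<and> j \<le> specht_rank lam)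
        \<longrightarrow> rho lam i j = 0)}"

definition gadd :: "gam \<Rightarrow> gam \<Rightarrow> gam" where
  "gadd x y = (\<lambda>lam i j. x lam i j + y lam i j)"

definition gsmul :: "rat \<Rightarrow> gam \<Rightarrow> gam" where
  "gsmul c x = (\<lambda>lam i j. c * x lam i j)"

definition gmul :: "gam \<Rightarrow> gam \<Rightarrow> gam" where
  "gmul x y = (\<lambda>lam i j. \<Sum>k = 1..specht_rank lam. x lam i k * y lam k j)"

definition hook :: "nat \<Rightarrow> nat \<Rightarrow> nat list" where
  "hook p k = (p - k + 1) # replicate (k - 1) 1"

definition nb :: "nat \<Rightarrow> nat \<Rightarrow> nat" where
  "nb p k = (p - 2) choose (k - 1)"

definition nc :: "nat \<Rightarrow> nat \<Rightarrow> nat" where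
  "nc p k = (if k \<ge> 2 then (p - 2) choose (k - 2) else 0)"

definition Lam :: "nat \<Rightarrow> gam set" where
  "Lam p = {rho \<in> Gam p.
     (\<forall>k \<in> {1..p-1}. \<forall>i j. 1 \<le> i \<and> i \<le> nb p k \<and> 1 \<le> j \<and> j \<le> nb p k \<longrightarrow>
        congp p (rho (hook p k) (nc p k + i) (nc p k + j)) (rho (hook p (k + 1)) i j))
   \<and> (\<forall>k \<in> {1..p}. \<forall>i j. 1 \<le> i \<and> i \<le> nc p k \<and> nc p k + 1 \<le> j \<and> j \<le> nc p k + nb p k \<longrightarrow>
        congp p (rho (hook p k) i j) 0)}"

definition eta :: "nat list \<Rightarrow> nat \<Rightarrow> nat \<Rightarrow> gam" where
  "eta lam i j = (\<lambda>mu x y. if mu = lam \<and> x = i \<and> y = j then 1 else 0)"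

definition etil :: "nat \<Rightarrow> nat \<Rightarrow> gam" where
  "etil p k = gadd (eta (hook p k) (nc p k + 1) (nc p k + 1)) (eta (hook p (k + 1)) 1 1)"

section \<open>The projective modules P_k = etil_k Lambda / p etil_k Lambda (right modules)\<close>

definition Mk :: "nat \<Rightarrow> nat \<Rightarrow> gam set" where
  "Mk p k = {gmul (etil p k) r | r. r \<in> Lam p}"

definition coset :: "nat \<Rightarrow> nat \<Rightarrow> gam \<Rightarrow> gam set" where
  "coset p k x = {gadd x (gsmul (of_nat p) y) | y. y \<in> Mk p k}"

definition Pcar :: "nat \<Rightarrow> nat \<Rightarrow> gam set set" where
  "Pcar p k = {coset p k x | x. x \<in> Mk p k}"

definition zcos :: "nat \<Rightarrow> nat \<Rightarrow> gam set" where
  "zcos p k = coset p k (\<lambda>_ _ _. 0)"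

definition cadd :: "gam set \<Rightarrow> gam set \<Rightarrow> gam set" where
  "cadd X Y = {gadd x y | x y. x \<in> X \<and> y \<in> Y}"

text \<open>Integer multiples of a coset X = x + N (N = X - X).\<close>
definition csmul :: "int \<Rightarrow> gam set \<Rightarrow> gam set" where
  "csmul n X = {gadd (gsmul (of_int n) x) (gadd a (gsmul (-1) b)) | x a b. x \<in> X \<and> a \<in> X \<and> b \<in> X}"

text \<open>Right action of Lambda (hence of Lambda/p Lambda = F_p S_p) on P_k.\<close>
definition ract :: "nat \<Rightarrow> nat \<Rightarrow> gam set \<Rightarrow> gam \<Rightarrow> gam set" where
  "ract p k X r = (\<Union>x\<in>X. coset p k (gmul x r))"

text \<open>Module homomorphisms P_k \<rightarrow> P_m over F_p S_p = Lambda/p Lambda.\<close>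
definition HomP :: "nat \<Rightarrow> nat \<Rightarrow> nat \<Rightarrow> (gam set \<Rightarrow> gam set) set" where
  "HomP p k m = {phi. phi \<in> extensional (Pcar p k) \<and> phi \<in> Pcar p k \<rightarrow> Pcar p m
     \<and> (\<forall>X\<in>Pcar p k. \<forall>Y\<in>Pcar p k. phi (cadd X Y) = cadd (phi X) (phi Y))
     \<and> (\<forall>X\<in>Pcar p k. \<forall>r\<in>Lam p. phi (ract p k X r) = ract p m (phi X) r)}"

definition lmul :: "nat \<Rightarrow> nat \<Rightarrow> nat \<Rightarrow> gam \<Rightarrow> gam set \<Rightarrow> gam set" where
  "lmul p b a rho = restrict (\<lambda>X. \<Union>x\<in>X. coset p a (gmul rho x)) (Pcar p b)"

text \<open>e_{a,b} : P_b \<rightarrow> P_a (for (a,b) = (1,1), (p-1,p-1), (k+1,k), (k,k+1)).\<close>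
definition emap :: "nat \<Rightarrow> nat \<Rightarrow> nat \<Rightarrow> gam set \<Rightarrow> gam set" where
  "emap p a b = lmul p b a
     (if a = b + 1 then eta (hook p a) (nc p a + 1) 1
      else if b = a + 1 then gsmul (of_nat p) (eta (hook p b) 1 (nc p b + 1))
      else if a = 1 then gsmul (of_nat p) (eta (hook p 1) 1 1)
      else gsmul (of_nat p) (eta (hook p p) 1 1))"

definition idP :: "nat \<Rightarrow> nat \<Rightarrow> gam set \<Rightarrow> gam set" where
  "idP p k = restrict id (Pcar p k)"

definition lval :: "nat \<Rightarrow> nat" where
  "lval p = 2 * (p - 1)"

definition omega :: "nat \<Rightarrow> nat \<Rightarrow> nat" where
  "omega p i = (let r = i mod lval p in if r \<le> p - 2 then r + 1 else lval p - r)"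

text \<open>Carrier of the i-th term of the resolution (empty stands for the zero module
  when i < 0; homomorphisms out of it are then the unique zero map).\<close>
definition Ccar :: "nat \<Rightarrow> int \<Rightarrow> gam set set" where
  "Ccar p i = (if i < 0 then {} else Pcar p (omega p (nat i)))"

definition HomC :: "nat \<Rightarrow> int \<Rightarrow> nat \<Rightarrow> (gam set \<Rightarrow> gam set) set" where
  "HomC p s t = (if s < 0 then {\<lambda>_. undefined} else HomP p (omega p (nat s)) (omega p t))"

text \<open>A homogeneous element of degree z of A = Hom^z(P,P): a family of components
  g i : C_{i+z} \<rightarrow> C_i (i \<ge> 0).\<close>
type_synonym afam = "nat \<Rightarrow> gam set \<Rightarrow> gam set"

definition Adeg :: "nat \<Rightarrow> int \<Rightarrow> afam \<Rightarrow> bool" where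
  "Adeg p z g \<longleftrightarrow> (\<forall>i. g i \<in> HomC p (int i + z) i)"

definition zeroHom :: "nat \<Rightarrow> int \<Rightarrow> nat \<Rightarrow> gam set \<Rightarrow> gam set" where
  "zeroHom p s t = restrict (\<lambda>_. zcos p (omega p t)) (Ccar p s)"

definition zeroA :: "nat \<Rightarrow> int \<Rightarrow> afam" where
  "zeroA p z = (\<lambda>i. zeroHom p (int i + z) i)"

definition addA :: "nat \<Rightarrow> int \<Rightarrow> afam \<Rightarrow> afam \<Rightarrow> afam" where
  "addA p z g h = (\<lambda>i. restrict (\<lambda>X. cadd (g i X) (h i X)) (Ccar p (int i + z)))"

definition smulA :: "nat \<Rightarrow> int \<Rightarrow> int \<Rightarrow> afam \<Rightarrow> afam" where
  "smulA p z n g = (\<lambda>i. restrict (\<lambda>X. csmul n (g i X)) (Ccar p (int i + z)))"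

definition sumA :: "nat \<Rightarrow> int \<Rightarrow> afam list \<Rightarrow> afam" where
  "sumA p z gs = foldr (addA p z) gs (zeroA p z)"

definition compA :: "nat \<Rightarrow> int \<Rightarrow> afam \<Rightarrow> int \<Rightarrow> afam \<Rightarrow> afam" where
  "compA p zg g zh h = (\<lambda>i. if int i + zg < 0 then zeroHom p (int i + zg + zh) i
      else restrict (g i \<circ> h (nat (int i + zg))) (Ccar p (int i + zg + zh)))"

text \<open>The differential d (degree 1): component i is d_{i+1} = e_{omega(i),omega(i+1)}.\<close>
definition dfam :: "nat \<Rightarrow> afam" where
  "dfam p = (\<lambda>i. emap p (omega p i) (omega p (i + 1)))"

definition m1A :: "nat \<Rightarrow> int \<Rightarrow> afam \<Rightarrow> afam" where
  "m1A p z g = addA p (z + 1) (compA p 1 (dfam p) z g)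
                 (smulA p (z + 1) (- ((-1) ^ nat \<bar>z\<bar>)) (compA p z g 1 (dfam p)))"

definition mA :: "nat \<Rightarrow> (int \<times> afam) list \<Rightarrow> afam" where
  "mA p gs = (case gs of
      [(z, g)] \<Rightarrow> m1A p z g
    | [(z1, g1), (z2, g2)] \<Rightarrow> compA p z1 g1 z2 g2
    | _ \<Rightarrow> zeroA p (sum_list (map fst gs) + 2 - int (length gs)))"

definition unitA :: "nat \<Rightarrow> afam" where
  "unitA p = (\<lambda>i. idP p (omega p i))"

text \<open>iota (degree l) and its powers.\<close>
definition iota :: "nat \<Rightarrow> afam" where
  "iota p = (\<lambda>i. idP p (omega p i))"

primrec iota_pow :: "nat \<Rightarrow> nat \<Rightarrow> afam" where
  "iota_pow p 0 = unitA p"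
| "iota_pow p (Suc j) = compA p (int (lval p)) (iota p) (int (j * lval p)) (iota_pow p j)"

text \<open>chi (degree l-1).\<close>
definition chi :: "nat \<Rightarrow> afam" where
  "chi p = (\<lambda>y. let q = y mod lval p in
      if q = 0 then idP p 1
      else if q \<le> p - 2 then emap p (q + 1) q
      else if q = p - 1 then idP p (p - 1)
      else emap p (lval p - q) (lval p - q + 1))"

definition gamma_deg :: "nat \<Rightarrow> nat \<Rightarrow> int" where
  "gamma_deg p k = int k * (int (lval p) - 2) + 1"

definition gamma :: "nat \<Rightarrow> nat \<Rightarrow> afam" where
  "gamma p k = (\<lambda>y. if y mod lval p = k - 1 then idP p k
      else if y mod lval p = k + p - 2 then idP p (p - k)
      else zeroHom p (int y + gamma_deg p k) y)"

section \<open>The graded vector space H^*A, with basis labels (a, j) for chi^a iota^j\<close>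

type_synonym lab = "bool \<times> nat"
type_synonym 'a Hel = "lab \<Rightarrow>\<^sub>0 'a mod_ring"

definition hdeg :: "nat \<Rightarrow> lab \<Rightarrow> int" where
  "hdeg p ab = int (snd ab * lval p) + (if fst ab then int (lval p) - 1 else 0)"

definition homogH :: "nat \<Rightarrow> int \<Rightarrow> ('a::prime_card) Hel \<Rightarrow> bool" where
  "homogH p z x \<longleftrightarrow> (\<forall>b \<in> Poly_Mapping.keys x. hdeg p b = z)"

definition bvec :: "lab \<Rightarrow> ('a::prime_card) Hel" where
  "bvec b = Poly_Mapping.single b 1"

definition scaleH :: "('a::prime_card) mod_ring \<Rightarrow> 'a Hel \<Rightarrow> 'a Hel" where
  "scaleH c x = Poly_Mapping.map (\<lambda>v. c * v) x"

definition mb :: "nat \<Rightarrow> lab list \<Rightarrow> ('a::prime_card) Hel" where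
  "mb p ls = (if (\<exists>b \<in> set ls. \<not> fst b) then
        (if length ls = 2 then bvec (fst (ls!0) \<or> fst (ls!1), snd (ls!0) + snd (ls!1)) else 0)
      else (if length ls = p then
        scaleH ((-1) ^ p) (bvec (False, p - 1 + sum_list (map snd ls))) else 0))"

text \<open>Multilinear extension to (H^*A)^{\<otimes> n} (evaluated on elementary tensors).\<close>
fun mlinH :: "(lab list \<Rightarrow> ('a::prime_card) Hel) \<Rightarrow> 'a Hel list \<Rightarrow> 'a Hel" where
  "mlinH F [] = F []"
| "mlinH F (h # hs) = (\<Sum>b \<in> Poly_Mapping.keys h. scaleH (Poly_Mapping.lookup h b) (mlinH (\<lambda>ls. F (b # ls)) hs))"

definition mH :: "nat \<Rightarrow> ('a::prime_card) Hel list \<Rightarrow> 'a Hel" where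
  "mH p xs = mlinH (mb p) xs"

definition fb :: "nat \<Rightarrow> lab list \<Rightarrow> afam" where
  "fb p ls = (let n = length ls; J = sum_list (map snd ls);
      z = sum_list (map (hdeg p) ls) + 1 - int n in
      if n = 1 then
        (if fst (ls!0) then compA p (int (lval p) - 1) (chi p) (int (snd (ls!0) * lval p)) (iota_pow p (snd (ls!0)))
         else iota_pow p (snd (ls!0)))
      else if 2 \<le> n \<and> n \<le> p - 1 then
        (if (\<forall>b \<in> set ls. fst b) then
           smulA p z ((-1) ^ (n - 1)) (compA p (gamma_deg p n) (gamma p n) (int (J * lval p)) (iota_pow p J))
         else zeroA p z)
      else zeroA p z)"

fun mlinA :: "nat \<Rightarrow> int \<Rightarrow> (lab list \<Rightarrow> afam) \<Rightarrow> ('a::prime_card) Hel list \<Rightarrow> afam" where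
  "mlinA p z F [] = F []"
| "mlinA p z F (h # hs) = sumA p z (map (\<lambda>b. smulA p z (to_int_mod_ring (Poly_Mapping.lookup h b))
        (mlinA p z (\<lambda>ls. F (b # ls)) hs)) (sorted_list_of_set (Poly_Mapping.keys h)))"

text \<open>f_n applied to homogeneous x_1 \<otimes> ... \<otimes> x_n of degrees ds (output degree sum ds + 1 - n).\<close>
definition fA :: "nat \<Rightarrow> int list \<Rightarrow> ('a::prime_card) Hel list \<Rightarrow> afam" where
  "fA p ds xs = mlinA p (sum_list ds + 1 - int (length xs)) (fb p) xs"

section \<open>A-infinity relations (evaluated on homogeneous elementary tensors, Koszul signs)\<close>

definition sgn :: "int \<Rightarrow> int" where
  "sgn e = (if even e then 1 else -1)"

definition rst_triples :: "nat \<Rightarrow> (nat \<times> nat \<times> nat) list" where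
  "rst_triples k = concat (map (\<lambda>r. map (\<lambda>s. (r, s, k - r - s)) [1..<k - r + 1]) [0..<k + 1])"

function comps :: "nat \<Rightarrow> nat list list" where
  "comps n = (if n = 0 then [[]] else concat (map (\<lambda>i. map ((#) i) (comps (n - i))) [1..<Suc n]))"
  by auto
termination by (relation "measure id") auto

text \<open>The sign (-1)^{rs+t} times the Koszul sign of (1^r \<otimes> m_s \<otimes> 1^t).\<close>
definition sgn_rst :: "int list \<Rightarrow> nat \<Rightarrow> nat \<Rightarrow> nat \<Rightarrow> int" where
  "sgn_rst ds r s t = sgn (int (r * s + t) + (2 - int s) * sum_list (take r ds))"

definition Ainf_rel_H :: "nat \<Rightarrow> int list \<Rightarrow> ('a::prime_card) Hel list \<Rightarrow> 'a Hel" where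
  "Ainf_rel_H p ds xs = (\<Sum>(r, s, t) \<leftarrow> rst_triples (length xs).
      scaleH (of_int (sgn_rst ds r s t))
        (mH p (take r xs @ [mH p (take s (drop r xs))] @ drop (r + s) xs)))"

definition morph_lhs :: "nat \<Rightarrow> int list \<Rightarrow> ('a::prime_card) Hel list \<Rightarrow> afam" where
  "morph_lhs p ds xs = (let k = length xs; z = sum_list ds + 2 - int k in
     sumA p z (map (\<lambda>(r, s, t).
        smulA p z (sgn_rst ds r s t)
          (fA p (take r ds @ [sum_list (take s (drop r ds)) + 2 - int s] @ drop (r + s) ds)
                (take r xs @ [mH p (take s (drop r xs))] @ drop (r + s) xs)))
       (rst_triples k)))"

definition block_starts :: "nat list \<Rightarrow> nat list" where
  "block_starts is = map (\<lambda>s. sum_list (take s is)) [0..<length is]"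

text \<open>v = sum_{t<s} (1 - i_s) i_t, plus the Koszul sign of f_{i_1} \<otimes> ... \<otimes> f_{i_r}.\<close>
definition sgn_comp :: "int list \<Rightarrow> nat list \<Rightarrow> int" where
  "sgn_comp ds is = sgn (
      (\<Sum>s \<leftarrow> [0..<length is]. \<Sum>t \<leftarrow> [0..<s]. (1 - int (is ! s)) * int (is ! t))
    + (\<Sum>s \<leftarrow> [0..<length is]. (1 - int (is ! s)) * sum_list (take (block_starts is ! s) ds)))"

definition morph_rhs :: "nat \<Rightarrow> int list \<Rightarrow> ('a::prime_card) Hel list \<Rightarrow> afam" where
  "morph_rhs p ds xs = (let k = length xs; z = sum_list ds + 2 - int k in
     sumA p z (map (\<lambda>is.
        smulA p z (sgn_comp ds is)
          (mA p (map (\<lambda>s. let a = block_starts is ! s; bds = take (is ! s) (drop a ds) in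
                    (sum_list bds + 1 - int (is ! s), fA p bds (take (is ! s) (drop a xs))))
                 [0..<length is])))
       (comps k)))"

end

theory Submission
  imports Defs "HOL-Library.Function_Algebras" "HOL-Library.Product_Plus"
begin

text \<open>For idempotents e, f of Lambda a homomorphism from e Lambda / p to f Lambda / p is left multiplication
  by an element of f Lambda e, which is unique modulo p. For the idempotents of the P_k this corner is
  explicit: modulo p it has dimension 2 for f = e, dimension 1 for neighbouring indices and is 0 otherwise.
  So every graded endomorphism of the resolution becomes a family of at most two coordinates in F_p, and
  composition becomes a small multiplication table. In these coordinates iota^j, chi and d are periodic and
  almost constant, and the morphism relations reduce to the differential of gamma_n being the sum of the
  products of gamma_i and gamma_(n-i), and to that sum being iota^(p-1) for n = p. For the homology,
  the complex is exact in positive degrees, so a cycle is contracted step by step as soon as the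
  identity coordinate of its bottom component has been removed by a multiple of iota^j or chi iota^j.
  Homogeneous elements of H^*A are multiples of single basis labels, because distinct labels have distinct
  degrees; hence all relations need to be checked on basis tensors only.\<close>

subsection \<open>Standard tableaux of hook shape\<close>

text \<open>Elements of A are concrete functions on sets of cosets, \<open>undefined\<close> off
  their carriers, so the relations are equalities of such functions, and coordinates are faithful
  only up to entries that do not exist in the given corner. The hook ranks enter because n_lambda is
  a number of tableaux while Lambda is described by blocks; both must fit before a matrix unit can
  be placed in Gamma. The prime enters twice. (1) p * eta at lambda^1 is p * e_1 minus p * eta at
  lambda^2, so e_{1,1} has radical coordinate -1 while e_{p-1,p-1} has 1; these signs make chi a
  cycle. (2) Modulo l = 2(p-1), the support of gamma_a is the pair of residues a-1, a+p-2, and with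
  the pair for a = 1 these partition all residues. A product gamma_a gamma_b with a, b > 1 is
  nonzero only for a + b = p. So for n < p only products with chi survive, and they match the
  differential of gamma_n, whereas for n = p the p - 1 products cover each residue once.\<close>

lemma young_cells_hook:
  "young_cells (Suc a # replicate b (Suc 0)) = Pair 0 ` {0..a} \<union> (\<lambda>i. (i, 0)) ` {1..b}"
  by (auto simp: young_cells_def nth_Cons image_iff split: nat.splits)

lemma strict_sorted_map_upt:
  fixes f :: "nat \<Rightarrow> nat"
  assumes "\<And>i. \<lbrakk>m \<le> i; Suc i < n\<rbrakk> \<Longrightarrow> f i < f (Suc i)"
  shows "sorted_wrt (<) (map f [m..<n])"
  unfolding sorted_wrt_map
proof (rule sorted_wrt_mono_rel[where P = "\<lambda>i j. i < j"])
  fix x y assume xy: "x \<in> set [m..<n]" "y \<in> set [m..<n]" "x < y"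
  have "Suc x \<le> y \<Longrightarrow> y < n \<Longrightarrow> f x < f y"
  proof (induction y rule: dec_induct)
    case base then show ?case using assms[of x] xy by auto
  next
    case (step k) then show ?case using assms[of k] xy by force
  qed
  with xy show "f x < f y" by auto
qed simp

lemma map_upt_eq_sorted_list_of_set:
  fixes f :: "nat \<Rightarrow> nat"
  assumes "\<And>i. \<lbrakk>m \<le> i; Suc i < n\<rbrakk> \<Longrightarrow> f i < f (Suc i)"
  shows "map f [m..<n] = sorted_list_of_set (f ` {m..<n})"
proof (rule strict_sorted_equal)
  show "sorted_wrt (<) (map f [m..<n])" by (rule strict_sorted_map_upt) (rule assms)
qed auto

text \<open>The corner must carry 1, and arm and leg are increasing, so a tableau is determined by
  the set of entries of its leg; every \<open>b\<close>-subset of \<open>{2..?n}\<close> occurs as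
  such a set.\<close>

lemma card_SYT_hook: "card (SYT (Suc a # replicate b (Suc 0))) = (a + b) choose b"
proof -
  let ?lam = "Suc a # replicate b (Suc 0)"
  let ?n = "Suc (a + b)"
  let ?F = "\<lambda>T. (\<lambda>i. T (i, 0::nat)) ` {1..<Suc b} :: nat set"
  let ?X = "{S. S \<subseteq> {2..?n} \<and> card S = b}"
  have sum: "sum_list ?lam = ?n" by (simp add: sum_list_replicate)
  have cells: "(i, j) \<in> young_cells ?lam \<longleftrightarrow> i = 0 \<and> j \<le> a \<or> j = 0 \<and> 1 \<le> i \<and> i \<le> b" for i j
    unfolding young_cells_hook by auto
  have cU: "young_cells ?lam = Pair 0 ` {0..<Suc a} \<union> (\<lambda>i. (i, 0)) ` {1..<Suc b}"
    unfolding young_cells_hook by (simp add: atLeastLessThanSuc_atLeastAtMost)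
  have split: "(\<lambda>j. T (0, j)) ` {0..<Suc a} = {1..?n} - ?F T" (is ?A)
    and leg: "map (\<lambda>i. T (i, 0)) [1..<Suc b] = sorted_list_of_set (?F T)" (is ?B)
    and arm: "map (\<lambda>j. T (0, j)) [0..<Suc a] = sorted_list_of_set ({1..?n} - ?F T)" (is ?C)
    and FX: "?F T \<in> ?X" (is ?D)
    if T: "T \<in> SYT ?lam" for T
  proof -
    have bij: "bij_betw T (young_cells ?lam) {1..?n}"
      and row: "\<And>i j. (i, j + 1) \<in> young_cells ?lam \<Longrightarrow> T (i, j) < T (i, j + 1)"
      and col: "\<And>i j. (i + 1, j) \<in> young_cells ?lam \<Longrightarrow> T (i, j) < T (i + 1, j)"
      using T sum unfolding SYT_def by auto
    have im: "{1..?n} = (\<lambda>j. T (0, j)) ` {0..<Suc a} \<union> ?F T"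
      using bij_betw_imp_surj_on[OF bij] unfolding cU image_Un image_image by simp
    have disj: "(\<lambda>j. T (0, j)) ` {0..<Suc a} \<inter> ?F T = {}"
    proof -
      have "T (0, j) \<noteq> T (i, 0)" if "j < Suc a" "1 \<le> i" "i < Suc b" for i j
      proof
        assume "T (0, j) = T (i, 0)"
        moreover have "(0, j) \<in> young_cells ?lam" "(i, 0) \<in> young_cells ?lam"
          using that by (auto simp: cells)
        ultimately show False using bij_betw_imp_inj_on[OF bij] that by (auto dest!: inj_onD)
      qed
      then show ?thesis by auto
    qed
    show A: ?A using im disj by blast
    have legmono: "T (i, 0) < T (Suc i, 0)" if "Suc i < Suc b" for i
      using col[of i 0] that by (auto simp: cells)
    have armmono: "T (0, j) < T (0, Suc j)" if "Suc j < Suc a" for j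
      using row[of 0 j] that by (auto simp: cells)
    show ?B using legmono by (intro map_upt_eq_sorted_list_of_set) auto
    show ?C unfolding A[symmetric] using armmono by (intro map_upt_eq_sorted_list_of_set) auto
    have "inj_on (\<lambda>i. T (i, 0)) {1..<Suc b}"
    proof (rule inj_onI)
      fix i j assume "i \<in> {1..<Suc b}" "j \<in> {1..<Suc b}" "T (i, 0) = T (j, 0)"
      then show "i = j" using inj_onD[OF bij_betw_imp_inj_on[OF bij], of "(i, 0)" "(j, 0)"]
        by (simp add: cells)
    qed
    then have card: "card (?F T) = b" by (simp add: card_image)
    have T00: "1 \<le> T (0, 0)" using im by force
    have "sorted_wrt (<) (map (\<lambda>i. T (i, 0)) [0..<Suc b])"
      by (rule strict_sorted_map_upt) (use legmono in auto)
    then have "T (0, 0) < T (i, 0)" if "1 \<le> i" "i \<le> b" for i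
      using that by (simp add: sorted_wrt_iff_nth_less del: upt_Suc)
    then have "?F T \<subseteq> {2..?n}" using T00 im by fastforce
    then show ?D using card by simp
  qed
  have "bij_betw ?F (SYT ?lam) ?X"
  proof (rule bij_betw_imageI)
    show "inj_on ?F (SYT ?lam)"
    proof (rule inj_onI)
      fix T T' assume T: "T \<in> SYT ?lam" and T': "T' \<in> SYT ?lam" and eq: "?F T = ?F T'"
      have l: "T (i, 0) = T' (i, 0)" if "1 \<le> i" "i \<le> b" for i
      proof -
        have "map (\<lambda>i. T (i, 0)) [1..<Suc b] = map (\<lambda>i. T' (i, 0)) [1..<Suc b]"
          using leg[OF T] leg[OF T'] eq by simp
        then show ?thesis using that by (simp del: upt_Suc)
      qed
      have r: "T (0, j) = T' (0, j)" if "j \<le> a" for j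
      proof -
        have "map (\<lambda>i. T (0, i)) [0..<Suc a] = map (\<lambda>i. T' (0, i)) [0..<Suc a]"
          using arm[OF T] arm[OF T'] eq by simp
        then show ?thesis using that by (simp del: upt_Suc)
      qed
      show "T = T'"
      proof
        fix c :: "nat \<times> nat"
        obtain i j where c: "c = (i, j)" by (cases c)
        show "T c = T' c"
        proof (cases "c \<in> young_cells ?lam")
          case True then show ?thesis using l[of i] r[of j] c by (auto simp: cells)
        next
          case False then show ?thesis using T T' by (auto simp: SYT_def c)
        qed
      qed
    qed
    show "?F ` SYT ?lam = ?X"
    proof
      show "?F ` SYT ?lam \<subseteq> ?X" using FX by blast
      show "?X \<subseteq> ?F ` SYT ?lam"
      proof
        fix S assume "S \<in> ?X"
        then have S: "S \<subseteq> {2..?n}" "card S = b" by auto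
        then have fS: "finite S" using finite_subset by blast
        let ?R = "{1..?n} - S"
        have cR: "card ?R = Suc a"
          using S fS by (subst card_Diff_subset) (auto simp: subset_iff)
        define L where "L = sorted_list_of_set S"
        define M where "M = sorted_list_of_set ?R"
        have L: "length L = b" "set L = S" "sorted_wrt (<) L"
          using S fS by (auto simp: L_def)
        have M: "length M = Suc a" "set M = ?R" "sorted_wrt (<) M"
          using cR by (auto simp: M_def)
        define T where "T = (\<lambda>(i, j). if i = 0 \<and> j \<le> a then M ! j
          else if j = 0 \<and> 1 \<le> i \<and> i \<le> b then L ! (i - 1) else 0)"
        have Tl: "T (i, 0) = L ! (i - 1)" if "1 \<le> i" "i \<le> b" for i using that by (simp add: T_def)
        have Tr: "T (0, j) = M ! j" if "j \<le> a" for j using that by (simp add: T_def)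
        have imL: "?F T = S"
        proof -
          have S01: "{1..<Suc b} = Suc ` {0..<b}" by simp
          have "?F T = (\<lambda>i. L ! (i - 1)) ` {1..<Suc b}" using Tl by (intro image_cong) auto
          also have "\<dots> = (\<lambda>i. L ! i) ` {0..<b}"
            unfolding S01 image_image by simp
          also have "\<dots> = S" using L by (metis list.set_map map_nth set_upt)
          finally show ?thesis .
        qed
        have imR: "(\<lambda>j. T (0, j)) ` {0..<Suc a} = ?R"
        proof -
          have "(\<lambda>j. T (0, j)) ` {0..<Suc a} = (\<lambda>j. M ! j) ` {0..<Suc a}"
            using Tr by (intro image_cong) auto
          also have "\<dots> = ?R" using M by (metis list.set_map map_nth set_upt)
          finally show ?thesis .
        qed
        have im: "T ` young_cells ?lam = {1..?n}"
          unfolding cU image_Un image_image imL imR using S by auto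
        have "finite (young_cells ?lam)" unfolding cU by simp
        moreover have "card (young_cells ?lam) = card {1..?n}"
          unfolding cU by (subst card_Un_disjoint) (auto simp: card_image inj_on_def)
        ultimately have "bij_betw T (young_cells ?lam) {1..?n}"
          using im by (simp add: bij_betw_def eq_card_imp_inj_on)
        moreover have "T (i, j) < T (i, j + 1)" if "(i, j + 1) \<in> young_cells ?lam" for i j
          using that M by (auto simp: cells Tr sorted_wrt_iff_nth_less)
        moreover have "T (i, j) < T (i + 1, j)" if "(i + 1, j) \<in> young_cells ?lam" for i j
        proof (cases "i = 0")
          case True
          \<comment> \<open>\<open>S\<close> avoids 1, so the corner gets the entry 1; this is the
            only comparison between arm and leg.\<close>
          have "M ! 0 \<le> 1"
          proof -
            have "1 \<in> set M" using S M by auto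
            then obtain k where "k < length M" "M ! k = 1" by (metis in_set_conv_nth)
            then show ?thesis using sorted_wrt_nth_less[OF M(3), of 0 k] by (cases "k = 0") simp_all
          qed
          moreover have "2 \<le> L ! 0" if "1 \<le> b"
            using S L that nth_mem[of 0 L] by auto
          ultimately show ?thesis using that True by (auto simp: cells Tr Tl)
        next
          case False
          then show ?thesis using that L by (auto simp: cells Tl sorted_wrt_iff_nth_less)
        qed
        moreover have "T c = 0" if "c \<notin> young_cells ?lam" for c
          using that by (cases c) (auto simp: T_def cells)
        ultimately have "T \<in> SYT ?lam" unfolding SYT_def sum by blast
        then show "S \<in> ?F ` SYT ?lam" using imL by blast
      qed
    qed
  qed
  then have "card (SYT ?lam) = card ?X" by (rule bij_betw_same_card)
  also have "\<dots> = (a + b) choose b" by (subst n_subsets) auto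
  finally show ?thesis .
qed

lemma hook_eq: "\<lbrakk>1 \<le> k; k \<le> p\<rbrakk> \<Longrightarrow> hook p k = Suc (p - k) # replicate (k - 1) 1"
  by (simp add: hook_def)

lemma specht_rank_hook: "\<lbrakk>1 \<le> k; k \<le> p\<rbrakk> \<Longrightarrow> specht_rank (hook p k) = (p - 1) choose (k - 1)"
  using card_SYT_hook[of "p - k" "k - 1"] by (simp add: specht_rank_def hook_eq)

text \<open>Pascal's rule. It shows that the blocks c and b exhaust the rows and columns of the
  matrices at a hook, including the case of an empty block c.\<close>

lemma specht_rank_hook_blocks:
  assumes "1 \<le> k" "k \<le> p" "2 \<le> p"
  shows "specht_rank (hook p k) = nc p k + nb p k"
proof (cases "k = 1")
  case True then show ?thesis using assms by (simp add: specht_rank_hook nc_def nb_def)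
next
  case False
  then obtain j where k: "k = Suc (Suc j)" using assms by (intro that[of "k - 2"]) simp
  obtain q where q: "p = Suc (Suc q)" using assms(3) by (intro that[of "p - 2"]) simp
  show ?thesis using assms unfolding k q by (simp add: specht_rank_hook nc_def nb_def)
qed

lemma is_partition_hook: "\<lbrakk>1 \<le> k; k \<le> p\<rbrakk> \<Longrightarrow> is_partition p (hook p k)"
  by (auto simp: is_partition_def hook_def sorted_wrt_iff_nth_less nth_Cons' sum_list_replicate)

lemma hook_inject:
  assumes "1 \<le> k" "1 \<le> m"
  shows "hook p k = hook p m \<longleftrightarrow> k = m"
proof
  assume "hook p k = hook p m"
  then have "length (hook p k) = length (hook p m)" by simp
  then show "k = m" using assms by (simp add: hook_def)
qed simp

lemma nb_pos: "\<lbrakk>1 \<le> k; k < p\<rbrakk> \<Longrightarrow> 1 \<le> nb p k"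
  by (simp add: nb_def Suc_le_eq)

lemma nc_pos: "\<lbrakk>2 \<le> k; k \<le> p\<rbrakk> \<Longrightarrow> 1 \<le> nc p k"
  by (simp add: nc_def Suc_le_eq)

subsection \<open>The localisation at p and its residue field\<close>

type_synonym 'a coord = "'a mod_ring \<times> 'a mod_ring"

text \<open>The parameter \<open>ty\<close> fixes a type of cardinality p, so that F_p is available
  as \<open>'p mod_ring\<close>.\<close>

locale symmetric_group_prime =
  fixes p :: nat and ty :: "'p::prime_card itself"
  assumes p_card: "p = CARD('p)" and p_ge_3: "p \<ge> 3"
begin

lemma prime_p: "prime (int p)"
  using prime_card_int[where 'a = 'p] p_card by simp

lemma of_int_eq_0_mod_ring: "of_int a = (0 :: 'p mod_ring) \<longleftrightarrow> int p dvd a"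
  using of_int_eq_0_iff_char_dvd[where 'a = "'p mod_ring", of a] p_card by simp

lemma of_nat_p_eq_0: "of_nat p = (0 :: 'p mod_ring)"
  using of_int_eq_0_mod_ring[of "int p"] by simp

definition red :: "rat \<Rightarrow> 'p mod_ring" where
  "red q = of_int (fst (quotient_of q)) / of_int (snd (quotient_of q))"

text \<open>A set-theoretic section of \<open>red\<close>, compatible neither with addition nor with
  multiplication; identities between coordinates are therefore proved over Z_(p) and transported by
  \<open>red\<close>.\<close>

definition rep :: "'p mod_ring \<Rightarrow> rat" where
  "rep c = of_int (to_int_mod_ring c)"

lemma Zloc_cases:
  assumes "x \<in> Zloc p"
  obtains a b where "\<not> int p dvd b" "x = of_int a / of_int b" "red x = of_int a / of_int b"
proof -
  obtain a b where ab: "quotient_of x = (a, b)" by (cases "quotient_of x")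
  show thesis
    by (rule that[of b a]) (use assms ab quotient_of_div[OF ab] in \<open>auto simp: Zloc_def red_def\<close>)
qed

text \<open>\<open>Zloc\<close> and \<open>red\<close> look at the reduced fraction. Any
  representation with denominator prime to p serves as well, since the reduced denominator divides
  it; hence sums and products can be computed without cancelling.\<close>

lemma
  assumes b: "\<not> int p dvd b"
  shows frac_in_Zloc: "of_int a / of_int b \<in> Zloc p"
    and red_frac: "red (of_int a / of_int b) = of_int a / of_int b"
proof -
  obtain c d where cd: "quotient_of (of_int a / of_int b :: rat) = (c, d)" by fastforce
  have b0: "b \<noteq> 0" using b by auto
  have d0: "d > 0" using quotient_of_denom_pos[OF cd] .
  have "(of_int a :: rat) / of_int b = of_int c / of_int d" using quotient_of_div[OF cd] .
  then have "(of_int (a * d) :: rat) = of_int (c * b)" using b0 d0 by (simp add: field_simps)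
  then have eq: "a * d = c * b" by (simp only: of_int_eq_iff)
  then have "d dvd c * b" by (metis dvd_triv_right)
  then have "d dvd b" using quotient_of_coprime[OF cd] coprime_commute coprime_dvd_mult_right_iff by blast
  then have d: "\<not> int p dvd d" using b by (meson dvd_trans)
  then show "of_int a / of_int b \<in> Zloc p" by (simp add: Zloc_def cd)
  have "of_int a * of_int d = (of_int c * of_int b :: 'p mod_ring)"
    using arg_cong[OF eq, of "of_int :: _ \<Rightarrow> 'p mod_ring"] by simp
  moreover have "of_int b \<noteq> (0 :: 'p mod_ring)" "of_int d \<noteq> (0 :: 'p mod_ring)"
    using b d by (simp_all add: of_int_eq_0_mod_ring)
  ultimately show "red (of_int a / of_int b) = of_int a / of_int b"
    by (simp add: red_def cd field_simps)
qed

lemma not_dvd_1: "\<not> int p dvd 1"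
  using prime_p by (auto simp: zdvd1_eq p_ge_3)

lemma Zloc_of_int [simp]: "of_int a \<in> Zloc p" and red_of_int [simp]: "red (of_int a) = of_int a"
  using frac_in_Zloc[OF not_dvd_1, of a] red_frac[OF not_dvd_1, of a] by simp_all

lemma Zloc_0 [simp]: "0 \<in> Zloc p" and red_0 [simp]: "red 0 = 0"
  using Zloc_of_int[of 0] red_of_int[of 0] by simp_all

lemma Zloc_1 [simp]: "1 \<in> Zloc p" and red_1 [simp]: "red 1 = 1"
  using Zloc_of_int[of 1] red_of_int[of 1] by simp_all

lemma Zloc_p [simp]: "of_nat p \<in> Zloc p" and red_p [simp]: "red (of_nat p) = 0"
  using Zloc_of_int[of "int p"] red_of_int[of "int p"] by (simp_all add: of_nat_p_eq_0)

lemma Zloc_rep [simp]: "rep c \<in> Zloc p" and red_rep [simp]: "red (rep c) = c"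
  by (simp_all add: rep_def of_int_of_int_mod_ring)

lemma
  assumes "x \<in> Zloc p" "y \<in> Zloc p"
  shows Zloc_add [simp]: "x + y \<in> Zloc p" and red_add [simp]: "red (x + y) = red x + red y"
    and Zloc_mult [simp]: "x * y \<in> Zloc p" and red_mult [simp]: "red (x * y) = red x * red y"
proof -
  obtain a b where x: "\<not> int p dvd b" "x = of_int a / of_int b" "red x = of_int a / of_int b"
    using Zloc_cases[OF assms(1)] .
  obtain c d where y: "\<not> int p dvd d" "y = of_int c / of_int d" "red y = of_int c / of_int d"
    using Zloc_cases[OF assms(2)] .
  have bd: "\<not> int p dvd b * d" using x y prime_p by (simp add: prime_dvd_mult_iff)
  have nz: "b \<noteq> 0" "d \<noteq> 0" "of_int b \<noteq> (0 :: 'p mod_ring)" "of_int d \<noteq> (0 :: 'p mod_ring)"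
    using x y by (auto simp: of_int_eq_0_mod_ring)
  have s: "x + y = of_int (a * d + c * b) / of_int (b * d)"
    and m: "x * y = of_int (a * c) / of_int (b * d)"
    using nz(1,2) by (simp_all add: x(2) y(2) add_frac_eq)
  show "x + y \<in> Zloc p" unfolding s by (rule frac_in_Zloc[OF bd])
  show "x * y \<in> Zloc p" unfolding m by (rule frac_in_Zloc[OF bd])
  have "red (x + y) = of_int (a * d + c * b) / of_int (b * d)" unfolding s by (rule red_frac[OF bd])
  also have "\<dots> = red x + red y" using nz(3,4) by (simp add: x(3) y(3) add_frac_eq)
  finally show "red (x + y) = red x + red y" .
  have "red (x * y) = of_int (a * c) / of_int (b * d)" unfolding m by (rule red_frac[OF bd])
  also have "\<dots> = red x * red y" by (simp add: x(3) y(3))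
  finally show "red (x * y) = red x * red y" .
qed

lemma
  assumes "x \<in> Zloc p"
  shows Zloc_uminus [simp]: "- x \<in> Zloc p" and red_uminus [simp]: "red (- x) = - red x"
proof -
  have "- 1 \<in> Zloc p" "red (- 1) = - 1" using Zloc_of_int[of "- 1"] red_of_int[of "- 1"] by simp_all
  then show "- x \<in> Zloc p" "red (- x) = - red x"
    using Zloc_mult[of "- 1" x] red_mult[of "- 1" x] assms by simp_all
qed

lemma
  assumes "x \<in> Zloc p" "y \<in> Zloc p"
  shows Zloc_diff [simp]: "x - y \<in> Zloc p" and red_diff [simp]: "red (x - y) = red x - red y"
  using Zloc_add[of x "- y"] red_add[of x "- y"] assms by (simp_all del: red_add Zloc_add)

lemma
  assumes "\<And>i. i \<in> I \<Longrightarrow> f i \<in> Zloc p"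
  shows Zloc_sum: "sum f I \<in> Zloc p" and red_sum: "red (sum f I) = (\<Sum>i\<in>I. red (f i))"
proof -
  have "sum f I \<in> Zloc p \<and> red (sum f I) = (\<Sum>i\<in>I. red (f i))" using assms
    by (induction I rule: infinite_finite_induct) auto
  then show "sum f I \<in> Zloc p" "red (sum f I) = (\<Sum>i\<in>I. red (f i))" by auto
qed

lemma p_pos: "p > 0" using p_ge_3 by simp

text \<open>The kernel of \<open>red\<close> is p Z_(p), so congruences modulo p become equations in
  F_p and divisibility by p can be read off there.\<close>

lemma red_eq_0_iff:
  assumes "x \<in> Zloc p"
  shows "red x = 0 \<longleftrightarrow> x / of_nat p \<in> Zloc p"
proof
  assume "x / of_nat p \<in> Zloc p"
  then have "red (of_nat p * (x / of_nat p)) = 0" by (subst red_mult) simp_all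
  then show "red x = 0" using p_pos by simp
next
  assume 0: "red x = 0"
  obtain a b where x: "\<not> int p dvd b" "x = of_int a / of_int b" "red x = of_int a / of_int b"
    using Zloc_cases[OF assms] .
  then have "int p dvd a" using 0 by (auto simp: of_int_eq_0_mod_ring)
  then obtain c where "a = int p * c" by auto
  then have "x / of_nat p = of_int c / of_int b" using x(2) p_pos by simp
  then show "x / of_nat p \<in> Zloc p" using frac_in_Zloc[OF x(1)] by simp
qed

lemma congp_iff:
  assumes "x \<in> Zloc p" "y \<in> Zloc p"
  shows "congp p x y \<longleftrightarrow> red x = red y"
  using red_eq_0_iff[of "x - y"] assms by (simp add: congp_def)

end

subsection \<open>The order Lambda\<close>

lemma gadd_eq_plus: "gadd x y = x + y"
  by (simp add: gadd_def fun_eq_iff)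

lemma gsmul_apply: "gsmul c x lam i j = c * x lam i j"
  by (simp add: gsmul_def)

lemma gsmul_simps:
  "gsmul c (x + y) = gsmul c x + gsmul c y"
  "gsmul c (x - y) = gsmul c x - gsmul c y"
  "gsmul (c * d) x = gsmul c (gsmul d x)"
  "gsmul c 0 = 0" "gsmul 0 x = 0" "gsmul 1 x = x" "gsmul (- 1) x = - x"
  by (simp_all add: gsmul_def fun_eq_iff algebra_simps)

lemma gsmul_add_left: "gsmul (c + d) x = gsmul c x + gsmul d x"
  by (simp add: gsmul_def fun_eq_iff algebra_simps)

lemma gmul_bilinear:
  "gmul (x + y) z = gmul x z + gmul y z" "gmul z (x + y) = gmul z x + gmul z y"
  "gmul (x - y) z = gmul x z - gmul y z" "gmul z (x - y) = gmul z x - gmul z y"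
  "gmul (gsmul c x) z = gsmul c (gmul x z)" "gmul z (gsmul c x) = gsmul c (gmul z x)"
  "gmul 0 z = 0" "gmul z 0 = 0"
  by (simp_all add: gmul_def gsmul_def fun_eq_iff algebra_simps sum.distrib sum_subtractf sum_distrib_left)

lemma gmul_assoc: "gmul (gmul x y) z = gmul x (gmul y z)"
proof (intro ext)
  fix lam i j
  let ?R = "{1..specht_rank lam}"
  have "gmul (gmul x y) z lam i j = (\<Sum>k\<in>?R. \<Sum>l\<in>?R. x lam i l * y lam l k * z lam k j)"
    by (simp add: gmul_def sum_distrib_right)
  also have "\<dots> = (\<Sum>l\<in>?R. \<Sum>k\<in>?R. x lam i l * y lam l k * z lam k j)" by (rule sum.swap)
  also have "\<dots> = gmul x (gmul y z) lam i j"
    by (simp add: gmul_def sum_distrib_left mult.assoc)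
  finally show "gmul (gmul x y) z lam i j = gmul x (gmul y z) lam i j" .
qed

lemma gmul_eta_left:
  "gmul (eta mu a b) y = (\<lambda>lam i j. if lam = mu \<and> i = a \<and> 1 \<le> b \<and> b \<le> specht_rank mu then y mu b j else 0)"
proof (intro ext)
  fix lam i j
  have "gmul (eta mu a b) y lam i j = (\<Sum>k = 1..specht_rank lam. if k = b then (if lam = mu \<and> i = a then y lam k j else 0) else 0)"
    unfolding gmul_def eta_def by (intro sum.cong) auto
  then show "gmul (eta mu a b) y lam i j = (if lam = mu \<and> i = a \<and> 1 \<le> b \<and> b \<le> specht_rank mu then y mu b j else 0)"
    by (simp add: sum.delta)
qed

lemma gmul_eta_right:
  "gmul y (eta mu a b) = (\<lambda>lam i j. if lam = mu \<and> j = b \<and> 1 \<le> a \<and> a \<le> specht_rank mu then y mu i a else 0)"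
proof (intro ext)
  fix lam i j
  have "gmul y (eta mu a b) lam i j = (\<Sum>k = 1..specht_rank lam. if k = a then (if lam = mu \<and> j = b then y lam i k else 0) else 0)"
    unfolding gmul_def eta_def by (intro sum.cong) auto
  then show "gmul y (eta mu a b) lam i j = (if lam = mu \<and> j = b \<and> 1 \<le> a \<and> a \<le> specht_rank mu then y mu i a else 0)"
    by (simp add: sum.delta)
qed

lemma gmul_eta_eta:
  "gmul (eta lam i j) (eta mu k l) = (if lam = mu \<and> j = k \<and> 1 \<le> j \<and> j \<le> specht_rank lam then eta lam i l else 0)"
  unfolding gmul_eta_left by (auto simp: eta_def fun_eq_iff)

context symmetric_group_prime
begin

lemma rank_hook: "\<lbrakk>1 \<le> k; k \<le> p\<rbrakk> \<Longrightarrow> specht_rank (hook p k) = nc p k + nb p k"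
  using specht_rank_hook_blocks p_ge_3 by simp

lemma nc_Suc: "1 \<le> k \<Longrightarrow> nc p (Suc k) = nb p k"
  by (simp add: nc_def nb_def)

lemma Gam_Zloc: "x \<in> Gam p \<Longrightarrow> x lam i j \<in> Zloc p"
  unfolding Gam_def by blast

lemma Lam_Gam: "x \<in> Lam p \<Longrightarrow> x \<in> Gam p"
  unfolding Lam_def by blast

lemma Lam_Zloc: "x \<in> Lam p \<Longrightarrow> x lam i j \<in> Zloc p"
  by (rule Gam_Zloc[OF Lam_Gam])

lemma Lam_iff: "x \<in> Lam p \<longleftrightarrow> x \<in> Gam p
  \<and> (\<forall>k i j. 1 \<le> k \<and> k < p \<and> 1 \<le> i \<and> i \<le> nb p k \<and> 1 \<le> j \<and> j \<le> nb p k \<longrightarrow>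
        red (x (hook p k) (nc p k + i) (nc p k + j)) = red (x (hook p (Suc k)) i j))
  \<and> (\<forall>k i j. 1 \<le> k \<and> k \<le> p \<and> 1 \<le> i \<and> i \<le> nc p k \<and> nc p k + 1 \<le> j \<and> j \<le> nc p k + nb p k \<longrightarrow>
        red (x (hook p k) i j) = 0)"
proof (cases "x \<in> Gam p")
  case True
  then have Z: "x lam i j \<in> Zloc p" for lam i j by (simp add: Gam_Zloc)
  have E: "k \<in> {1..p - 1} \<longleftrightarrow> 1 \<le> k \<and> k < p" "k \<in> {1..p} \<longleftrightarrow> 1 \<le> k \<and> k \<le> p" for k
    using p_ge_3 by auto
  show ?thesis using True
    unfolding Lam_def mem_Collect_eq congp_iff[OF Z Z] congp_iff[OF Z Zloc_0] Ball_def E red_0 Suc_eq_plus1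
    by blast
next
  case False
  then show ?thesis unfolding Lam_def by blast
qed

lemma Gam_add: "\<lbrakk>x \<in> Gam p; y \<in> Gam p\<rbrakk> \<Longrightarrow> x + y \<in> Gam p"
  by (simp add: Gam_def)

lemma Gam_gsmul: "\<lbrakk>c \<in> Zloc p; x \<in> Gam p\<rbrakk> \<Longrightarrow> gsmul c x \<in> Gam p"
  by (simp add: Gam_def gsmul_def)

lemma Gam_gmul: "\<lbrakk>x \<in> Gam p; y \<in> Gam p\<rbrakk> \<Longrightarrow> gmul x y \<in> Gam p"
  by (auto simp: Gam_def gmul_def intro!: Zloc_sum sum.neutral)

lemma Lam_add: "\<lbrakk>x \<in> Lam p; y \<in> Lam p\<rbrakk> \<Longrightarrow> x + y \<in> Lam p"
  by (auto simp: Lam_iff Gam_add Gam_Zloc)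

lemma Lam_gsmul: "\<lbrakk>c \<in> Zloc p; x \<in> Lam p\<rbrakk> \<Longrightarrow> gsmul c x \<in> Lam p"
  by (auto simp: Lam_iff Gam_gsmul gsmul_apply Gam_Zloc)

lemma Lam_0: "0 \<in> Lam p"
  by (simp add: Lam_iff Gam_def)

lemma Lam_diff: "\<lbrakk>x \<in> Lam p; y \<in> Lam p\<rbrakk> \<Longrightarrow> x - y \<in> Lam p"
  using Lam_add[of x "gsmul (-1) y"] Lam_gsmul[of "-1" y] by (simp add: gsmul_simps)

lemma red_gmul_hook:
  assumes "x \<in> Gam p" "y \<in> Gam p" "1 \<le> k" "k \<le> p"
  shows "red (gmul x y (hook p k) i j) =
    (\<Sum>t = 1..nc p k. red (x (hook p k) i t) * red (y (hook p k) t j)) +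
    (\<Sum>t = 1..nb p k. red (x (hook p k) i (nc p k + t)) * red (y (hook p k) (nc p k + t) j))"
proof -
  let ?f = "\<lambda>t. red (x (hook p k) i t) * red (y (hook p k) t j)"
  have 1: "red (gmul x y (hook p k) i j) = sum ?f {1..nc p k + nb p k}"
    using assms unfolding gmul_def by (subst red_sum) (simp_all add: Gam_Zloc rank_hook)
  have 2: "sum ?f {1..nc p k + nb p k} = sum ?f {1..nc p k} + sum ?f {nc p k + 1..nc p k + nb p k}"
    by (rule sum.ub_add_nat) simp
  have 3: "sum ?f {nc p k + 1..nc p k + nb p k} = (\<Sum>t = 1..nb p k. ?f (nc p k + t))"
    by (rule sum.reindex_bij_witness[of _ "\<lambda>t. nc p k + t" "\<lambda>t. t - nc p k"]) auto
  show ?thesis unfolding 1 2 3 ..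
qed

text \<open>Modulo p every hook component is block lower triangular, because the block bc vanishes.
  The diagonal blocks of a product are then products of diagonal blocks, which preserves the
  matching of bb at one hook with cc at the next.\<close>

lemma Lam_gmul:
  assumes x: "x \<in> Lam p" and y: "y \<in> Lam p"
  shows "gmul x y \<in> Lam p"
proof -
  note g = red_gmul_hook[OF Lam_Gam[OF x] Lam_Gam[OF y]]
  have x1: "red (x (hook p k) (nc p k + i) (nc p k + j)) = red (x (hook p (Suc k)) i j)"
   and y1: "red (y (hook p k) (nc p k + i) (nc p k + j)) = red (y (hook p (Suc k)) i j)"
    if "1 \<le> k" "k < p" "1 \<le> i" "i \<le> nb p k" "1 \<le> j" "j \<le> nb p k" for k i j
    using x y that by (simp_all add: Lam_iff)
  have x2: "red (x (hook p k) i j) = 0" and y2: "red (y (hook p k) i j) = 0"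
    if "1 \<le> k" "k \<le> p" "1 \<le> i" "i \<le> nc p k" "nc p k + 1 \<le> j" "j \<le> nc p k + nb p k" for k i j
    using x y that by (simp_all add: Lam_iff)
  show ?thesis unfolding Lam_iff
  proof (intro conjI allI impI; (elim conjE)?)
    show "gmul x y \<in> Gam p" using x y by (simp add: Gam_gmul Lam_Gam)
    fix k i j assume k: "1 \<le> k" "k < p" and i: "1 \<le> i" "i \<le> nb p k" and j: "1 \<le> j" "j \<le> nb p k"
    have "red (gmul x y (hook p k) (nc p k + i) (nc p k + j)) =
      (\<Sum>t = 1..nb p k. red (x (hook p (Suc k)) i t) * red (y (hook p (Suc k)) t j))"
      using k i j by (simp add: g x1 y1 y2)
    also have "\<dots> = red (gmul x y (hook p (Suc k)) i j)"
      using k i j by (simp add: g nc_Suc x2)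
    finally show "red (gmul x y (hook p k) (nc p k + i) (nc p k + j)) = red (gmul x y (hook p (Suc k)) i j)" .
  next
    fix k i j assume "1 \<le> k" "k \<le> p" "1 \<le> i" "i \<le> nc p k" "nc p k + 1 \<le> j" "j \<le> nc p k + nb p k"
    then show "red (gmul x y (hook p k) i j) = 0" by (simp add: g x2 y2)
  qed
qed

lemma eta_Gam: "\<lbrakk>1 \<le> k; k \<le> p; 1 \<le> i; i \<le> nc p k + nb p k; 1 \<le> j; j \<le> nc p k + nb p k\<rbrakk> \<Longrightarrow>
    eta (hook p k) i j \<in> Gam p"
  by (simp add: Gam_def eta_def is_partition_hook rank_hook)

lemma p_eta_Lam:
  assumes "1 \<le> k" "k \<le> p" "1 \<le> i" "i \<le> nc p k + nb p k" "1 \<le> j" "j \<le> nc p k + nb p k"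
  shows "gsmul (of_nat p) (eta (hook p k) i j) \<in> Lam p"
  using Gam_gsmul[OF Zloc_p eta_Gam[OF assms]]
  by (simp add: Lam_iff gsmul_apply eta_def)

text \<open>The lower-left block is unconstrained in Lambda, which is why the map raising the index
  carries no factor p while the one lowering it does.\<close>

lemma eta_cb_Lam:
  assumes "2 \<le> k" "k < p"
  shows "eta (hook p k) (nc p k + 1) 1 \<in> Lam p"
  using assms eta_Gam[of k "nc p k + 1" 1] nb_pos[of k p] nc_pos[of k p]
  by (auto simp: Lam_iff eta_def hook_inject nc_Suc)

lemma etil_Lam:
  assumes "1 \<le> k" "k < p"
  shows "etil p k \<in> Lam p"
proof -
  have "etil p k \<in> Gam p" unfolding etil_def gadd_eq_plus
    using assms eta_Gam[of k "nc p k + 1" "nc p k + 1"] eta_Gam[of "Suc k" 1 1] nb_pos[of k p] nc_pos[of "Suc k" p]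
    by (intro Gam_add) auto
  then show ?thesis using assms nc_pos[of "Suc k" p]
    by (auto simp: Lam_iff etil_def gadd_def eta_def hook_inject nc_Suc)
qed

lemma gmul_etil_left:
  assumes "1 \<le> k" "k < p"
  shows "gmul (etil p k) y = (\<lambda>lam i j. if lam = hook p k \<and> i = nc p k + 1 \<or> lam = hook p (Suc k) \<and> i = 1
    then y lam i j else 0)"
  using assms nb_pos[of k p] nc_pos[of "Suc k" p]
  by (auto simp: etil_def gadd_eq_plus gmul_bilinear gmul_eta_left fun_eq_iff hook_inject rank_hook)

lemma gmul_etil_right:
  assumes "1 \<le> k" "k < p"
  shows "gmul y (etil p k) = (\<lambda>lam i j. if lam = hook p k \<and> j = nc p k + 1 \<or> lam = hook p (Suc k) \<and> j = 1
    then y lam i j else 0)"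
  using assms nb_pos[of k p] nc_pos[of "Suc k" p]
  by (auto simp: etil_def gadd_eq_plus gmul_bilinear gmul_eta_right fun_eq_iff hook_inject rank_hook)

lemma etil_idem: "\<lbrakk>1 \<le> k; k < p\<rbrakk> \<Longrightarrow> gmul (etil p k) (etil p k) = etil p k"
  unfolding gmul_etil_left by (auto simp: fun_eq_iff etil_def gadd_def eta_def)

subsection \<open>Homomorphisms between the projective modules\<close>

abbreviation q :: rat where "q \<equiv> of_nat p"

definition corner :: "nat \<Rightarrow> nat \<Rightarrow> gam set" where
  "corner m k = {x \<in> Lam p. gmul (etil p m) x = x \<and> gmul x (etil p k) = x}"

text \<open>Normal form of an element of the corner between two of the idempotents. For m = k the coordinates A, B
  refer to the idempotent and to the radical element p eta; for m and k neighbouring only A is used.\<close>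
definition mt :: "nat \<Rightarrow> nat \<Rightarrow> rat \<Rightarrow> rat \<Rightarrow> gam" where
  "mt m k A B = (if m = k then gsmul A (etil p k) + gsmul (B * q) (eta (hook p (Suc k)) 1 1)
    else if k = Suc m then gsmul (A * q) (eta (hook p k) 1 (nc p k + 1))
    else if m = Suc k then gsmul A (eta (hook p m) (nc p m + 1) 1) else 0)"

lemma etil_apply: "\<lbrakk>1 \<le> k; k < p\<rbrakk> \<Longrightarrow> etil p k lam i j =
    (if lam = hook p k \<and> i = nc p k + 1 \<and> j = nc p k + 1 \<or> lam = hook p (Suc k) \<and> i = 1 \<and> j = 1 then 1 else 0)"
  by (auto simp: etil_def gadd_def eta_def hook_inject)

lemma p_neq_0 [simp]: "p \<noteq> 0" using p_pos by simp

lemma mt_corner: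
  assumes "1 \<le> m" "m < p" "1 \<le> k" "k < p" "A \<in> Zloc p" "B \<in> Zloc p"
  shows "mt m k A B \<in> corner m k"
proof -
  have L: "mt m k A B \<in> Lam p"
  proof -
    have "gsmul (B * q) (eta (hook p (Suc k)) 1 1) \<in> Lam p"
      using Lam_gsmul[OF assms(6) p_eta_Lam[of "Suc k" 1 1]] assms nc_pos[of "Suc k" p]
      by (simp add: gsmul_simps)
    moreover have "gsmul (A * q) (eta (hook p k) 1 (nc p k + 1)) \<in> Lam p"
      using Lam_gsmul[OF assms(5) p_eta_Lam[of "k" 1 "nc p k + 1"]] assms nb_pos[of k p]
      by (simp add: gsmul_simps)
    moreover have "gsmul A (eta (hook p m) (nc p m + 1) 1) \<in> Lam p" if "m = Suc k"
      using Lam_gsmul[OF assms(5) eta_cb_Lam[of m]] assms that by simp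
    moreover have "gsmul A (etil p k) \<in> Lam p" using assms by (simp add: Lam_gsmul etil_Lam)
    ultimately show ?thesis unfolding mt_def by (auto intro!: Lam_add Lam_0)
  qed
  have "gmul (etil p m) (mt m k A B) = mt m k A B"
    unfolding gmul_etil_left[OF assms(1,2)]
    by (auto simp: mt_def fun_eq_iff gsmul_def eta_def etil_apply[OF assms(3,4)])
  moreover have "gmul (mt m k A B) (etil p k) = mt m k A B"
    unfolding gmul_etil_right[OF assms(3,4)]
    by (auto simp: mt_def fun_eq_iff gsmul_def eta_def etil_apply[OF assms(3,4)])
  ultimately show ?thesis using L by (simp add: corner_def)
qed

lemma Lam_bb:
  assumes "x \<in> Lam p" "1 \<le> k" "k < p"
  shows "red (x (hook p k) (nc p k + 1) (nc p k + 1)) = red (x (hook p (Suc k)) 1 1)"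
  using assms nb_pos[OF assms(2,3)] unfolding Lam_iff by blast

lemma Lam_bc:
  assumes "x \<in> Lam p" "2 \<le> k" "k < p"
  shows "red (x (hook p k) 1 (nc p k + 1)) = 0"
proof -
  have "1 \<le> k" "k \<le> p" "1 \<le> nc p k" "nc p k + 1 \<le> nc p k + 1" "nc p k + 1 \<le> nc p k + nb p k"
    using assms nb_pos[of k p] nc_pos[of k p] by auto
  then show ?thesis using assms(1) unfolding Lam_iff by (meson order_refl)
qed

lemma red_eq_0_div: "\<lbrakk>x \<in> Zloc p; red x = 0\<rbrakk> \<Longrightarrow> x / q \<in> Zloc p"
  by (simp add: red_eq_0_iff)

text \<open>The idempotents leave only entries where a row of \<open>m\<close> meets a column of
  \<open>k\<close> in a common matrix. For \<open>m = k\<close> there are two, congruent modulo p,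
  and their difference divided by p is the second coordinate; for \<open>k = Suc m\<close> the
  single entry lies in block bc and is divisible by p; for \<open>m = Suc k\<close> it is
  arbitrary.\<close>

lemma corner_mt:
  assumes m: "1 \<le> m" "m < p" and k: "1 \<le> k" "k < p" and x: "x \<in> corner m k"
  obtains A B where "A \<in> Zloc p" "B \<in> Zloc p" "x = mt m k A B"
proof -
  have xL: "x \<in> Lam p" and l: "gmul (etil p m) x = x" and r: "gmul x (etil p k) = x"
    using x by (simp_all add: corner_def)
  note Z = Lam_Zloc[OF xL]
  have supp: "x lam i j = 0"
    if "\<not> ((lam = hook p m \<and> i = nc p m + 1 \<or> lam = hook p (Suc m) \<and> i = 1)
      \<and> (lam = hook p k \<and> j = nc p k + 1 \<or> lam = hook p (Suc k) \<and> j = 1))" for lam i j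
  proof (cases "lam = hook p m \<and> i = nc p m + 1 \<or> lam = hook p (Suc m) \<and> i = 1")
    case True
    then show ?thesis using that fun_cong[OF fun_cong[OF fun_cong[OF r, of lam], of i], of j]
      unfolding gmul_etil_right[OF k] by (auto split: if_splits)
  next
    case False
    then show ?thesis using fun_cong[OF fun_cong[OF fun_cong[OF l, of lam], of i], of j]
      unfolding gmul_etil_left[OF m] by (auto split: if_splits)
  qed
  have hi: "hook p m = hook p k \<longleftrightarrow> m = k" "hook p (Suc m) = hook p k \<longleftrightarrow> Suc m = k"
    "hook p m = hook p (Suc k) \<longleftrightarrow> m = Suc k" "hook p (Suc m) = hook p (Suc k) \<longleftrightarrow> m = k"
    using m k by (simp_all add: hook_inject)
  consider "m = k" | "k = Suc m" | "m = Suc k" | "m \<noteq> k" "k \<noteq> Suc m" "m \<noteq> Suc k" by blast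
  then show thesis
  proof cases
    case 1
    define A where "A = x (hook p k) (nc p k + 1) (nc p k + 1)"
    define C where "C = x (hook p (Suc k)) 1 1"
    have hk: "hook p k \<noteq> hook p (Suc k)" using k by (simp add: hook_inject)
    have "red A = red C" unfolding A_def C_def by (rule Lam_bb[OF xL k])
    moreover have AC: "A \<in> Zloc p" "C \<in> Zloc p" by (simp_all add: A_def C_def Z)
    ultimately have "(C - A) / q \<in> Zloc p" by (intro red_eq_0_div) simp_all
    moreover have "x = mt m k A ((C - A) / q)"
    proof (intro ext)
      fix lam i j show "x lam i j = mt m k A ((C - A) / q) lam i j"
      proof (cases "(lam = hook p k \<and> i = nc p k + 1 \<and> j = nc p k + 1) \<or> (lam = hook p (Suc k) \<and> i = 1 \<and> j = 1)")
        case True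
        then show ?thesis using 1 k hk
          by (auto simp: mt_def gsmul_def etil_apply eta_def A_def C_def)
      next
        case False
        have "x lam i j = 0" by (rule supp) (use False 1 hk in auto)
        moreover have "mt m k A ((C - A) / q) lam i j = 0"
          using False 1 k by (auto simp: mt_def gsmul_def etil_apply eta_def)
        ultimately show ?thesis by simp
      qed
    qed
    ultimately show ?thesis using AC that by blast
  next
    case 2
    define C where "C = x (hook p k) 1 (nc p k + 1)"
    have "red C = 0" unfolding C_def by (rule Lam_bc[OF xL]) (use m k 2 in auto)
    then have C: "C / q \<in> Zloc p" by (intro red_eq_0_div) (simp_all add: C_def Z)
    have d: "hook p m \<noteq> hook p (Suc m)" "hook p m \<noteq> hook p (Suc (Suc m))" "hook p (Suc m) \<noteq> hook p (Suc (Suc m))"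
      using m by (simp_all add: hook_inject)
    have "x = mt m k (C / q) 0"
    proof (intro ext)
      fix lam i j show "x lam i j = mt m k (C / q) 0 lam i j"
      proof (cases "lam = hook p k \<and> i = 1 \<and> j = nc p k + 1")
        case False
        have "x lam i j = 0" by (rule supp) (use False 2 d in auto)
        moreover have "mt m k (C / q) 0 lam i j = 0"
          using False 2 by (auto simp: mt_def gsmul_def eta_def)
        ultimately show ?thesis by simp
      qed (use 2 in \<open>simp add: mt_def gsmul_def eta_def C_def\<close>)
    qed
    then show ?thesis using that[OF C Zloc_0] by blast
  next
    case 3
    define C where "C = x (hook p m) (nc p m + 1) 1"
    have d: "hook p k \<noteq> hook p (Suc k)" "hook p k \<noteq> hook p (Suc (Suc k))" "hook p (Suc k) \<noteq> hook p (Suc (Suc k))"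
      using k by (simp_all add: hook_inject)
    have "x = mt m k C 0"
    proof (intro ext)
      fix lam i j show "x lam i j = mt m k C 0 lam i j"
      proof (cases "lam = hook p m \<and> i = nc p m + 1 \<and> j = 1")
        case False
        have "x lam i j = 0" by (rule supp) (use False 3 d in auto)
        moreover have "mt m k C 0 lam i j = 0"
          using False 3 by (auto simp: mt_def gsmul_def eta_def)
        ultimately show ?thesis by simp
      qed (use 3 in \<open>simp add: mt_def gsmul_def eta_def C_def\<close>)
    qed
    moreover have "C \<in> Zloc p" unfolding C_def by (rule Z)
    ultimately show ?thesis using that[OF _ Zloc_0] by blast
  next
    case 4
    have "x = mt m k 0 0"
    proof (intro ext)
      fix lam i j
      have "x lam i j = 0" by (rule supp) (use 4 hi in auto)
      then show "x lam i j = mt m k 0 0 lam i j" using 4 by (simp add: mt_def)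
    qed
    then show ?thesis using that[OF Zloc_0 Zloc_0] by blast
  qed
qed

lemma mt_add: "mt m k (A + A') (B + B') = mt m k A B + mt m k A' B'"
  by (simp add: mt_def gsmul_add_left distrib_right)

lemma mt_gsmul: "gsmul c (mt m k A B) = mt m k (c * A) (c * B)"
  by (simp add: mt_def fun_eq_iff gsmul_def algebra_simps)

lemma mt_0: "mt m k 0 0 = 0"
  by (simp add: mt_def gsmul_simps)

text \<open>Coordinates that do not occur in the corner at (m, k) are ignored, so equality of homomorphisms
  is equality of coordinates up to this predicate.\<close>
definition coords_zero :: "nat \<Rightarrow> nat \<Rightarrow> 'p coord \<Rightarrow> bool" where
  "coords_zero m k c \<longleftrightarrow> (m = k \<or> m = Suc k \<or> k = Suc m \<longrightarrow> fst c = 0) \<and> (m = k \<longrightarrow> snd c = 0)"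

text \<open>The corner is free over Z_(p) on its coordinates, so dividing by p inside the corner
  means dividing each existing coordinate; the others may be set to 0.\<close>

lemma mt_div_p_iff:
  assumes m: "1 \<le> m" "m < p" and k: "1 \<le> k" "k < p" and Z: "A \<in> Zloc p" "B \<in> Zloc p"
  shows "(\<exists>w \<in> corner m k. mt m k A B = gsmul q w) \<longleftrightarrow> coords_zero m k (red A, red B)"
proof
  assume "coords_zero m k (red A, red B)"
  then have A: "m = k \<or> m = Suc k \<or> k = Suc m \<Longrightarrow> A / q \<in> Zloc p" and B: "m = k \<Longrightarrow> B / q \<in> Zloc p"
    using Z by (auto simp: coords_zero_def intro!: red_eq_0_div)
  define A' where "A' = (if m = k \<or> m = Suc k \<or> k = Suc m then A / q else 0)"
  define B' where "B' = (if m = k then B / q else 0)"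
  have "mt m k A B = gsmul q (mt m k A' B')"
    unfolding mt_gsmul by (auto simp: mt_def A'_def B'_def)
  moreover have "mt m k A' B' \<in> corner m k"
    using A B by (intro mt_corner[OF m k]) (auto simp: A'_def B'_def)
  ultimately show "\<exists>w \<in> corner m k. mt m k A B = gsmul q w" by blast
next
  assume "\<exists>w \<in> corner m k. mt m k A B = gsmul q w"
  then obtain w where w: "w \<in> corner m k" "mt m k A B = gsmul q w" by blast
  obtain A' B' where Z': "A' \<in> Zloc p" "B' \<in> Zloc p" and "w = mt m k A' B'"
    using corner_mt[OF m k w(1)] .
  then have eq: "mt m k A B = mt m k (q * A') (q * B')" using w by (simp add: mt_gsmul)
  note eq' = fun_cong[OF fun_cong[OF fun_cong[OF eq]]]
  have hk: "hook p k \<noteq> hook p (Suc k)" using k by (simp add: hook_inject)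
  have A: "A = q * A'" if "m = k \<or> m = Suc k \<or> k = Suc m"
  proof -
    consider "m = k" | "m = Suc k" | "k = Suc m" using \<open>_ \<or> _\<close> by blast
    then show ?thesis
    proof cases
      case 1 then show ?thesis using eq'[of "hook p k" "nc p k + 1" "nc p k + 1"] k hk
        by (simp add: mt_def gsmul_def etil_apply eta_def)
    next
      case 2 then show ?thesis using eq'[of "hook p m" "nc p m + 1" 1]
        by (simp add: mt_def gsmul_def eta_def)
    next
      case 3 then show ?thesis using eq'[of "hook p k" 1 "nc p k + 1"]
        by (simp add: mt_def gsmul_def eta_def)
    qed
  qed
  moreover have "B = q * B'" if "m = k"
    using eq'[of "hook p (Suc k)" 1 1] A that k hk
    by (simp add: mt_def gsmul_def etil_apply eta_def)
  ultimately show "coords_zero m k (red A, red B)"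
    using Z' by (auto simp: coords_zero_def)
qed

section \<open>The modules P_k as sets of cosets\<close>

lemma Mk_iff:
  assumes "1 \<le> k" "k < p"
  shows "x \<in> Mk p k \<longleftrightarrow> x \<in> Lam p \<and> gmul (etil p k) x = x"
proof
  assume "x \<in> Mk p k"
  then obtain r where "r \<in> Lam p" "x = gmul (etil p k) r" unfolding Mk_def by blast
  then show "x \<in> Lam p \<and> gmul (etil p k) x = x"
    using assms by (auto simp: Lam_gmul etil_Lam etil_idem simp flip: gmul_assoc)
next
  assume "x \<in> Lam p \<and> gmul (etil p k) x = x"
  then have "x = gmul (etil p k) x" "x \<in> Lam p" by auto
  then show "x \<in> Mk p k" unfolding Mk_def by blast
qed

lemma
  assumes k: "1 \<le> k" "k < p"
  shows Mk_add: "\<lbrakk>x \<in> Mk p k; y \<in> Mk p k\<rbrakk> \<Longrightarrow> x + y \<in> Mk p k"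
    and Mk_diff: "\<lbrakk>x \<in> Mk p k; y \<in> Mk p k\<rbrakk> \<Longrightarrow> x - y \<in> Mk p k"
    and Mk_gsmul: "\<lbrakk>c \<in> Zloc p; x \<in> Mk p k\<rbrakk> \<Longrightarrow> gsmul c x \<in> Mk p k"
    and Mk_gmul: "\<lbrakk>x \<in> Mk p k; r \<in> Lam p\<rbrakk> \<Longrightarrow> gmul x r \<in> Mk p k"
    and Mk_0: "0 \<in> Mk p k"
    and Mk_etil: "etil p k \<in> Mk p k"
  by (simp_all add: Mk_iff[OF k] Lam_add Lam_diff Lam_gsmul Lam_gmul Lam_0 etil_Lam[OF k] etil_idem[OF k]
      gmul_bilinear gmul_assoc[symmetric])

lemma corner_gmul_Mk:
  assumes "1 \<le> m" "m < p" "1 \<le> k" "k < p" "x \<in> corner m k" "y \<in> Mk p k"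
  shows "gmul x y \<in> Mk p m"
  using assms by (simp add: Mk_iff corner_def Lam_gmul flip: gmul_assoc)

lemma coset_alt: "coset p k x = {x + gsmul q y | y. y \<in> Mk p k}"
  by (simp add: coset_def gadd_eq_plus)

lemma coset_self:
  assumes "1 \<le> k" "k < p"
  shows "x \<in> coset p k x"
  using Mk_0[OF assms] unfolding coset_alt by (force simp: gsmul_simps)

lemma coset_eq_iff:
  assumes k: "1 \<le> k" "k < p"
  shows "coset p k x = coset p k y \<longleftrightarrow> (\<exists>w \<in> Mk p k. x - y = gsmul q w)"
proof
  assume "coset p k x = coset p k y"
  then have "x \<in> coset p k y" using coset_self[OF k, of x] by simp
  then show "\<exists>w \<in> Mk p k. x - y = gsmul q w" unfolding coset_alt by auto
next
  assume "\<exists>w \<in> Mk p k. x - y = gsmul q w"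
  then obtain w where w: "w \<in> Mk p k" "x = y + gsmul q w" by (metis add.commute diff_add_cancel)
  have "y + gsmul q w + gsmul q v = y + gsmul q (w + v)" "y + gsmul q v = y + gsmul q w + gsmul q (v - w)" for v
    by (simp_all add: gsmul_simps add.assoc)
  then show "coset p k x = coset p k y" unfolding coset_alt w(2)
    using Mk_add[OF k w(1)] Mk_diff[OF k _ w(1)] by blast
qed

lemma Pcar_cases:
  assumes "X \<in> Pcar p k"
  obtains x where "x \<in> Mk p k" "X = coset p k x"
  using assms unfolding Pcar_def by blast

lemma coset_Pcar: "x \<in> Mk p k \<Longrightarrow> coset p k x \<in> Pcar p k"
  unfolding Pcar_def by blast

lemma cadd_coset:
  assumes k: "1 \<le> k" "k < p"
  shows "cadd (coset p k x) (coset p k y) = coset p k (x + y)"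
proof
  show "cadd (coset p k x) (coset p k y) \<subseteq> coset p k (x + y)"
  proof
    fix z assume "z \<in> cadd (coset p k x) (coset p k y)"
    then obtain u v where uv: "u \<in> Mk p k" "v \<in> Mk p k" "z = (x + gsmul q u) + (y + gsmul q v)"
      unfolding cadd_def coset_alt gadd_eq_plus by blast
    then have "z = (x + y) + gsmul q (u + v)" by (simp add: gsmul_simps algebra_simps)
    then show "z \<in> coset p k (x + y)" using Mk_add[OF k uv(1,2)] unfolding coset_alt by blast
  qed
  show "coset p k (x + y) \<subseteq> cadd (coset p k x) (coset p k y)"
  proof
    fix z assume "z \<in> coset p k (x + y)"
    then obtain u where u: "u \<in> Mk p k" "z = (x + y) + gsmul q u" unfolding coset_alt by blast
    then have "z = x + (y + gsmul q u)" by (simp add: add.assoc)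
    moreover have "y + gsmul q u \<in> coset p k y" using u(1) unfolding coset_alt by blast
    ultimately show "z \<in> cadd (coset p k x) (coset p k y)"
      using coset_self[OF k, of x] unfolding cadd_def gadd_eq_plus by blast
  qed
qed

text \<open>The difference of two elements of the coset that is built into \<open>csmul\<close>
  supplies all of p times the module, so the result is a full coset even for
  \<open>n = 0\<close>.\<close>

lemma csmul_coset:
  assumes k: "1 \<le> k" "k < p"
  shows "csmul n (coset p k x) = coset p k (gsmul (of_int n) x)"
proof
  show "csmul n (coset p k x) \<subseteq> coset p k (gsmul (of_int n) x)"
  proof
    fix z assume "z \<in> csmul n (coset p k x)"
    then obtain u v w where uvw: "u \<in> Mk p k" "v \<in> Mk p k" "w \<in> Mk p k"
      "z = gsmul (of_int n) (x + gsmul q u) + ((x + gsmul q v) + gsmul (-1) (x + gsmul q w))"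
      unfolding csmul_def coset_alt gadd_eq_plus by blast
    then have "z = gsmul (of_int n) x + gsmul q (gsmul (of_int n) u + (v - w))"
      by (simp add: fun_eq_iff gsmul_def algebra_simps)
    moreover have "gsmul (of_int n) u + (v - w) \<in> Mk p k"
      using uvw by (intro Mk_add Mk_diff Mk_gsmul k) simp_all
    ultimately show "z \<in> coset p k (gsmul (of_int n) x)" unfolding coset_alt by blast
  qed
  show "coset p k (gsmul (of_int n) x) \<subseteq> csmul n (coset p k x)"
  proof
    fix z assume "z \<in> coset p k (gsmul (of_int n) x)"
    then obtain u where u: "u \<in> Mk p k" "z = gsmul (of_int n) x + gsmul q u" unfolding coset_alt by blast
    then have "z = gsmul (of_int n) x + ((x + gsmul q u) + gsmul (-1) x)"
      by (simp add: gsmul_simps)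
    moreover have "x + gsmul q u \<in> coset p k x" using u(1) unfolding coset_alt by blast
    ultimately show "z \<in> csmul n (coset p k x)"
      using coset_self[OF k, of x] unfolding csmul_def gadd_eq_plus by blast
  qed
qed

lemma ract_coset:
  assumes k: "1 \<le> k" "k < p" and "r \<in> Lam p"
  shows "ract p k (coset p k x) r = coset p k (gmul x r)"
proof -
  have "coset p k (gmul z r) = coset p k (gmul x r)" if z: "z \<in> coset p k x" for z
  proof -
    obtain u where u: "u \<in> Mk p k" "z = x + gsmul q u" using z unfolding coset_alt by blast
    then have "gmul z r - gmul x r = gsmul q (gmul u r)" by (simp add: gmul_bilinear)
    then show ?thesis unfolding coset_eq_iff[OF k] using Mk_gmul[OF k u(1) assms(3)] by blast
  qed
  then show ?thesis unfolding ract_def using coset_self[OF k, of x] by blast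
qed

lemma lmul_coset:
  assumes m: "1 \<le> m" "m < p" and k: "1 \<le> k" "k < p" and r: "r \<in> corner m k" and x: "x \<in> Mk p k"
  shows "lmul p k m r (coset p k x) = coset p m (gmul r x)"
proof -
  have "coset p m (gmul r z) = coset p m (gmul r x)" if z: "z \<in> coset p k x" for z
  proof -
    obtain u where u: "u \<in> Mk p k" "z = x + gsmul q u" using z unfolding coset_alt by blast
    then have "gmul r z - gmul r x = gsmul q (gmul r u)" by (simp add: gmul_bilinear)
    then show ?thesis unfolding coset_eq_iff[OF m] using corner_gmul_Mk[OF m k r u(1)] by blast
  qed
  then show ?thesis unfolding lmul_def restrict_apply'[OF coset_Pcar[OF x]]
    using coset_self[OF k, of x] by blast
qed

lemma hom_ext:
  assumes "f \<in> extensional (Pcar p k)" "g \<in> extensional (Pcar p k)"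
    and "\<And>x. x \<in> Mk p k \<Longrightarrow> f (coset p k x) = g (coset p k x)"
  shows "f = g"
proof (rule extensionalityI[OF assms(1,2)])
  fix X assume "X \<in> Pcar p k"
  then show "f X = g X" using assms(3) by (elim Pcar_cases) simp
qed

lemma lmul_extensional: "lmul p k m r \<in> extensional (Pcar p k)"
  unfolding lmul_def by simp

lemma lmul_HomP:
  assumes m: "1 \<le> m" "m < p" and k: "1 \<le> k" "k < p" and r: "r \<in> corner m k"
  shows "lmul p k m r \<in> HomP p k m"
  unfolding HomP_def
proof (intro CollectI conjI ballI lmul_extensional)
  show "lmul p k m r \<in> Pcar p k \<rightarrow> Pcar p m"
  proof
    fix X assume "X \<in> Pcar p k"
    then show "lmul p k m r X \<in> Pcar p m"
      using lmul_coset[OF m k r] corner_gmul_Mk[OF m k r] coset_Pcar by (elim Pcar_cases) simp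
  qed
  fix X assume "X \<in> Pcar p k"
  then obtain x where x: "x \<in> Mk p k" "X = coset p k x" by (rule Pcar_cases)
  {
    fix Y assume "Y \<in> Pcar p k"
    then obtain y where y: "y \<in> Mk p k" "Y = coset p k y" by (rule Pcar_cases)
    show "lmul p k m r (cadd X Y) = cadd (lmul p k m r X) (lmul p k m r Y)"
      unfolding x(2) y(2) cadd_coset[OF k] lmul_coset[OF m k r x(1)] lmul_coset[OF m k r y(1)]
        lmul_coset[OF m k r Mk_add[OF k x(1) y(1)]] cadd_coset[OF m] gmul_bilinear ..
  }
  {
    fix s assume s: "s \<in> Lam p"
    show "lmul p k m r (ract p k X s) = ract p m (lmul p k m r X) s"
      unfolding x(2) ract_coset[OF k s] lmul_coset[OF m k r x(1)]
        lmul_coset[OF m k r Mk_gmul[OF k x(1) s]] ract_coset[OF m s] gmul_assoc ..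
  }
qed

text \<open>P_k is cyclic, generated by the coset of the idempotent. If \<open>y\<close> represents
  the image of this generator, the homomorphism is left multiplication by \<open>y\<close>, and
  multiplying \<open>y\<close> by the idempotent from the right moves it into the corner.\<close>

lemma HomP_lmul:
  assumes m: "1 \<le> m" "m < p" and k: "1 \<le> k" "k < p" and f: "f \<in> HomP p k m"
  obtains r where "r \<in> corner m k" "f = lmul p k m r"
proof -
  let ?e = "etil p k"
  have ext: "f \<in> extensional (Pcar p k)" and car: "f \<in> Pcar p k \<rightarrow> Pcar p m"
    and act: "\<And>X r. \<lbrakk>X \<in> Pcar p k; r \<in> Lam p\<rbrakk> \<Longrightarrow> f (ract p k X r) = ract p m (f X) r"
    using f unfolding HomP_def by blast+
  have eP: "coset p k ?e \<in> Pcar p k" by (rule coset_Pcar[OF Mk_etil[OF k]])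
  obtain y where y: "y \<in> Mk p m" "f (coset p k ?e) = coset p m y"
    using funcset_mem[OF car eP] by (rule Pcar_cases)
  have fx: "f (coset p k x) = coset p m (gmul y x)" if x: "x \<in> Mk p k" for x
  proof -
    have xL: "x \<in> Lam p" "gmul ?e x = x" using x Mk_iff[OF k] by auto
    show ?thesis using act[OF eP xL(1)] unfolding y(2) ract_coset[OF k xL(1)] ract_coset[OF m xL(1)] xL(2) .
  qed
  let ?r = "gmul y ?e"
  have r: "?r \<in> corner m k"
    using y(1) Mk_iff[OF m, of y] etil_Lam[OF k] etil_idem[OF k]
    by (simp add: corner_def Lam_gmul gmul_assoc) (simp flip: gmul_assoc)
  moreover have "f = lmul p k m ?r"
  proof (rule hom_ext[OF ext lmul_extensional])
    fix x assume x: "x \<in> Mk p k"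
    then have "gmul ?e x = x" using Mk_iff[OF k] by auto
    then show "f (coset p k x) = lmul p k m ?r (coset p k x)"
      unfolding fx[OF x] lmul_coset[OF m k r x] gmul_assoc by simp
  qed
  ultimately show thesis by (rule that)
qed

lemma lmul_eq_iff:
  assumes m: "1 \<le> m" "m < p" and k: "1 \<le> k" "k < p" and r: "r \<in> corner m k" and s: "s \<in> corner m k"
  shows "lmul p k m r = lmul p k m s \<longleftrightarrow> (\<exists>w \<in> corner m k. r - s = gsmul q w)"
proof
  assume "\<exists>w \<in> corner m k. r - s = gsmul q w"
  then obtain w where w: "w \<in> corner m k" "r - s = gsmul q w" by blast
  show "lmul p k m r = lmul p k m s"
  proof (rule hom_ext[OF lmul_extensional lmul_extensional])
    fix x assume x: "x \<in> Mk p k"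
    have "gmul r x - gmul s x = gsmul q (gmul w x)"
      unfolding gmul_bilinear(3)[symmetric] w(2) gmul_bilinear ..
    then show "lmul p k m r (coset p k x) = lmul p k m s (coset p k x)"
      unfolding lmul_coset[OF m k r x] lmul_coset[OF m k s x] coset_eq_iff[OF m]
      using corner_gmul_Mk[OF m k w(1) x] by blast
  qed
next
  let ?e = "etil p k"
  assume "lmul p k m r = lmul p k m s"
  then have "coset p m (gmul r ?e) = coset p m (gmul s ?e)"
    using lmul_coset[OF m k r Mk_etil[OF k]] lmul_coset[OF m k s Mk_etil[OF k]] by simp
  then have "coset p m r = coset p m s" using r s by (simp add: corner_def)
  then obtain w where w: "w \<in> Mk p m" "r - s = gsmul q w" unfolding coset_eq_iff[OF m] by blast
  \<comment> \<open>The quotient \<open>w\<close> is only known to lie in the module; right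
    multiplication by the idempotent fixes \<open>r - s\<close> and puts the quotient into the
    corner.\<close>
  have "gsmul q (gmul w ?e) = gmul (r - s) ?e" by (simp add: w(2) gmul_bilinear)
  also have "\<dots> = r - s" using r s by (simp add: corner_def gmul_bilinear)
  finally have "r - s = gsmul q (gmul w ?e)" ..
  moreover have "gmul w ?e \<in> corner m k"
    using w(1) Mk_iff[OF m, of w] etil_Lam[OF k] etil_idem[OF k]
    by (simp add: corner_def Lam_gmul gmul_assoc) (simp flip: gmul_assoc)
  ultimately show "\<exists>w \<in> corner m k. r - s = gsmul q w" by blast
qed

section \<open>Homomorphisms in coordinates over F_p\<close>

definition hm :: "nat \<Rightarrow> nat \<Rightarrow> 'p coord \<Rightarrow> gam set \<Rightarrow> gam set" where
  "hm m k c = lmul p k m (mt m k (rep (fst c)) (rep (snd c)))"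

text \<open>Composition of homomorphisms in coordinates. The two ways around through a neighbour differ in sign,
  since the two radical elements of a diagonal corner add up to p times the idempotent.\<close>
definition cmul :: "nat \<Rightarrow> nat \<Rightarrow> nat \<Rightarrow> 'p coord \<Rightarrow> 'p coord \<Rightarrow> 'p coord" where
  "cmul m k n c d = (if k = m \<or> k = n then fst c * fst d else 0,
    if m \<noteq> n then 0 else if k = m then fst c * snd d + snd c * fst d
    else if k = Suc m then fst c * fst d else if m = Suc k then - (fst c * fst d) else 0)"

definition smult2 :: "'p mod_ring \<Rightarrow> 'p coord \<Rightarrow> 'p coord" where
  "smult2 a c = (a * fst c, a * snd c)"

lemma mt_diff: "mt m k A B - mt m k A' B' = mt m k (A - A') (B - B')"
  by (simp add: mt_def fun_eq_iff gsmul_def algebra_simps)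

lemma lmul_mt_eq_iff:
  assumes m: "1 \<le> m" "m < p" and k: "1 \<le> k" "k < p"
    and Z: "A \<in> Zloc p" "B \<in> Zloc p" "A' \<in> Zloc p" "B' \<in> Zloc p"
  shows "lmul p k m (mt m k A B) = lmul p k m (mt m k A' B') \<longleftrightarrow>
    coords_zero m k (red A - red A', red B - red B')"
  using lmul_eq_iff[OF m k mt_corner[OF m k Z(1,2)] mt_corner[OF m k Z(3,4)]]
    mt_div_p_iff[OF m k Zloc_diff[OF Z(1,3)] Zloc_diff[OF Z(2,4)]]
  unfolding mt_diff red_diff[OF Z(1,3)] red_diff[OF Z(2,4)] by blast

lemma lmul_mt:
  assumes m: "1 \<le> m" "m < p" and k: "1 \<le> k" "k < p" and Z: "A \<in> Zloc p" "B \<in> Zloc p"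
  shows "lmul p k m (mt m k A B) = hm m k (red A, red B)"
  unfolding hm_def using lmul_mt_eq_iff[OF m k Z Zloc_rep Zloc_rep] by (simp add: coords_zero_def)

lemma hm_eq_iff:
  assumes m: "1 \<le> m" "m < p" and k: "1 \<le> k" "k < p"
  shows "hm m k c = hm m k d \<longleftrightarrow> coords_zero m k (c - d)"
proof -
  have "(fst c - fst d, snd c - snd d) = c - d" by (simp add: prod_eq_iff)
  then show ?thesis unfolding hm_def lmul_mt_eq_iff[OF m k Zloc_rep Zloc_rep Zloc_rep Zloc_rep] by simp
qed

lemma hm_HomP: "\<lbrakk>1 \<le> m; m < p; 1 \<le> k; k < p\<rbrakk> \<Longrightarrow> hm m k c \<in> HomP p k m"
  unfolding hm_def by (intro lmul_HomP mt_corner) simp_all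

lemma HomP_hm:
  assumes m: "1 \<le> m" "m < p" and k: "1 \<le> k" "k < p" and f: "f \<in> HomP p k m"
  obtains c where "f = hm m k c"
proof -
  obtain r where r: "r \<in> corner m k" "f = lmul p k m r" using HomP_lmul[OF m k f] .
  obtain A B where AB: "A \<in> Zloc p" "B \<in> Zloc p" "r = mt m k A B" using corner_mt[OF m k r(1)] .
  show thesis by (rule that[of "(red A, red B)"]) (simp only: r(2) AB(3) lmul_mt[OF m k AB(1,2)])
qed

lemma mt_rep_corner: "\<lbrakk>1 \<le> m; m < p; 1 \<le> k; k < p\<rbrakk> \<Longrightarrow> mt m k (rep a) (rep b) \<in> corner m k"
  by (rule mt_corner) simp_all

lemma hm_coset:
  assumes m: "1 \<le> m" "m < p" and k: "1 \<le> k" "k < p" and x: "x \<in> Mk p k"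
  shows "hm m k c (coset p k x) = coset p m (gmul (mt m k (rep (fst c)) (rep (snd c))) x)"
  unfolding hm_def by (rule lmul_coset[OF m k mt_rep_corner[OF m k] x])

lemma hm_add:
  assumes m: "1 \<le> m" "m < p" and k: "1 \<le> k" "k < p"
  shows "restrict (\<lambda>X. cadd (hm m k c X) (hm m k d X)) (Pcar p k) = hm m k (c + d)"
proof -
  let ?A = "rep (fst c) + rep (fst d)" and ?B = "rep (snd c) + rep (snd d)"
  have Z: "?A \<in> Zloc p" "?B \<in> Zloc p" by simp_all
  have "restrict (\<lambda>X. cadd (hm m k c X) (hm m k d X)) (Pcar p k) = lmul p k m (mt m k ?A ?B)"
  proof (rule hom_ext)
    fix x assume x: "x \<in> Mk p k"
    show "restrict (\<lambda>X. cadd (hm m k c X) (hm m k d X)) (Pcar p k) (coset p k x) = lmul p k m (mt m k ?A ?B) (coset p k x)"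
      unfolding restrict_apply'[OF coset_Pcar[OF x]] hm_coset[OF m k x] lmul_coset[OF m k mt_corner[OF m k Z] x]
      unfolding cadd_coset[OF m] mt_add gmul_bilinear ..
  qed (simp_all add: lmul_extensional)
  also have "\<dots> = hm m k (c + d)"
    unfolding lmul_mt[OF m k Z] by (rule arg_cong[of _ _ "hm m k"]) (simp add: prod_eq_iff)
  finally show ?thesis .
qed

lemma hm_csmul:
  assumes m: "1 \<le> m" "m < p" and k: "1 \<le> k" "k < p"
  shows "restrict (\<lambda>X. csmul n (hm m k c X)) (Pcar p k) = hm m k (smult2 (of_int n) c)"
proof -
  let ?A = "of_int n * rep (fst c)" and ?B = "of_int n * rep (snd c)"
  have Z: "?A \<in> Zloc p" "?B \<in> Zloc p" by simp_all
  have "restrict (\<lambda>X. csmul n (hm m k c X)) (Pcar p k) = lmul p k m (mt m k ?A ?B)"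
  proof (rule hom_ext)
    fix x assume x: "x \<in> Mk p k"
    show "restrict (\<lambda>X. csmul n (hm m k c X)) (Pcar p k) (coset p k x) = lmul p k m (mt m k ?A ?B) (coset p k x)"
      unfolding restrict_apply'[OF coset_Pcar[OF x]] hm_coset[OF m k x] lmul_coset[OF m k mt_corner[OF m k Z] x]
      unfolding csmul_coset[OF m] mt_gsmul[symmetric] gmul_bilinear ..
  qed (simp_all add: lmul_extensional)
  also have "\<dots> = hm m k (smult2 (of_int n) c)"
    unfolding lmul_mt[OF m k Z] by (rule arg_cong[of _ _ "hm m k"]) (simp add: smult2_def)
  finally show ?thesis .
qed

lemma hm_zero:
  assumes m: "1 \<le> m" "m < p" and k: "1 \<le> k" "k < p"
  shows "restrict (\<lambda>_. zcos p m) (Pcar p k) = hm m k 0"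
proof -
  have "restrict (\<lambda>_. zcos p m) (Pcar p k) = lmul p k m (mt m k 0 0)"
  proof (rule hom_ext)
    fix x assume x: "x \<in> Mk p k"
    have "(\<lambda>_ _ _. 0) = (0 :: gam)" by (simp add: fun_eq_iff)
    then show "restrict (\<lambda>_. zcos p m) (Pcar p k) (coset p k x) = lmul p k m (mt m k 0 0) (coset p k x)"
      unfolding restrict_apply'[OF coset_Pcar[OF x]] lmul_coset[OF m k mt_corner[OF m k Zloc_0 Zloc_0] x]
      unfolding mt_0 gmul_bilinear zcos_def by simp
  qed (simp_all add: lmul_extensional)
  also have "\<dots> = hm m k 0"
    unfolding lmul_mt[OF m k Zloc_0 Zloc_0] by (rule arg_cong[of _ _ "hm m k"]) (simp add: prod_eq_iff)
  finally show ?thesis .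
qed

text \<open>Exact coordinates of a product in Lambda; the terms carrying a factor p disappear modulo p.\<close>
definition prod_fst :: "nat \<Rightarrow> nat \<Rightarrow> nat \<Rightarrow> rat \<Rightarrow> rat \<Rightarrow> rat \<Rightarrow> rat \<Rightarrow> rat" where
  "prod_fst m k n A B C D =
    (if k = m \<or> k = n then A * C + (if k = m \<and> n = Suc m then q * B * C else 0)
        + (if k = n \<and> m = Suc k then q * A * D else 0)
     else if m = n \<and> m = Suc k then q * A * C else 0)"

definition prod_snd :: "nat \<Rightarrow> nat \<Rightarrow> nat \<Rightarrow> rat \<Rightarrow> rat \<Rightarrow> rat \<Rightarrow> rat \<Rightarrow> rat" where
  "prod_snd m k n A B C D =
    (if m \<noteq> n then 0 else if k = m then A * D + B * C + q * B * D
     else if k = Suc m then A * C else if m = Suc k then - (A * C) else 0)"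

text \<open>Matrix units at different hooks multiply to 0, so only the relative position of the
  three indices matters. The factors \<open>q\<close> come from the square of
  \<open>q * eta\<close>, from its action on a neighbour, and from rewriting \<open>q\<close> times
  the other diagonal unit as \<open>q\<close> times the idempotent minus
  \<open>q * eta\<close>.\<close>

lemma mt_gmul:
  assumes m: "1 \<le> m" "m < p" and k: "1 \<le> k" "k < p" and n: "1 \<le> n" "n < p"
  shows "gmul (mt m k A B) (mt k n C D) = mt m n (prod_fst m k n A B C D) (prod_snd m k n A B C D)"
proof -
  note ex = mt_def etil_def gadd_eq_plus gmul_bilinear gmul_eta_eta hook_inject rank_hook prod_fst_def prod_snd_def
  note pos = nb_pos[OF m] nb_pos[OF k] nb_pos[OF n] nc_pos[of "Suc m" p] nc_pos[of "Suc k" p] nc_pos[of "Suc n" p]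
  note pt = fun_eq_iff gsmul_def eta_def algebra_simps
  consider "m = k" | "k = Suc m" | "m = Suc k" | "m \<noteq> k" "k \<noteq> Suc m" "m \<noteq> Suc k" by blast
  then show ?thesis
  proof cases
    case 1
    consider "n = k" | "n = Suc k" | "k = Suc n" | "n \<noteq> k" "k \<noteq> Suc n" "n \<noteq> Suc k" by blast
    then show ?thesis using 1 m k n pos by cases (simp_all add: ex, (simp_all add: pt)?)
  next
    case 2
    consider "n = k" | "n = Suc k" | "k = Suc n" | "n \<noteq> k" "k \<noteq> Suc n" "n \<noteq> Suc k" by blast
    then show ?thesis using 2 m k n pos by cases (simp_all add: ex, (simp_all add: pt)?)
  next
    case 3
    consider "n = k" | "n = Suc k" | "k = Suc n" | "n \<noteq> k" "k \<noteq> Suc n" "n \<noteq> Suc k" by blast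
    then show ?thesis using 3 m k n pos by cases (simp_all add: ex, (simp_all add: pt)?)
  next
    case 4
    then show ?thesis using m k n by (auto simp: ex gsmul_simps)
  qed
qed

lemma
  assumes "A \<in> Zloc p" "B \<in> Zloc p" "C \<in> Zloc p" "D \<in> Zloc p"
  shows prod_fst_Zloc: "prod_fst m k n A B C D \<in> Zloc p"
    and prod_snd_Zloc: "prod_snd m k n A B C D \<in> Zloc p"
    and red_prod: "(red (prod_fst m k n A B C D), red (prod_snd m k n A B C D)) = cmul m k n (red A, red B) (red C, red D)"
  using assms by (auto simp: prod_fst_def prod_snd_def cmul_def)

lemma hm_comp:
  assumes m: "1 \<le> m" "m < p" and k: "1 \<le> k" "k < p" and n: "1 \<le> n" "n < p"
  shows "restrict (hm m k c \<circ> hm k n d) (Pcar p n) = hm m n (cmul m k n c d)"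
proof -
  let ?a = "rep (fst c)" and ?b = "rep (snd c)" and ?c = "rep (fst d)" and ?d = "rep (snd d)"
  let ?A = "prod_fst m k n ?a ?b ?c ?d" and ?B = "prod_snd m k n ?a ?b ?c ?d"
  have Z: "?A \<in> Zloc p" "?B \<in> Zloc p" by (rule prod_fst_Zloc prod_snd_Zloc; simp)+
  have "restrict (hm m k c \<circ> hm k n d) (Pcar p n) = lmul p n m (mt m n ?A ?B)"
  proof (rule hom_ext)
    fix x assume x: "x \<in> Mk p n"
    have y: "gmul (mt k n ?c ?d) x \<in> Mk p k" by (rule corner_gmul_Mk[OF k n mt_rep_corner[OF k n] x])
    show "restrict (hm m k c \<circ> hm k n d) (Pcar p n) (coset p n x) = lmul p n m (mt m n ?A ?B) (coset p n x)"
      unfolding restrict_apply'[OF coset_Pcar[OF x]] o_apply hm_coset[OF k n x] hm_coset[OF m k y]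
        lmul_coset[OF m n mt_corner[OF m n Z] x]
      unfolding gmul_assoc[symmetric] mt_gmul[OF m k n] ..
  qed (simp_all add: lmul_extensional)
  also have "\<dots> = hm m n (cmul m k n c d)"
    unfolding lmul_mt[OF m n Z]
    by (subst red_prod) simp_all
  finally show ?thesis .
qed

lemma idP_hm:
  assumes k: "1 \<le> k" "k < p"
  shows "idP p k = hm k k (1, 0)"
proof -
  have "idP p k = lmul p k k (mt k k 1 0)"
  proof (rule hom_ext)
    fix x assume x: "x \<in> Mk p k"
    then have "gmul (mt k k 1 0) x = x" using Mk_iff[OF k] by (simp add: mt_def gsmul_simps)
    then show "idP p k (coset p k x) = lmul p k k (mt k k 1 0) (coset p k x)"
      unfolding lmul_coset[OF k k mt_corner[OF k k Zloc_1 Zloc_0] x] idP_def restrict_apply'[OF coset_Pcar[OF x]]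
      by simp
  qed (simp_all add: lmul_extensional idP_def)
  then show ?thesis by (simp add: lmul_mt[OF k k])
qed

lemma emap_off_diagonal:
  assumes m: "1 \<le> m" "m < p" and k: "1 \<le> k" "k < p" and "m = Suc k \<or> k = Suc m"
  shows "emap p m k = hm m k (1, 0)"
proof -
  have "emap p m k = lmul p k m (mt m k 1 0)"
    using assms(5) by (auto simp: emap_def mt_def gsmul_simps)
  then show ?thesis by (simp add: lmul_mt[OF m k])
qed

text \<open>At the first hook, p times the matrix unit is p times the idempotent minus the chosen
  radical element; the first part vanishes modulo p and leaves the coordinate -1.\<close>

lemma emap_1_1: "emap p 1 1 = hm 1 1 (0, - 1)"
proof -
  have 1: "(1::nat) \<le> 1" "1 < p" using p_ge_3 by simp_all
  have nc1: "nc p 1 = 0" by (simp add: nc_def)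
  have "mt 1 1 q (- 1) = gsmul q (eta (hook p 1) 1 1)"
    by (simp add: mt_def etil_def gadd_eq_plus nc1[unfolded One_nat_def] fun_eq_iff gsmul_def algebra_simps)
  then have "emap p 1 1 = lmul p 1 1 (mt 1 1 q (- 1))" by (simp add: emap_def)
  then show ?thesis using lmul_mt[OF 1 1, of q "- 1"] by simp
qed

lemma emap_last: "emap p (p - 1) (p - 1) = hm (p - 1) (p - 1) (0, 1)"
proof -
  have 1: "1 \<le> p - 1" "p - 1 < p" using p_ge_3 by simp_all
  have ne: "p - Suc 0 \<noteq> Suc 0" "p - Suc 0 \<noteq> p" "Suc (p - Suc 0) = p" using p_ge_3 by auto
  have "emap p (p - 1) (p - 1) = lmul p (p - 1) (p - 1) (mt (p - 1) (p - 1) 0 1)"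
    using ne by (simp add: emap_def mt_def gsmul_simps)
  then show ?thesis using lmul_mt[OF 1 1, of 0 1] by simp
qed

subsection \<open>Families of coordinates\<close>

abbreviation l :: nat where "l \<equiv> lval p"

abbreviation om :: "nat \<Rightarrow> nat" where "om \<equiv> omega p"

abbreviation gd :: "nat \<Rightarrow> nat \<Rightarrow> int" where
  "gd a J \<equiv> gamma_deg p a + int (J * l)"

lemma l_eq: "l = 2 * (p - 1)" by (simp add: lval_def)

lemma l_pos: "l > 0" and l_ge_4: "l \<ge> 4" using p_ge_3 by (simp_all add: lval_def)

lemma omega_cong: "i mod l = j mod l \<Longrightarrow> om i = om j"
  by (simp add: omega_def)

lemma omega_lower: "i mod l \<le> p - 2 \<Longrightarrow> om i = i mod l + 1"
  and omega_upper: "p - 1 \<le> i mod l \<Longrightarrow> om i = l - i mod l"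
  using p_ge_3 by (auto simp: omega_def Let_def)

lemma mod_l_less: "i mod l < l" using l_pos by simp

lemma omega_bounds: "1 \<le> om i" "om i < p"
proof -
  have "1 \<le> om i \<and> om i < p"
  proof (cases "i mod l \<le> p - 2")
    case True then show ?thesis using omega_lower[OF True] p_ge_3 by simp
  next
    case False then show ?thesis using omega_upper[of i] mod_l_less[of i] l_eq p_ge_3 by linarith
  qed
  then show "1 \<le> om i" "om i < p" by auto
qed

text \<open>Below position 0 the resolution is zero. The only map from there is the everywhere
  undefined function, and coordinates at such indices are ignored.\<close>

definition Phi :: "int \<Rightarrow> (nat \<Rightarrow> 'p coord) \<Rightarrow> afam" where
  "Phi z G = (\<lambda>i. if int i + z < 0 then (\<lambda>_. undefined)
     else hm (om i) (om (nat (int i + z))) (G i))"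

definition fam_eq :: "int \<Rightarrow> (nat \<Rightarrow> 'p coord) \<Rightarrow> (nat \<Rightarrow> 'p coord) \<Rightarrow> bool" where
  "fam_eq z G H \<longleftrightarrow> (\<forall>i. int i + z \<ge> 0 \<longrightarrow>
     coords_zero (om i) (om (nat (int i + z))) (G i - H i))"

definition fsc :: "'p mod_ring \<Rightarrow> (nat \<Rightarrow> 'p coord) \<Rightarrow> nat \<Rightarrow> 'p coord" where
  "fsc a G = (\<lambda>i. smult2 a (G i))"

definition fcomp :: "int \<Rightarrow> int \<Rightarrow> (nat \<Rightarrow> 'p coord) \<Rightarrow> (nat \<Rightarrow> 'p coord) \<Rightarrow>
    nat \<Rightarrow> 'p coord" where
  "fcomp y z G H = (\<lambda>i. if int i + y < 0 then 0
     else cmul (om i) (om (nat (int i + y))) (om (nat (int i + y + z))) (G i) (H (nat (int i + y))))"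

lemma Phi_eq_iff: "Phi z G = Phi z H \<longleftrightarrow> fam_eq z G H"
proof -
  have "Phi z G = Phi z H \<longleftrightarrow> (\<forall>i. int i + z \<ge> 0 \<longrightarrow>
    hm (om i) (om (nat (int i + z))) (G i) = hm (om i) (om (nat (int i + z))) (H i))"
    unfolding Phi_def fun_eq_iff[of "\<lambda>i. if _ i then _ else _ i"] by (metis linorder_not_less)
  then show ?thesis unfolding fam_eq_def hm_eq_iff[OF omega_bounds omega_bounds] .
qed

lemma Ccar_nonneg: "0 \<le> s \<Longrightarrow> Ccar p s = Pcar p (om (nat s))"
  by (simp add: Ccar_def)

lemma Ccar_neg: "s < 0 \<Longrightarrow> Ccar p s = {}"
  by (simp add: Ccar_def)

lemma Adeg_Phi: "Adeg p z (Phi z G)"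
  unfolding Adeg_def HomC_def Phi_def using hm_HomP[OF omega_bounds omega_bounds] by auto

lemma Adeg_cases:
  assumes "Adeg p z g"
  obtains G where "g = Phi z G"
proof -
  have "\<exists>c. int i + z \<ge> 0 \<longrightarrow> g i = hm (om i) (om (nat (int i + z))) c" for i
  proof (cases "int i + z \<ge> 0")
    case True
    then have "g i \<in> HomP p (om (nat (int i + z))) (om i)"
      using spec[OF assms[unfolded Adeg_def], of i] by (simp add: HomC_def flip: linorder_not_less)
    then show ?thesis by (rule HomP_hm[OF omega_bounds omega_bounds]) blast
  qed simp
  then obtain G where G: "\<And>i. int i + z \<ge> 0 \<longrightarrow> g i = hm (om i) (om (nat (int i + z))) (G i)"
    by metis
  have "g i = Phi z G i" for i
  proof (cases "int i + z \<ge> 0")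
    case True then show ?thesis using G by (simp add: Phi_def)
  next
    case False
    then have "g i \<in> {\<lambda>_. undefined}" using assms unfolding Adeg_def HomC_def by (metis linorder_not_less)
    then show ?thesis using False by (simp add: Phi_def)
  qed
  then show thesis using that by blast
qed

lemma restrict_empty: "restrict f {} = (\<lambda>_. undefined)"
  by (simp add: fun_eq_iff)

lemma zeroHom_hm: "zeroHom p s t = (if s < 0 then (\<lambda>_. undefined) else hm (om t) (om (nat s)) 0)"
  by (simp add: zeroHom_def Ccar_neg Ccar_nonneg hm_zero[OF omega_bounds omega_bounds] restrict_empty)

lemma zeroA_Phi: "zeroA p z = Phi z 0"
  by (simp add: zeroA_def Phi_def zeroHom_hm zero_fun_def)

lemma addA_Phi: "addA p z (Phi z G) (Phi z H) = Phi z (G + H)"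
proof
  fix i show "addA p z (Phi z G) (Phi z H) i = Phi z (G + H) i"
    by (cases "int i + z < 0")
      (simp_all add: addA_def Phi_def Ccar_neg Ccar_nonneg hm_add[OF omega_bounds omega_bounds] restrict_empty)
qed

lemma smulA_Phi: "smulA p z n (Phi z G) = Phi z (fsc (of_int n) G)"
proof
  fix i show "smulA p z n (Phi z G) i = Phi z (fsc (of_int n) G) i"
    by (cases "int i + z < 0")
      (simp_all add: smulA_def Phi_def Ccar_neg Ccar_nonneg fsc_def hm_csmul[OF omega_bounds omega_bounds] restrict_empty)
qed

lemma sumA_Phi:
  assumes "\<And>x. x \<in> set xs \<Longrightarrow> F x = Phi z (G x)"
  shows "sumA p z (map F xs) = Phi z (\<Sum>x\<leftarrow>xs. G x)"
  using assms by (induction xs) (simp_all add: sumA_def zeroA_Phi addA_Phi)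

lemma compA_Phi: "compA p y (Phi y G) z (Phi z H) = Phi (y + z) (fcomp y z G H)"
proof
  fix i
  show "compA p y (Phi y G) z (Phi z H) i = Phi (y + z) (fcomp y z G H) i"
  proof (cases "int i + y < 0")
    \<comment> \<open>Here the middle term is the zero module although the source may be nonzero, so
      the component is the zero map with coordinate 0 and not a value of
      \<open>cmul\<close>.\<close>
    case True then show ?thesis by (simp add: compA_def Phi_def fcomp_def zeroHom_hm add.assoc)
  next
    case False
    then have j: "int (nat (int i + y)) = int i + y" by simp
    show ?thesis
    proof (cases "int i + y + z < 0")
      case True
      then show ?thesis using False by (simp add: compA_def Phi_def Ccar_neg add.assoc restrict_empty)
    next
      case nn: False
      then show ?thesis using False
        by (simp add: compA_def Phi_def Ccar_nonneg j fcomp_def hm_comp[OF omega_bounds omega_bounds omega_bounds] flip: add.assoc)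
    qed
  qed
qed

section \<open>The differential and the zigzag of the indices\<close>

definition dc :: "nat \<Rightarrow> 'p coord" where
  "dc i = (if i mod l = p - 2 then (0, 1) else if i mod l = l - 1 then (0, - 1) else (1, 0))"

lemma Suc_mod_l: "Suc i mod l = (if i mod l = l - 1 then 0 else Suc (i mod l))"
  using l_pos by (simp add: mod_Suc) linarith

lemma l_bounds: "p - 2 < l - 1" "Suc (p - 2) = p - 1" "p - 1 < l" "l - (p - 1) = p - 1" "p - 2 \<noteq> l - 1"
  "l - (l - 1) = 1"
  using l_eq p_ge_3 by linarith+

lemma omega_step:
  "i mod l < p - 2 \<Longrightarrow> om (Suc i) = Suc (om i)"
  "i mod l = p - 2 \<Longrightarrow> om i = p - 1 \<and> om (Suc i) = p - 1"
  "p - 1 \<le> i mod l \<Longrightarrow> i mod l < l - 1 \<Longrightarrow> om i = Suc (om (Suc i))"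
  "i mod l = l - 1 \<Longrightarrow> om i = 1 \<and> om (Suc i) = 1"
proof -
  assume h: "i mod l < p - 2"
  then have "Suc i mod l = Suc (i mod l)" using Suc_mod_l[of i] l_bounds(1) by simp
  then show "om (Suc i) = Suc (om i)" using omega_lower[of i] omega_lower[of "Suc i"] h by simp
next
  assume h: "i mod l = p - 2"
  then have "Suc i mod l = p - 1" using Suc_mod_l[of i] l_bounds(2,5) by simp
  then show "om i = p - 1 \<and> om (Suc i) = p - 1"
    using omega_lower[of i] omega_upper[of "Suc i"] h l_bounds(2,4) by simp
next
  assume h: "p - 1 \<le> i mod l" "i mod l < l - 1"
  then have "Suc i mod l = Suc (i mod l)" using Suc_mod_l[of i] by simp
  then show "om i = Suc (om (Suc i))" using omega_upper[of i] omega_upper[of "Suc i"] h by simp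
next
  assume h: "i mod l = l - 1"
  then have "Suc i mod l = 0" using Suc_mod_l[of i] by simp
  then show "om i = 1 \<and> om (Suc i) = 1"
    using omega_upper[of i] omega_lower[of "Suc i"] h l_bounds by simp
qed

lemma mod_l_cases:
  obtains "i mod l < p - 2" | "i mod l = p - 2" | "p - 1 \<le> i mod l" "i mod l < l - 1" | "i mod l = l - 1"
  using mod_l_less[of i] by linarith

lemma dfam_Phi: "dfam p = Phi 1 dc"
proof
  fix i
  have n: "nat (int i + 1) = Suc i" by simp
  show "dfam p i = Phi 1 dc i"
  proof (cases rule: mod_l_cases[of i])
    case 1
    then show ?thesis using emap_off_diagonal[OF omega_bounds omega_bounds, of i "Suc i"] omega_step(1)[OF 1] 1 l_bounds(1)
      by (simp add: dfam_def Phi_def dc_def n)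
  next
    case 2
    then show ?thesis using emap_last omega_step(2)[OF 2]
      by (simp add: dfam_def Phi_def dc_def n)
  next
    case 3
    then show ?thesis using emap_off_diagonal[OF omega_bounds omega_bounds, of i "Suc i"] omega_step(3)[OF 3] 3 l_bounds(2) p_ge_3
      by (simp add: dfam_def Phi_def dc_def n)
  next
    case 4
    then have "dc i = (0, - 1)" using l_bounds(5) by (simp add: dc_def)
    then show ?thesis using emap_1_1 omega_step(4)[OF 4] by (simp add: dfam_def Phi_def n)
  qed
qed

text \<open>The indices omega run up and down the interval from 1 to p - 1, each end point being taken twice;
  d is radical exactly because its diagonal steps have first coordinate 0.\<close>
lemma step_forms:
  obtains (up) "om (Suc i) = Suc (om i)" "dc i = (1, 0)"
  | (down) "om i = Suc (om (Suc i))" "dc i = (1, 0)"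
  | (top) "om i = p - 1" "om (Suc i) = p - 1" "dc i = (0, 1)"
  | (bottom) "om i = 1" "om (Suc i) = 1" "dc i = (0, - 1)"
proof (cases rule: mod_l_cases[of i])
  case 1
  then show thesis using up omega_step(1)[OF 1] l_bounds(1) by (simp add: dc_def)
next
  case 2
  then show thesis using top omega_step(2)[OF 2] by (simp add: dc_def)
next
  case 3
  then show thesis using down omega_step(3)[OF 3] l_bounds(2) by (auto simp: dc_def)
next
  case 4
  then show thesis using bottom omega_step(4)[OF 4] l_bounds(5) by (simp add: dc_def)
qed

text \<open>Products of two neighbouring components, as in d d, in chi chi and in the cycle
  condition for chi, depend only on these six patterns. Two consecutive turns do not occur because p
  is at least 3.\<close>

lemma two_steps:
  obtains (up) "om (Suc i) = Suc (om i)" "om (Suc (Suc i)) = Suc (Suc (om i))"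
      "dc i = (1, 0)" "dc (Suc i) = (1, 0)"
  | (up_top) "om i = p - 2" "om (Suc i) = p - 1" "om (Suc (Suc i)) = p - 1"
      "dc i = (1, 0)" "dc (Suc i) = (0, 1)"
  | (top_down) "om i = p - 1" "om (Suc i) = p - 1" "om (Suc (Suc i)) = p - 2"
      "dc i = (0, 1)" "dc (Suc i) = (1, 0)"
  | (down) "om (Suc i) = Suc (om (Suc (Suc i)))" "om i = Suc (Suc (om (Suc (Suc i))))"
      "dc i = (1, 0)" "dc (Suc i) = (1, 0)"
  | (down_bottom) "om i = 2" "om (Suc i) = 1" "om (Suc (Suc i)) = 1"
      "dc i = (1, 0)" "dc (Suc i) = (0, - 1)"
  | (bottom_up) "om i = 1" "om (Suc i) = 1" "om (Suc (Suc i)) = 2"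
      "dc i = (0, - 1)" "dc (Suc i) = (1, 0)"
proof (cases rule: mod_l_cases[of i])
  case 1
  then have dc: "dc i = (1, 0)" and S: "Suc i mod l = Suc (i mod l)"
    using Suc_mod_l[of i] l_bounds(1) by (simp_all add: dc_def)
  from S 1 consider (a) "Suc i mod l < p - 2" | (b) "Suc i mod l = p - 2" by linarith
  then show thesis
  proof cases
    case a
    then have "dc (Suc i) = (1, 0)" using l_bounds(1) by (simp add: dc_def)
    then show thesis using up omega_step(1)[OF 1] omega_step(1)[OF a] dc by simp
  next
    case b
    then have "dc (Suc i) = (0, 1)" by (simp add: dc_def)
    then show thesis using up_top omega_step(1)[OF 1] omega_step(2)[OF b] dc by simp
  qed
next
  case 2
  then have dc: "dc i = (0, 1)" and S: "Suc i mod l = p - 1"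
    using Suc_mod_l[of i] l_bounds(2,5) by (simp_all add: dc_def)
  have lt: "p - 1 < l - 1" using l_eq p_ge_3 by linarith
  then have "dc (Suc i) = (1, 0)" using S l_bounds(2) by (auto simp: dc_def)
  moreover have "om (Suc i) = Suc (om (Suc (Suc i)))" using omega_step(3)[of "Suc i"] S lt by simp
  ultimately show thesis using top_down omega_step(2)[OF 2] dc by simp
next
  case 3
  then have dc: "dc i = (1, 0)" and S: "Suc i mod l = Suc (i mod l)"
    using Suc_mod_l[of i] l_bounds(2) by (auto simp: dc_def)
  from S 3 consider (a) "p - 1 \<le> Suc i mod l" "Suc i mod l < l - 1" | (b) "Suc i mod l = l - 1" by linarith
  then show thesis
  proof cases
    case a
    then have "dc (Suc i) = (1, 0)" using l_bounds(2) by (auto simp: dc_def)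
    then show thesis using down omega_step(3)[OF 3] omega_step(3)[OF a] dc by simp
  next
    case b
    then have "dc (Suc i) = (0, - 1)" using l_bounds(5) by (simp add: dc_def)
    then show thesis using down_bottom omega_step(3)[OF 3] omega_step(4)[OF b] dc by simp
  qed
next
  case 4
  then have dc: "dc i = (0, - 1)" and S: "Suc i mod l = 0"
    using Suc_mod_l[of i] l_bounds(5) by (simp_all add: dc_def)
  have "dc (Suc i) = (1, 0)" using S p_ge_3 l_ge_4 by (simp add: dc_def)
  moreover have "om (Suc (Suc i)) = Suc (om (Suc i))" using omega_step(1)[of "Suc i"] S p_ge_3 by simp
  ultimately show thesis using bottom_up omega_step(4)[OF 4] dc by simp
qed

definition fdiff :: "int \<Rightarrow> (nat \<Rightarrow> 'p coord) \<Rightarrow> nat \<Rightarrow> 'p coord" where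
  "fdiff z G = fcomp 1 z dc G + fsc (- ((-1) ^ nat \<bar>z\<bar>)) (fcomp z 1 G dc)"

lemma m1A_Phi: "m1A p z (Phi z G) = Phi (z + 1) (fdiff z G)"
  unfolding m1A_def dfam_Phi compA_Phi fdiff_def
  by (simp add: add.commute[of 1 z] smulA_Phi addA_Phi)

section \<open>Coordinates of iota, chi and gamma\<close>

definition one :: "nat \<Rightarrow> 'p coord" where
  "one = (\<lambda>_. (1, 0))"

text \<open>Coordinates of gamma; the case k = 1 is chi, all of whose components have coordinate (1, 0).\<close>
definition gc :: "nat \<Rightarrow> nat \<Rightarrow> 'p coord" where
  "gc k = (\<lambda>i. if k = 1 \<or> i mod l = k - 1 \<or> i mod l = k + p - 2 then (1, 0) else 0)"

lemma gc_1: "gc 1 = one" by (simp add: gc_def one_def)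

lemma unitA_Phi: "unitA p = Phi 0 one"
  by (simp add: unitA_def Phi_def one_def idP_hm[OF omega_bounds] fun_eq_iff)

lemma omega_add_l: "om (i + l) = om i" by (rule omega_cong) simp

lemma omega_add_mult_l: "om (i + j * l) = om i" by (rule omega_cong) simp

lemma iota_Phi: "iota p = Phi (int l) one"
proof
  fix i
  have "nat (int i + int l) = i + l" by simp
  then show "iota p i = Phi (int l) one i"
    by (simp add: iota_def Phi_def one_def idP_hm[OF omega_bounds] omega_add_l)
qed

lemma fcomp_one_one: "fcomp (int (j * l)) (int (k * l)) one one = one"
proof
  fix i
  have "nat (int i + int (j * l)) = i + j * l" "nat (int i + int (j * l) + int (k * l)) = i + j * l + k * l"
    "\<not> int i + int (j * l) < 0"
    by linarith+
  then show "fcomp (int (j * l)) (int (k * l)) one one i = one i"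
    unfolding fcomp_def one_def by (simp only: cmul_def omega_add_mult_l) simp
qed

lemma iota_pow_Phi: "iota_pow p j = Phi (int (j * l)) one"
proof (induction j)
  case (Suc j)
  then show ?case using fcomp_one_one[of 1 j] by (simp add: iota_Phi compA_Phi)
qed (simp add: unitA_Phi)

text \<open>As \<open>om\<close> has period l, composing with a power of iota only shifts the
  degree, which removes the exponents of iota from later computations. The condition on
  \<open>snd\<close> makes this an equality of coordinates and not just of maps, since
  \<open>cmul\<close> clears second entries off the diagonal.\<close>

lemma fcomp_one_right:
  assumes "y \<ge> 0" "\<And>i. snd (G i) = 0"
  shows "fcomp y (int (j * l)) G one = G"
proof
  fix i
  have "nat (int i + y + int (j * l)) = nat (int i + y) + j * l" "\<not> int i + y < 0" using assms(1) by linarith+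
  then show "fcomp y (int (j * l)) G one i = G i"
    using assms(2) unfolding fcomp_def by (simp add: cmul_def one_def omega_add_mult_l prod_eq_iff)
qed

lemma chi_Phi: "chi p = Phi (int l - 1) one"
proof
  fix i
  \<comment> \<open>The source index of component \<open>i\<close>. Up to the period, chi leads from
    position \<open>j\<close> to position \<open>j + 1\<close>, against the direction of d, so the
    cases are those of the step of \<open>om\<close> at \<open>j\<close>.\<close>
  define j where "j = i + (l - 1)"
  have nj: "nat (int i + (int l - 1)) = j" and nn: "\<not> int i + (int l - 1) < 0"
    using l_pos by (simp_all add: j_def)
  have "Suc j = i + l" using l_pos by (simp add: j_def)
  then have om: "om (Suc j) = om i" and md: "i mod l = (if j mod l = l - 1 then 0 else Suc (j mod l))"
    using omega_add_l Suc_mod_l[of j] by simp_all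
  have P: "Phi (int l - 1) one i = hm (om i) (om j) (1, 0)"
    using nn by (simp add: Phi_def nj one_def)
  show "chi p i = Phi (int l - 1) one i" unfolding P
  proof (cases rule: mod_l_cases[of j])
    case 1
    then have q: "i mod l = Suc (j mod l)" "Suc (j mod l) \<le> p - 2" "j mod l \<le> p - 2" using md l_bounds(1) by simp_all
    have "om i = i mod l + 1" "om j = i mod l" using q omega_lower[of i] omega_lower[of j] by simp_all
    then show "chi p i = hm (om i) (om j) (1, 0)"
      using emap_off_diagonal[OF omega_bounds omega_bounds, of i j] q by (simp add: chi_def Let_def)
  next
    case 2
    then have q: "i mod l = p - 1" "i mod l \<noteq> 0" "\<not> i mod l \<le> p - 2" using md l_bounds(2,5) p_ge_3 by auto
    have "om i = p - 1" "om j = p - 1" using omega_step(2)[OF 2] om by simp_all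
    then show "chi p i = hm (om i) (om j) (1, 0)"
      using idP_hm[of "p - 1"] q p_ge_3 by (simp add: chi_def Let_def)
  next
    case 3
    then have q: "i mod l = Suc (j mod l)" "Suc (j mod l) \<noteq> p - 1" "\<not> Suc (j mod l) \<le> p - 2" "p - 1 \<le> i mod l"
      using md by simp_all
    have o: "om i = l - i mod l" "om j = l - i mod l + 1"
      using q(4) 3 omega_upper[of i] omega_step(3)[OF 3] om by simp_all
    then show "chi p i = hm (om i) (om j) (1, 0)"
      using emap_off_diagonal[OF omega_bounds omega_bounds, of i j] q by (simp add: chi_def Let_def)
  next
    case 4
    then have "i mod l = 0" using md by simp
    then show "chi p i = hm (om i) (om j) (1, 0)"
      using omega_step(4)[OF 4] om idP_hm[of 1] p_ge_3 by (simp add: chi_def Let_def)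
  qed
qed

lemma gamma_deg_nonneg: "gamma_deg p k \<ge> 0"
  using l_ge_4 by (simp add: gamma_deg_def)

text \<open>The degree is 1 - 2k modulo l, hence k - 1 goes to -k and k + p - 2 to p - 1 - k. Source
  and target then carry the same module, P_k respectively P_(p-k).\<close>

lemma gamma_source_mod:
  assumes k: "1 \<le> k" "k \<le> p - 1" and d: "d = i + (k * (l - 2) + 1)"
  shows "i mod l = k - 1 \<Longrightarrow> d mod l = l - k"
    and "i mod l = k + p - 2 \<Longrightarrow> d mod l = p - 1 - k"
proof -
  have l2: "l \<ge> k" "l \<ge> 2" using k l_eq by linarith+
  have dm: "d mod l = (i mod l + (k * (l - 2) + 1)) mod l" unfolding d by (simp only: mod_add_left_eq)
  have kl: "k * (l - 2) + k + k = k * l" using l2 by (simp add: diff_mult_distrib2)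
  { assume "i mod l = k - 1"
    then have "i mod l + (k * (l - 2) + 1) + k = k * l" using kl k by simp
    then have "i mod l + (k * (l - 2) + 1) = (k - 1) * l + (l - k)"
      using k l2 by (cases k) simp_all
    then show "d mod l = l - k" unfolding dm using k l_pos by simp }
  { assume "i mod l = k + p - 2"
    then have "i mod l + (k * (l - 2) + 1) = k * l + (p - 1 - k)" using kl k p_ge_3 by simp
    moreover have "p - 1 - k < l" using l_bounds(3) by simp
    ultimately show "d mod l = p - 1 - k" unfolding dm by (simp only: mod_mult_self3 mod_less) }
qed

lemma gamma_Phi:
  assumes k: "2 \<le> k" "k \<le> p - 1"
  shows "gamma p k = Phi (gamma_deg p k) (gc k)"
proof
  fix i
  define j where "j = i + (k * (l - 2) + 1)"
  have "int (l - 2) = int l - 2" using l_ge_4 by simp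
  then have "gamma_deg p k = int (k * (l - 2) + 1)" by (simp add: gamma_deg_def)
  then have nj: "nat (int i + gamma_deg p k) = j" and nn: "\<not> int i + gamma_deg p k < 0"
    unfolding j_def by linarith+
  have P: "Phi (gamma_deg p k) (gc k) i = hm (om i) (om j) (gc k i)"
    using nn by (simp add: Phi_def nj)
  have k1: "1 \<le> k" using k by simp
  note src = gamma_source_mod[OF k1 k(2) j_def]
  consider "i mod l = k - 1" | "i mod l = k + p - 2" "i mod l \<noteq> k - 1" | "i mod l \<noteq> k - 1" "i mod l \<noteq> k + p - 2" by blast
  then show "gamma p k i = Phi (gamma_deg p k) (gc k) i" unfolding P
  proof cases
    case 1
    have "om i = k" using omega_lower[of i] 1 k by simp
    moreover have "om j = k" using omega_upper[of j] src(1)[OF 1] k l_eq by simp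
    ultimately show "gamma p k i = hm (om i) (om j) (gc k i)"
      using 1 idP_hm[of k] k p_ge_3 by (simp add: gamma_def gc_def)
  next
    case 2
    have "om i = p - k" using omega_upper[of i] 2 k l_eq by simp
    moreover have "om j = p - k" using omega_lower[of j] src(2)[OF 2(1)] k by simp
    ultimately show "gamma p k i = hm (om i) (om j) (gc k i)"
      using 2 idP_hm[of "p - k"] k p_ge_3 by (simp add: gamma_def gc_def)
  next
    case 3
    then show "gamma p k i = hm (om i) (om j) (gc k i)"
      using k nn by (simp add: gamma_def gc_def zeroHom_hm nj)
  qed
qed

lemma gamma_deg_1: "gamma_deg p 1 = int l - 1"
  by (simp add: gamma_deg_def)

lemma sum_hdeg_true:
  assumes "\<forall>b\<in>set ls. fst b"
  shows "sum_list (map (hdeg p) ls) + 1 - int (length ls)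
    = gamma_deg p (length ls) + int (sum_list (map snd ls) * l)"
  using assms by (induction ls) (auto simp: hdeg_def gamma_deg_def algebra_simps)

text \<open>The exponents of iota do not occur: they enter \<open>fb\<close> only through the
  degree. A single iota power and a single chi both get the coordinates \<open>one\<close>, the
  latter through \<open>gc 1\<close>.\<close>

definition fcoef :: "lab list \<Rightarrow> nat \<Rightarrow> 'p coord" where
  "fcoef ls = (if length ls = 1 \<and> \<not> fst (hd ls) then one
    else if (\<forall>b\<in>set ls. fst b) \<and> 1 \<le> length ls \<and> length ls \<le> p - 1
    then fsc ((-1) ^ (length ls - 1)) (gc (length ls)) else 0)"

lemma fsc_1: "fsc 1 G = G"
  by (simp add: fsc_def smult2_def)

lemma fb_Phi: "ls \<noteq> [] \<Longrightarrow> fb p ls = Phi (sum_list (map (hdeg p) ls) + 1 - int (length ls)) (fcoef ls)"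
proof -
  assume ne: "ls \<noteq> []"
  consider (1) b where "ls = [b]" | (2) "2 \<le> length ls" "length ls \<le> p - 1" "\<forall>b\<in>set ls. fst b"
    | (3) "2 \<le> length ls" "\<not> (length ls \<le> p - 1 \<and> (\<forall>b\<in>set ls. fst b))"
    using ne by (metis One_nat_def Suc_1 Suc_leI length_0_conv length_Suc_conv le_neq_implies_less less_one not_le)
  then show ?thesis
  proof cases
    case 1
    obtain a j where b: "b = (a, j)" by (cases b)
    show ?thesis
    proof (cases a)
      case True
      have "fcomp (int l - 1) (int (j * l)) one one = one"
        using l_pos by (intro fcomp_one_right) (simp_all add: one_def)
      moreover have "Suc 0 \<le> p - Suc 0" using p_ge_3 by simp
      ultimately show ?thesis using 1 b True gc_1
        by (simp add: fb_def Let_def chi_Phi iota_pow_Phi compA_Phi fcoef_def hdeg_def fsc_1 algebra_simps)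
    next
      case False
      then show ?thesis using 1 b
        by (simp add: fb_def Let_def iota_pow_Phi fcoef_def hdeg_def)
    qed
  next
    case 2
    let ?n = "length ls" and ?J = "sum_list (map snd ls)"
    have "fcomp (gamma_deg p ?n) (int (?J * l)) (gc ?n) one = gc ?n"
      by (intro fcomp_one_right gamma_deg_nonneg) (simp add: gc_def)
    then have c: "compA p (gamma_deg p ?n) (gamma p ?n) (int (?J * l)) (iota_pow p ?J) = Phi (gd ?n ?J) (gc ?n)"
      using gamma_Phi[OF 2(1,2)] by (simp only: iota_pow_Phi compA_Phi)
    have s: "of_int ((-1) ^ (?n - 1)) = ((-1) ^ (?n - 1) :: 'p mod_ring)" by simp
    have "fb p ls = smulA p (sum_list (map (hdeg p) ls) + 1 - int ?n) ((-1) ^ (?n - 1))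
       (compA p (gamma_deg p ?n) (gamma p ?n) (int (?J * l)) (iota_pow p ?J))"
      using 2 by (auto simp: fb_def Let_def)
    then show ?thesis unfolding c sum_hdeg_true[OF 2(3)] smulA_Phi s using 2 by (auto simp: fcoef_def)
  next
    case 3
    then show ?thesis by (auto simp: fb_def Let_def fcoef_def zeroA_Phi)
  qed
qed

end

subsection \<open>Multilinear reduction to basis tensors\<close>

lemma lookup_scaleH: "Poly_Mapping.lookup (scaleH c x) b = c * Poly_Mapping.lookup x b"
  unfolding scaleH_def by (simp add: Poly_Mapping.map.rep_eq when_def)

lemma scaleH_single: "scaleH c (Poly_Mapping.single b d) = Poly_Mapping.single b (c * d)"
  by (intro poly_mapping_eqI) (simp add: lookup_scaleH lookup_single when_def)

lemma scaleH_scaleH: "scaleH c (scaleH d x) = scaleH (c * d) x"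
  by (intro poly_mapping_eqI) (simp add: lookup_scaleH mult.assoc)

lemma scaleH_zero_left: "scaleH 0 x = 0" and scaleH_zero_right: "scaleH c 0 = 0" and scaleH_one: "scaleH 1 x = x"
  by (intro poly_mapping_eqI; simp add: lookup_scaleH)+

abbreviation el :: "('a::prime_card) mod_ring \<times> lab \<Rightarrow> 'a Hel" where
  "el cb \<equiv> Poly_Mapping.single (snd cb) (fst cb)"

lemma mlinH_el:
  "mlinH F (map el cbs) = scaleH (prod_list (map fst cbs)) (F (map snd cbs))"
proof (induction cbs arbitrary: F)
  case Nil then show ?case by (simp add: scaleH_one)
next
  case (Cons cb cbs)
  then show ?case
    \<comment> \<open>For a zero coefficient the support is empty and both sides vanish; otherwise
      the sum has one term.\<close>
    by (cases "fst cb = 0") (simp_all add: scaleH_zero_left scaleH_scaleH)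
qed

lemma mlinH_eq_0: "(\<And>ls. length ls = length xs \<Longrightarrow> F ls = 0) \<Longrightarrow> mlinH F xs = 0"
proof (induction xs arbitrary: F)
  case (Cons x xs)
  have "mlinH (\<lambda>ls. F (b # ls)) xs = 0" for b by (rule Cons.IH) (simp add: Cons.prems)
  then show ?case by (simp add: scaleH_zero_right)
qed simp

context symmetric_group_prime
begin

section \<open>The operations m' on basis labels\<close>

definition mcoef :: "lab list \<Rightarrow> 'p mod_ring" where
  "mcoef ls = (if \<exists>b\<in>set ls. \<not> fst b then (if length ls = 2 then 1 else 0)
    else (if length ls = p then - 1 else 0))"

definition mlab :: "lab list \<Rightarrow> lab" where
  "mlab ls = (if \<exists>b\<in>set ls. \<not> fst b then (fst (ls ! 0) \<or> fst (ls ! 1), snd (ls ! 0) + snd (ls ! 1))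
    else (False, p - 1 + sum_list (map snd ls)))"

lemma odd_p: "odd p"
  using prime_p p_ge_3 prime_odd_nat[of p] by simp

lemma mb_eq: "(mb p ls :: 'p Hel) = el (mcoef ls, mlab ls)"
  using odd_p by (simp add: mb_def mcoef_def mlab_def bvec_def scaleH_single)

lemma mH_el: "mH p (map el cbs) = (el (prod_list (map fst cbs) * mcoef (map snd cbs), mlab (map snd cbs)) :: 'p Hel)"
  by (simp add: mH_def mlinH_el mb_eq scaleH_single)

lemma mH_eq_0: "length xs \<noteq> 2 \<Longrightarrow> length xs \<noteq> p \<Longrightarrow> mH p xs = (0 :: 'p Hel)"
  unfolding mH_def by (rule mlinH_eq_0) (simp add: mb_def)

text \<open>Division by l recovers the exponent of iota, and the remainder, 0 or l - 1, recovers the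
  power of chi.\<close>

lemma hdeg_inject: "hdeg p b = hdeg p b' \<longleftrightarrow> b = b'"
proof
  assume eq: "hdeg p b = hdeg p b'"
  obtain a j a' j' where b: "b = (a, j)" "b' = (a', j')" by (cases b, cases b')
  have d: "hdeg p (a, j) div int l = int j" and m: "hdeg p (a, j) mod int l = (if a then int l - 1 else 0)" for a j
    using l_pos by (auto simp: hdeg_def div_pos_pos_trivial)
  have "int j = int j'" using d[of a j] d[of a' j'] eq b by simp
  moreover have "a = a'" using m[of a j] m[of a' j'] eq b l_ge_4 by (auto split: if_splits)
  ultimately show "b = b'" using b by simp
qed simp

definition compat :: "int list \<Rightarrow> ('p mod_ring \<times> lab) list \<Rightarrow> bool" where
  "compat = list_all2 (\<lambda>d cb. fst cb \<noteq> 0 \<longrightarrow> hdeg p (snd cb) = d)"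

lemma homogH_cases:
  assumes "homogH p z (x :: 'p Hel)"
  obtains cb where "x = el cb" "fst cb \<noteq> 0 \<longrightarrow> hdeg p (snd cb) = z"
proof (cases "x = 0")
  case True then show thesis using that[of "(0, undefined)"] by simp
next
  case False
  then obtain b where b: "b \<in> Poly_Mapping.keys x" by (metis keys_eq_empty ex_in_conv)
  have "Poly_Mapping.keys x = {b}"
  proof
    show "Poly_Mapping.keys x \<subseteq> {b}"
    proof
      fix b' assume "b' \<in> Poly_Mapping.keys x"
      then have "hdeg p b' = hdeg p b" using assms b by (simp add: homogH_def)
      then show "b' \<in> {b}" using hdeg_inject by blast
    qed
  qed (use b in simp)
  then have "x = el (Poly_Mapping.lookup x b, b)"
    by (intro poly_mapping_eqI) (auto simp: lookup_single when_def in_keys_iff)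
  then show thesis using that[of "(Poly_Mapping.lookup x b, b)"] assms b by (simp add: homogH_def)
qed

lemma homogH_list_cases:
  assumes "length ds = length xs" "\<forall>i < length xs. homogH p (ds ! i) (xs ! i :: 'p Hel)"
  obtains cbs where "xs = map el cbs" "compat ds cbs"
proof -
  have "\<exists>cbs. xs = map el cbs \<and> compat ds cbs" using assms
  proof (induction ds xs rule: list_induct2)
    case Nil then show ?case by (intro exI[of _ "[]"]) (simp add: compat_def)
  next
    case (Cons d ds x xs)
    have "homogH p d x" using Cons.prems by force
    then obtain cb where cb: "x = el cb" "fst cb \<noteq> 0 \<longrightarrow> hdeg p (snd cb) = d"
      by (rule homogH_cases)
    have "\<forall>i < length xs. homogH p (ds ! i) (xs ! i)" using Cons.prems by auto
    then obtain cbs where "xs = map el cbs" "compat ds cbs" using Cons.IH by blast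
    then show ?case using cb by (intro exI[of _ "cb # cbs"]) (simp add: compat_def)
  qed
  then show thesis using that by blast
qed

lemma compat_length: "compat ds cbs \<Longrightarrow> length ds = length cbs"
  by (simp add: compat_def list_all2_lengthD)

lemma compat_append: "\<lbrakk>compat ds cbs; compat ds' cbs'\<rbrakk> \<Longrightarrow> compat (ds @ ds') (cbs @ cbs')"
  by (simp add: compat_def list_all2_appendI)

lemma compat_take: "compat ds cbs \<Longrightarrow> compat (take n ds) (take n cbs)"
  by (simp add: compat_def list_all2_takeI)

lemma compat_drop: "compat ds cbs \<Longrightarrow> compat (drop n ds) (drop n cbs)"
  by (simp add: compat_def list_all2_dropI)

text \<open>The dichotomy behind every multilinear reduction: either the product of the coefficients
  is 0 and both sides of a relation vanish, or the signs computed from \<open>ds\<close> are those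
  of the labels.\<close>

lemma compat_degrees:
  assumes "compat ds cbs" "prod_list (map fst cbs) \<noteq> 0"
  shows "ds = map (hdeg p) (map snd cbs)"
  using assms unfolding compat_def by (induction rule: list_all2_induct) auto

lemma mlab_degree:
  assumes "mcoef ls \<noteq> 0"
  shows "hdeg p (mlab ls) = sum_list (map (hdeg p) ls) + 2 - int (length ls)"
proof (cases "\<exists>b\<in>set ls. \<not> fst b")
  case True
  then have "length ls = 2" using assms by (simp add: mcoef_def split: if_splits)
  then obtain b c where "ls = [b, c]" by (auto simp: numeral_2_eq_2 length_Suc_conv)
  then show ?thesis using True by (auto simp: mlab_def hdeg_def algebra_simps)
next
  case False
  then have n: "length ls = p" using assms by (simp add: mcoef_def split: if_splits)
  \<comment> \<open>The degree of p factors chi, raised by 2 - p. It equals that of iota^(p-1)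
    because \<open>p * (l - 2) + 2 = (p - 1) * l\<close> for \<open>l = 2 * (p - 1)\<close>.\<close>
  have "gamma_deg p p + 1 = int ((p - 1) * l)"
  proof -
    have "int (p - 1) = int p - 1" "int l = 2 * (int p - 1)" using p_ge_3 l_eq by auto
    then show ?thesis unfolding gamma_deg_def of_nat_mult by (simp add: algebra_simps)
  qed
  then show ?thesis using sum_hdeg_true[of ls] False n
    by (simp add: mlab_def hdeg_def algebra_simps)
qed

lemma mH_homog:
  assumes "compat ds cbs"
  shows "prod_list (map fst cbs) * mcoef (map snd cbs) \<noteq> 0 \<Longrightarrow>
    hdeg p (mlab (map snd cbs)) = sum_list ds + 2 - int (length cbs)"
  using compat_degrees[OF assms] mlab_degree[of "map snd cbs"] by simp

text \<open>The hypothesis is restricted to nonzero coefficients because only then do the degrees of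
  the labels have to agree with \<open>z\<close>.\<close>

lemma mlinA_el:
  assumes "prod_list (map fst cbs) \<noteq> 0 \<Longrightarrow> F (map snd cbs) = Phi z G"
  shows "mlinA p z F (map el cbs) = Phi z (fsc (prod_list (map fst cbs)) G)"
  using assms
proof (induction cbs arbitrary: F)
  case Nil then show ?case by (simp add: fsc_1)
next
  case (Cons cb cbs)
  show ?case
  proof (cases "fst cb = 0")
    case True
    have "fsc 0 G = 0" by (simp add: fsc_def smult2_def fun_eq_iff prod_eq_iff)
    then show ?thesis using True by (simp add: sumA_def zeroA_Phi zero_fun_def)
  next
    case False
    have IH: "mlinA p z (\<lambda>ls. F (snd cb # ls)) (map el cbs) = Phi z (fsc (prod_list (map fst cbs)) G)"
      by (rule Cons.IH) (use Cons.prems False in simp)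
    have "fsc (fst cb) (fsc (prod_list (map fst cbs)) G) + 0 = fsc (fst cb * prod_list (map fst cbs)) G"
      by (simp add: fsc_def smult2_def fun_eq_iff prod_eq_iff)
    then show ?thesis using False IH
      by (simp add: sumA_def zeroA_Phi smulA_Phi addA_Phi of_int_of_int_mod_ring)
  qed
qed

lemma fA_el:
  assumes "compat ds cbs" "cbs \<noteq> []"
  shows "fA p ds (map el cbs) =
    Phi (sum_list ds + 1 - int (length cbs)) (fsc (prod_list (map fst cbs)) (fcoef (map snd cbs)))"
  unfolding fA_def length_map
proof (rule mlinA_el)
  assume "prod_list (map fst cbs) \<noteq> 0"
  then have "ds = map (hdeg p) (map snd cbs)" by (rule compat_degrees[OF assms(1)])
  then show "fb p (map snd cbs) = Phi (sum_list ds + 1 - int (length cbs)) (fcoef (map snd cbs))"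
    using fb_Phi[of "map snd cbs"] assms(2) by simp
qed

lemma compat_mid:
  assumes c: "compat ds cbs" and s: "r + s \<le> length cbs"
  defines "mid \<equiv> take s (drop r cbs)"
  shows "compat (take r ds @ [sum_list (take s (drop r ds)) + 2 - int s] @ drop (r + s) ds)
    (take r cbs @ [(prod_list (map fst mid) * mcoef (map snd mid), mlab (map snd mid))] @ drop (r + s) cbs)"
proof (intro compat_append compat_take compat_drop c)
  have "length mid = s" using s by (simp add: mid_def)
  then show "compat [sum_list (take s (drop r ds)) + 2 - int s]
      [(prod_list (map fst mid) * mcoef (map snd mid), mlab (map snd mid))]"
    using mH_homog[OF compat_take[OF compat_drop[OF c]], of s r] by (simp add: compat_def mid_def)
qed

end

subsection \<open>The Stasheff relations on homology\<close>

lemma sum_list_concat_map: "(\<Sum>x\<leftarrow>concat (map g ys). f x) = (\<Sum>y\<leftarrow>ys. \<Sum>x\<leftarrow>g y. f x)"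
  by (induction ys) simp_all

lemma rst_triples_sum:
  "(\<Sum>x\<leftarrow>rst_triples n. f x) = (\<Sum>r\<in>{..n}. \<Sum>s\<in>{1..n - r}. f (r, s, n - r - s))"
proof -
  have "{0..<n + 1} = {..n}" "\<And>r. {1..<n - r + 1} = {1..n - r}" by auto
  then show ?thesis
    unfolding rst_triples_def sum_list_concat_map map_map o_def
    by (simp only: interv_sum_list_conv_sum_set_nat set_upt)
qed

lemma rst_triples_mem: "(r, s, t) \<in> set (rst_triples n) \<longleftrightarrow> 1 \<le> s \<and> r + s + t = n"
  by (auto simp: rst_triples_def simp del: upt_Suc intro!: bexI[of _ r] image_eqI)

text \<open>In the Stasheff and in the morphism relations the inner operation has arity 2 or p; this
  leaves two simple sums over its position.\<close>

lemma rst_triples_sum_two: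
  assumes ab: "1 \<le> a" "1 \<le> b" "a \<noteq> b"
    and zero: "\<And>r s. \<lbrakk>r + s \<le> n; s \<noteq> a; s \<noteq> b\<rbrakk> \<Longrightarrow> f (r, s, n - r - s) = 0"
  shows "(\<Sum>x\<leftarrow>rst_triples n. f x) =
    (\<Sum>r<n + 1 - a. f (r, a, n - r - a)) + (\<Sum>r<n + 1 - b. f (r, b, n - r - b))"
proof -
  let ?g = "\<lambda>a r. if r + a \<le> n then f (r, a, n - r - a) else 0"
  have "(\<Sum>s\<in>{1..n - r}. f (r, s, n - r - s)) = ?g a r + ?g b r" if r: "r \<le> n" for r
  proof -
    have "(\<Sum>s\<in>{1..n - r}. f (r, s, n - r - s)) =
      (\<Sum>s\<in>{1..n - r}. (if s = a then f (r, s, n - r - s) else 0) + (if s = b then f (r, s, n - r - s) else 0))"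
      using ab(3) zero[of r] r by (intro sum.cong) auto
    also have "\<dots> = ?g a r + ?g b r"
      using ab r by (simp add: sum.distrib le_diff_conv2 add.commute)
    finally show ?thesis .
  qed
  moreover have "(\<Sum>r\<in>{..n}. ?g a r) = (\<Sum>r<n + 1 - a. f (r, a, n - r - a))" for a
    by (rule sum.mono_neutral_cong_right) auto
  ultimately show ?thesis unfolding rst_triples_sum by (simp add: sum.distrib)
qed

definition outer_with :: "'b \<Rightarrow> 'b list \<Rightarrow> nat \<Rightarrow> nat \<Rightarrow> 'b list" where
  "outer_with y xs r s = take r xs @ [y] @ drop (r + s) xs"

lemma map_outer_with: "map f (outer_with y xs r s) = outer_with (f y) (map f xs) r s"
  by (simp add: outer_with_def take_map drop_map)

lemma length_outer_with: "r + s \<le> length xs \<Longrightarrow> length (outer_with y xs r s) = length xs - s + 1"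
  by (simp add: outer_with_def)

lemma prod_list_outer_with:
  fixes xs :: "'b::comm_monoid_mult list"
  shows "prod_list (outer_with (prod_list (take s (drop r xs)) * c) xs r s) = prod_list xs * c"
proof -
  have "xs = take r xs @ take s (drop r xs) @ drop (r + s) xs"
    by (metis add.commute append_take_drop_id drop_drop)
  then have "prod_list xs = prod_list (take r xs) * (prod_list (take s (drop r xs)) * prod_list (drop (r + s) xs))"
    by (metis prod_list.append)
  then show ?thesis by (simp add: outer_with_def mult_ac)
qed

context symmetric_group_prime
begin

abbreviation falses :: "lab list \<Rightarrow> nat" where
  "falses ls \<equiv> length (filter (\<lambda>b. \<not> fst b) ls)"

lemma falses_0_iff: "falses ls = 0 \<longleftrightarrow> (\<forall>b\<in>set ls. fst b)"
  by (simp add: filter_empty_conv)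

definition outer :: "lab list \<Rightarrow> nat \<Rightarrow> nat \<Rightarrow> lab list" where
  "outer ls r s = outer_with (mlab (take s (drop r ls))) ls r s"

lemma Ainf_rel_H_basis_imp:
  assumes c: "compat ds cbs"
    and basis: "(\<Sum>(r, s, t)\<leftarrow>rst_triples (length cbs). el (of_int (sgn_rst (map (hdeg p) (map snd cbs)) r s t) *
       (mcoef (take s (drop r (map snd cbs))) * mcoef (outer (map snd cbs) r s)), mlab (outer (map snd cbs) r s))) = (0 :: 'p Hel)"
  shows "Ainf_rel_H p ds (map el cbs) = (0 :: 'p Hel)"
proof -
  let ?ls = "map snd cbs" and ?C = "prod_list (map fst cbs)"
  have inner: "mH p (take r (map el cbs) @ [mH p (take s (drop r (map el cbs)))] @ drop (r + s) (map el cbs))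
     = el (?C * (mcoef (take s (drop r ?ls)) * mcoef (outer ?ls r s)), mlab (outer ?ls r s))" for r s
  proof -
    let ?mid = "take s (drop r cbs)"
    let ?cb = "(prod_list (map fst ?mid) * mcoef (map snd ?mid), mlab (map snd ?mid))"
    have "take r (map el cbs) @ [mH p (take s (drop r (map el cbs)))] @ drop (r + s) (map el cbs)
      = map el (outer_with ?cb cbs r s)"
      unfolding take_map drop_map mH_el outer_with_def by simp
    moreover have "map snd (outer_with ?cb cbs r s) = outer ?ls r s"
      unfolding map_outer_with outer_def by (simp add: take_map drop_map)
    moreover have "prod_list (map fst (outer_with ?cb cbs r s)) = ?C * mcoef (map snd ?mid)"
      unfolding map_outer_with fst_conv by (simp add: prod_list_outer_with flip: take_map drop_map)
    ultimately show ?thesis by (simp add: mH_el take_map drop_map mult.assoc)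
  qed
  have "Ainf_rel_H p ds (map el cbs) = (\<Sum>(r, s, t)\<leftarrow>rst_triples (length cbs).
    scaleH (of_int (sgn_rst ds r s t)) (el (?C * (mcoef (take s (drop r ?ls)) * mcoef (outer ?ls r s)), mlab (outer ?ls r s)) :: 'p Hel))"
    unfolding Ainf_rel_H_def inner length_map ..
  also have "\<dots> = scaleH ?C (\<Sum>(r, s, t)\<leftarrow>rst_triples (length cbs). el (of_int (sgn_rst ds r s t) *
       (mcoef (take s (drop r ?ls)) * mcoef (outer ?ls r s)), mlab (outer ?ls r s)))" (is "_ = scaleH ?C (sum_list (map ?f ?xs))")
  proof -
    have "scaleH a (x + y) = scaleH a x + scaleH a y" for a and x y :: "'p Hel"
      by (intro poly_mapping_eqI) (simp add: lookup_scaleH lookup_add distrib_left)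
    then have sc: "scaleH a (sum_list xs) = (\<Sum>x\<leftarrow>xs. scaleH a x)" for a and xs :: "'p Hel list"
      by (induction xs) (simp_all add: scaleH_zero_right)
    show ?thesis unfolding sc map_map
      by (intro arg_cong[of _ _ sum_list] map_cong refl) (auto simp: scaleH_single mult_ac)
  qed
  also have "\<dots> = 0"
  proof (cases "?C = 0")
    case False
    have "ds = map (hdeg p) ?ls" by (rule compat_degrees[OF c False])
    then show ?thesis using basis by (simp only: scaleH_zero_right)
  next
    case True
    then show ?thesis by (simp only: scaleH_zero_left)
  qed
  finally show ?thesis .
qed

lemma split_two:
  assumes "Suc r < length ls"
  obtains A x y D where "ls = A @ x # y # D" "length A = r"
    "take 2 (drop r ls) = [x, y]" "outer ls r 2 = A @ mlab [x, y] # D" "ls ! r = x" "ls ! Suc r = y"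
proof -
  have d: "drop r ls = ls ! r # ls ! Suc r # drop (r + 2) ls"
    using assms by (simp add: Cons_nth_drop_Suc)
  then have e: "ls = take r ls @ ls ! r # ls ! Suc r # drop (r + 2) ls" by (metis append_take_drop_id)
  have "take 2 (drop r ls) = [ls ! r, ls ! Suc r]" by (simp add: d numeral_2_eq_2)
  then show thesis using that[OF e] assms by (simp add: outer_def outer_with_def)
qed

lemma mcoef_two: "mcoef [x, y] = (if fst x \<and> fst y then 0 else 1)"
  using p_ge_3 by (simp add: mcoef_def)

text \<open>Merging a neighbouring pair by m'_2 is nonzero unless both are chi, and it then removes
  exactly one label without chi. So the merged tuple consists of chi only precisely when the
  original had a single exception.\<close>

lemma merge_all_true:
  assumes "Suc r < length ls"
  shows "mcoef (take 2 (drop r ls)) = (if fst (ls ! r) \<and> fst (ls ! Suc r) then 0 else 1)"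
    and "\<not> (fst (ls ! r) \<and> fst (ls ! Suc r)) \<Longrightarrow> (\<forall>b\<in>set (outer ls r 2). fst b) \<longleftrightarrow> falses ls = 1"
proof -
  obtain A x y D where s: "ls = A @ x # y # D" "take 2 (drop r ls) = [x, y]"
    "outer ls r 2 = A @ mlab [x, y] # D" "ls ! r = x" "ls ! Suc r = y"
    using split_two[OF assms] by metis
  show "mcoef (take 2 (drop r ls)) = (if fst (ls ! r) \<and> fst (ls ! Suc r) then 0 else 1)"
    unfolding s(2,4,5) by (rule mcoef_two)
  assume ne: "\<not> (fst (ls ! r) \<and> fst (ls ! Suc r))"
  then have "fst (mlab [x, y]) \<longleftrightarrow> fst x \<or> fst y" using s by (auto simp: mlab_def)
  then have "(\<forall>b\<in>set (outer ls r 2). fst b) \<longleftrightarrow> falses A = 0 \<and> falses D = 0 \<and> (fst x \<or> fst y)"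
    unfolding s(3) falses_0_iff by auto
  moreover have "falses ls = falses A + falses D + (if fst x then 0 else 1) + (if fst y then 0 else 1)"
    unfolding s(1) by simp
  ultimately show "(\<forall>b\<in>set (outer ls r 2). fst b) \<longleftrightarrow> falses ls = 1" using ne s(4,5) by auto
qed

lemma mlab_outer_two:
  assumes "Suc r < length ls" "\<not> (fst (ls ! r) \<and> fst (ls ! Suc r))" "\<forall>b\<in>set (outer ls r 2). fst b"
  shows "mlab (outer ls r 2) = (False, p - 1 + sum_list (map snd ls))"
proof -
  obtain A x y D where s: "ls = A @ x # y # D" "take 2 (drop r ls) = [x, y]"
    "outer ls r 2 = A @ mlab [x, y] # D" "ls ! r = x" "ls ! Suc r = y"
    using split_two[OF assms(1)] by metis
  have "snd (mlab [x, y]) = snd x + snd y" using assms(2) unfolding s(4,5) by (auto simp: mlab_def)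
  then have "sum_list (map snd (A @ mlab [x, y] # D)) = sum_list (map snd (A @ x # y # D))" by simp
  then have "sum_list (map snd (outer ls r 2)) = sum_list (map snd ls)" unfolding s(3) s(1)[symmetric] .
  then show ?thesis using assms(3) by (auto simp: mlab_def)
qed

lemma single_false_position:
  assumes "falses ls = 1"
  obtains i where "i < length ls" "\<And>r. r < length ls \<Longrightarrow> \<not> fst (ls ! r) \<longleftrightarrow> r = i"
proof -
  obtain x where "filter (\<lambda>b. \<not> fst b) ls = [x]" using assms by (auto simp: length_Suc_conv)
  then obtain us vs where s: "ls = us @ x # vs" "\<forall>u\<in>set us. fst u" "\<not> fst x" "filter (\<lambda>b. \<not> fst b) vs = []"
    by (auto simp: filter_eq_Cons_iff)
  then have v: "\<forall>u\<in>set vs. fst u" by (simp add: filter_empty_conv)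
  show thesis
  proof (rule that[of "length us"])
    fix r assume r: "r < length ls"
    then show "\<not> fst (ls ! r) \<longleftrightarrow> r = length us"
      using s bspec[OF s(2) nth_mem, of r] bspec[OF v nth_mem, of "r - Suc (length us)"]
      by (auto simp: nth_append nth_Cons')
  qed (simp add: s(1))
qed

lemma mcoef_p_nonzero:
  assumes "length ls = p"
  shows "mcoef ls = (if \<forall>b\<in>set ls. fst b then - 1 else 0)"
  using assms p_ge_3 by (auto simp: mcoef_def)

text \<open>An exceptional label at position i can be merged with its right or its left neighbour,
  with opposite signs. Inside the tuple the two contributions cancel; at an end there is just
  one.\<close>

lemma alternating_pair_sum:
  fixes g :: "nat \<Rightarrow> 'p mod_ring" and T :: "'p mod_ring \<Rightarrow> 'b::ab_group_add"
  assumes i: "i \<le> n" and T: "\<And>r. T (g (Suc r)) = - T (g r)" and n: "1 \<le> n"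
  shows "(\<Sum>r<n. if r = i \<or> Suc r = i then T (g r) else 0) =
    (if i = 0 then T (g 0) else 0) + (if i = n then T (g (n - 1)) else 0)"
proof -
  have "(\<Sum>r<n. if r = i \<or> Suc r = i then T (g r) else 0) =
    (\<Sum>r<n. (if r = i then T (g r) else 0) + (if r = i - 1 \<and> i \<noteq> 0 then T (g r) else 0))"
    by (intro sum.cong) auto
  also have "\<dots> = (if i < n then T (g i) else 0) + (if i \<noteq> 0 \<and> i - 1 < n then T (g (i - 1)) else 0)"
    by (cases "i = 0") (simp_all add: sum.distrib)
  also have "\<dots> = (if i = 0 then T (g 0) else 0) + (if i = n then T (g (n - 1)) else 0)"
    using i n T[of "i - 1"] by (cases "i = 0"; cases "i = n") auto
  finally show ?thesis .
qed

lemma length_outer: "r + s \<le> length ls \<Longrightarrow> length (outer ls r s) = length ls - s + 1"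
  unfolding outer_def by (rule length_outer_with)

text \<open>The value of m'_p is a power of iota, so another m'_p, or an f_n with n at least 2,
  vanishes on the resulting tuple.\<close>

lemma outer_has_false:
  assumes "mcoef (take p (drop r ls)) \<noteq> 0" "r + p \<le> length ls"
  shows "\<exists>b\<in>set (outer ls r p). \<not> fst b" "\<forall>b\<in>set (take p (drop r ls)). fst b"
proof -
  have "length (take p (drop r ls)) = p" using assms(2) by simp
  then show all: "\<forall>b\<in>set (take p (drop r ls)). fst b"
    using assms(1) mcoef_p_nonzero by metis
  then have "\<not> fst (mlab (take p (drop r ls)))" unfolding mlab_def by auto
  then show "\<exists>b\<in>set (outer ls r p). \<not> fst b" unfolding outer_def outer_with_def by auto
qed

lemma sgn_mod_ring: "(of_int (sgn e) :: 'p mod_ring) = (if even e then 1 else - 1)"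
  by (simp add: sgn_def)

lemma hdeg_even_iff: "even (hdeg p b) \<longleftrightarrow> \<not> fst b"
proof -
  have "even (int l)" by (simp add: l_eq)
  then show ?thesis by (simp add: hdeg_def)
qed

section \<open>The terms of the Stasheff relations\<close>

definition hterm :: "lab list \<Rightarrow> nat \<times> nat \<times> nat \<Rightarrow> 'p Hel" where
  "hterm ls = (\<lambda>(r, s, t). el (of_int (sgn_rst (map (hdeg p) ls) r s t) *
       (mcoef (take s (drop r ls)) * mcoef (outer ls r s)), mlab (outer ls r s)))"

lemma mcoef_length: "length ls \<noteq> 2 \<Longrightarrow> length ls \<noteq> p \<Longrightarrow> mcoef ls = 0"
  by (simp add: mcoef_def)

lemma hterm_eq_0:
  "mcoef (take s (drop r ls)) = 0 \<or> mcoef (outer ls r s) = 0 \<Longrightarrow> hterm ls (r, s, t) = 0"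
  by (auto simp: hterm_def)

lemma hterm_sum:
  "(\<Sum>x\<leftarrow>rst_triples (length ls). hterm ls x) =
    (\<Sum>r<length ls - 1. hterm ls (r, 2, length ls - r - 2)) + (\<Sum>r<length ls + 1 - p. hterm ls (r, p, length ls - r - p))"
proof -
  have "(\<Sum>x\<leftarrow>rst_triples (length ls). hterm ls x) =
    (\<Sum>r<length ls + 1 - 2. hterm ls (r, 2, length ls - r - 2)) + (\<Sum>r<length ls + 1 - p. hterm ls (r, p, length ls - r - p))"
  proof (rule rst_triples_sum_two)
    fix r s assume "r + s \<le> length ls" "s \<noteq> 2" "s \<noteq> p"
    then show "hterm ls (r, s, length ls - r - s) = 0" by (intro hterm_eq_0 disjI1 mcoef_length) auto
  qed (use p_ge_3 in auto)
  then show ?thesis by (simp add: numeral_2_eq_2)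
qed

text \<open>This is the associativity of m'_2. For p = 3 an inner operation of arity p also fits,
  but it leaves a tuple of length 1, on which m' vanishes.\<close>

lemma hterm_sum_3:
  assumes "length ls = 3"
  shows "(\<Sum>x\<leftarrow>rst_triples (length ls). hterm ls x) = 0"
proof -
  obtain a b c where ls: "ls = [a, b, c]" using assms by (auto simp: numeral_3_eq_3 length_Suc_conv)
  have "hterm ls (r, p, length ls - r - p) = 0" if "r < length ls + 1 - p" for r
  proof -
    have "length (outer ls r p) = 1" using that assms p_ge_3 by (subst length_outer) auto
    then show ?thesis using p_ge_3 by (intro hterm_eq_0 disjI2 mcoef_length) auto
  qed
  then have "(\<Sum>r<length ls + 1 - p. hterm ls (r, p, length ls - r - p)) = 0" by (intro sum.neutral) auto
  moreover have "(\<Sum>r<length ls - 1. hterm ls (r, 2, length ls - r - 2)) = 0"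
  proof -
    have m: "mcoef [x, y] = (if fst x \<and> fst y then 0 else 1)" for x y by (rule mcoef_two)
    have "(\<Sum>r<length ls - 1. hterm ls (r, 2, length ls - r - 2)) = hterm ls (0, 2, 1) + hterm ls (1, 2, 0)"
      by (simp add: ls numeral_2_eq_2)
    also have "\<dots> = 0"
      by (cases a; cases b; cases c) (auto simp: hterm_def ls outer_def outer_with_def m sgn_rst_def sgn_def mlab_def add.assoc simp flip: single_add)
    finally show ?thesis .
  qed
  ultimately show ?thesis unfolding hterm_sum by simp
qed

text \<open>Nested arities 2, 2 need three entries, and 2, p or p, 2 need p + 1; a nesting p, p
  vanishes since the inner value contains no chi.\<close>

lemma hterm_sum_other:
  assumes "length ls \<noteq> 3" "length ls \<noteq> p + 1"
  shows "(\<Sum>x\<leftarrow>rst_triples (length ls). hterm ls x) = 0"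
proof -
  have "hterm ls (r, p, length ls - r - p) = 0" if "r < length ls + 1 - p" for r
  proof (cases "mcoef (take p (drop r ls)) = 0")
    case False
    have n: "length (outer ls r p) \<noteq> 2" using that assms by (subst length_outer) auto
    have "mcoef (outer ls r p) = 0"
      using outer_has_false(1)[OF False] that n by (simp add: mcoef_def)
    then show ?thesis by (intro hterm_eq_0 disjI2)
  qed (intro hterm_eq_0 disjI1)
  moreover have "hterm ls (r, 2, length ls - r - 2) = 0" if "r < length ls - 1" for r
  proof -
    have "length (outer ls r 2) = length ls - 1" using that by (subst length_outer) auto
    then show ?thesis using assms that by (intro hterm_eq_0 disjI2 mcoef_length) auto
  qed
  ultimately show ?thesis unfolding hterm_sum by simp
qed

text \<open>As p is odd, rs + t has the parity of r, and m'_2 has degree 0, so no Koszul sign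
  arises; the outer m'_p contributes the factor -1.\<close>

lemma hterm_two:
  assumes "length ls = p + 1" "r < p"
  shows "hterm ls (r, 2, p - 1 - r) = (if falses ls = 1 \<and> \<not> (fst (ls ! r) \<and> fst (ls ! Suc r))
    then el (if even r then - 1 else 1, (False, p - 1 + sum_list (map snd ls))) else 0)"
proof -
  have r: "Suc r < length ls" using assms by simp
  note m = merge_all_true[OF r]
  have len: "length (outer ls r 2) = p" using assms by (subst length_outer) auto
  have e: "even (int (r * 2 + (p - 1 - r)) + (2 - int 2) * x) \<longleftrightarrow> even r" for x
    using odd_p assms(2) by auto
  show ?thesis
  proof (cases "fst (ls ! r) \<and> fst (ls ! Suc r)")
    case True then show ?thesis using m(1) by (simp add: hterm_def)
  next
    case False
    then have o: "mcoef (outer ls r 2) = (if falses ls = 1 then - 1 else 0)"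
      using m(2)[OF False] mcoef_p_nonzero[OF len] by simp
    show ?thesis
    proof (cases "falses ls = 1")
      case True
      then have "mlab (outer ls r 2) = (False, p - 1 + sum_list (map snd ls))"
        using mlab_outer_two[OF r False] m(2)[OF False] by simp
      then show ?thesis using False True o m(1) unfolding hterm_def prod.case sgn_rst_def sgn_mod_ring e by auto
    next
      case F: False
      then show ?thesis using o by (simp add: hterm_def)
    qed
  qed
qed

lemma hterm_p_left:
  assumes "length ls = p + 1"
  shows "hterm ls (0, p, 1) = (if falses (take p ls) = 0
    then el (1, (fst (ls ! p), p - 1 + sum_list (map snd ls))) else 0)"
proof -
  have ls: "ls = take p ls @ [ls ! p]" using assms by (metis Suc_eq_plus1 lessI take_Suc_conv_app_nth take_all order_refl)
  have len: "length (take p ls) = p" using assms by simp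
  have out: "outer ls 0 p = [mlab (take p ls), ls ! p]"
    using arg_cong[OF ls, of "drop p"] len by (simp add: outer_def outer_with_def)
  have J: "sum_list (map snd ls) = sum_list (map snd (take p ls)) + snd (ls ! p)"
    using arg_cong[OF ls, of "\<lambda>ls. sum_list (map snd ls)"] by simp
  show ?thesis
  proof (cases "falses (take p ls) = 0")
    case True
    then have t: "\<forall>b\<in>set (take p ls). fst b" unfolding falses_0_iff .
    then have ml: "mlab (take p ls) = (False, p - 1 + sum_list (map snd (take p ls)))" by (auto simp: mlab_def)
    have mc: "mcoef (take p ls) = - 1" using t mcoef_p_nonzero[OF len] by simp
    show ?thesis using True mc mcoef_two
      by (simp add: hterm_def out ml sgn_rst_def sgn_def J) (simp add: mlab_def add.assoc)
  next
    case False
    then have "mcoef (take p ls) = 0" unfolding falses_0_iff using mcoef_p_nonzero[OF len] by simp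
    then show ?thesis using False by (simp add: hterm_def)
  qed
qed

lemma hterm_p_right:
  assumes "length ls = p + 1"
  shows "hterm ls (1, p, 0) = (if falses (drop 1 ls) = 0
    then el (if fst (ls ! 0) then - 1 else 1, (fst (ls ! 0), p - 1 + sum_list (map snd ls))) else 0)"
proof -
  obtain b bs where ls: "ls = b # bs" using assms by (cases ls) auto
  have len: "length bs = p" using assms ls by simp
  have out: "outer ls 1 p = [b, mlab bs]" using len ls by (simp add: outer_def outer_with_def)
  \<comment> \<open>m'_p has odd degree 2 - p, so passing the first entry produces a Koszul sign
    exactly when that entry contains chi.\<close>
  have e: "even (int (1 * p + 0) + (2 - int p) * sum_list (take 1 (map (hdeg p) ls))) \<longleftrightarrow> fst b"
    using odd_p hdeg_even_iff[of b] ls by simp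
  show ?thesis
  proof (cases "falses bs = 0")
    case True
    then have t: "\<forall>b\<in>set bs. fst b" unfolding falses_0_iff .
    then have ml: "mlab bs = (False, p - 1 + sum_list (map snd bs))" by (auto simp: mlab_def)
    have mc: "mcoef bs = - 1" using t mcoef_p_nonzero[OF len] by simp
    have dr: "take p (drop 1 ls) = bs" using ls len by simp
    have mo: "mcoef [b, mlab bs] = 1" "mlab [b, mlab bs] = (fst b, p - 1 + sum_list (map snd ls))"
      using mcoef_two[of b "mlab bs"] unfolding ml by (simp_all add: mlab_def[of "[b, _]"] ls add.commute)
    show ?thesis using True
      unfolding hterm_def sgn_rst_def prod.case out dr mc mo sgn_mod_ring e by (simp add: ls)
  next
    case False
    then have "mcoef bs = 0" unfolding falses_0_iff using mcoef_p_nonzero[OF len] by simp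
    then show ?thesis using False ls len by (simp add: hterm_def)
  qed
qed

text \<open>For chi only, the two terms with inner m'_p cancel. With one power of iota, an inner
  position cancels by merging to both sides, and an end position is balanced by the inner m'_p on
  the other p entries. With two or more exceptions every term vanishes.\<close>

lemma hterm_sum_Suc_p:
  assumes n: "length ls = p + 1"
  shows "(\<Sum>x\<leftarrow>rst_triples (length ls). hterm ls x) = 0"
proof -
  let ?J = "(False, p - 1 + sum_list (map snd ls))"
  let ?g = "\<lambda>r::nat. if even r then - 1 else 1 :: 'p mod_ring"
  have S: "(\<Sum>x\<leftarrow>rst_triples (length ls). hterm ls x) =
    (\<Sum>r<p. if falses ls = 1 \<and> \<not> (fst (ls ! r) \<and> fst (ls ! Suc r)) then el (?g r, ?J) else 0)
    + (hterm ls (0, p, 1) + hterm ls (1, p, 0))"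
  proof -
    have "(\<Sum>r<length ls + 1 - p. hterm ls (r, p, length ls - r - p)) = hterm ls (0, p, 1) + hterm ls (1, p, 0)"
      using n by (simp add: numeral_2_eq_2)
    moreover have "(\<Sum>r<length ls - 1. hterm ls (r, 2, length ls - r - 2)) =
      (\<Sum>r<p. if falses ls = 1 \<and> \<not> (fst (ls ! r) \<and> fst (ls ! Suc r)) then el (?g r, ?J) else 0)"
    proof (rule sum.cong)
      fix r assume "r \<in> {..<p}"
      then show "hterm ls (r, 2, length ls - r - 2) =
        (if falses ls = 1 \<and> \<not> (fst (ls ! r) \<and> fst (ls ! Suc r)) then el (?g r, ?J) else 0)"
        using hterm_two[OF n, of r] n by simp
    qed (simp add: n)
    ultimately show ?thesis unfolding hterm_sum by simp
  qed
  have lsl: "ls = take p ls @ [ls ! p]" using n by (metis Suc_eq_plus1 lessI take_Suc_conv_app_nth take_all order_refl)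
  have "falses (take p ls @ [ls ! p]) = falses (take p ls) + (if fst (ls ! p) then 0 else 1)" by simp
  then have fl: "falses ls = falses (take p ls) + (if fst (ls ! p) then 0 else 1)"
    unfolding lsl[symmetric] .
  obtain b bs where lb: "ls = b # bs" using n by (cases ls) auto
  have fr: "falses ls = (if fst (ls ! 0) then 0 else 1) + falses (drop 1 ls)" unfolding lb by simp
  consider "falses ls = 0" | "falses ls = 1" | "falses ls \<ge> 2" by linarith
  then show ?thesis
  proof cases
    case 1
    then have "falses (take p ls) = 0" "fst (ls ! p)" "falses (drop 1 ls) = 0" "fst (ls ! 0)"
      using fl fr by (auto split: if_splits)
    then show ?thesis unfolding S hterm_p_left[OF n] hterm_p_right[OF n] using 1
      by (simp flip: single_add)
  next
    case 3
    then have "falses (take p ls) \<noteq> 0" "falses (drop 1 ls) \<noteq> 0" using fl fr by (auto split: if_splits)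
    then show ?thesis unfolding S hterm_p_left[OF n] hterm_p_right[OF n] using 3 by simp
  next
    case 2
    obtain i where i: "i < length ls" "\<And>r. r < length ls \<Longrightarrow> \<not> fst (ls ! r) \<longleftrightarrow> r = i"
      using single_false_position[OF 2] by blast
    have c: "falses ls = 1 \<and> \<not> (fst (ls ! r) \<and> fst (ls ! Suc r)) \<longleftrightarrow> r = i \<or> Suc r = i" if "r < p" for r
      using i(2)[of r] i(2)[of "Suc r"] that n 2 by auto
    have ev: "?g 0 = - 1" "?g (p - 1) = - 1" using odd_p p_pos by simp_all
    have "(\<Sum>r<p. if falses ls = 1 \<and> \<not> (fst (ls ! r) \<and> fst (ls ! Suc r)) then el (?g r, ?J) else 0)
      = (\<Sum>r<p. if r = i \<or> Suc r = i then el (?g r, ?J) else 0)"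
      by (intro sum.cong) (use c in auto)
    also have "\<dots> = (if i = 0 then el (?g 0, ?J) else 0) + (if i = p then el (?g (p - 1), ?J) else 0)"
      using i(1) n p_pos by (intro alternating_pair_sum[where T = "\<lambda>c. el (c, ?J)"]) (auto simp flip: single_uminus)
    also have "\<dots> = (if i = 0 then el (- 1, ?J) else 0) + (if i = p then el (- 1, ?J) else 0)"
      unfolding ev ..
    finally have s2: "(\<Sum>r<p. if falses ls = 1 \<and> \<not> (fst (ls ! r) \<and> fst (ls ! Suc r)) then el (?g r, ?J) else 0)
      = (if i = 0 then el (- 1, ?J) else 0) + (if i = p then el (- 1, ?J) else 0)" .
    have os: "1 = x + (if B then 0 else 1) \<Longrightarrow> x = 0 \<longleftrightarrow> \<not> B" for x :: nat and B by auto
    have l1: "p < length ls" "0 < length ls" using n by simp_all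
    have ip: "\<not> fst (ls ! p) \<longleftrightarrow> i = p" and i0: "\<not> fst (ls ! 0) \<longleftrightarrow> i = 0"
      unfolding i(2)[OF l1(1)] i(2)[OF l1(2)] by blast+
    have z1: "falses (take p ls) = 0 \<longleftrightarrow> i = p" using os[OF fl[unfolded 2]] unfolding ip .
    have z2: "falses (drop 1 ls) = 0 \<longleftrightarrow> i = 0"
      using os[OF fr[unfolded 2, unfolded add.commute[of _ "falses (drop 1 ls)"]]] unfolding i0 .
    have fp: "i = p \<Longrightarrow> fst (ls ! p) = False" and f0: "i = 0 \<Longrightarrow> fst (ls ! 0) = False" using ip i0 by blast+
    have cancel: "el (- 1, ?J) + el (1, ?J) = 0" by (simp flip: single_add)
    consider "i = 0" "i \<noteq> p" | "i = p" "i \<noteq> 0" | "i \<noteq> 0" "i \<noteq> p" using p_pos by linarith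
    then show ?thesis
    proof cases
      case 1 then show ?thesis unfolding S s2 hterm_p_left[OF n] hterm_p_right[OF n] z1 z2
        using cancel by (simp only: f0 if_True if_False simp_thms add_0_left add_0_right)
    next
      case 2 then show ?thesis unfolding S s2 hterm_p_left[OF n] hterm_p_right[OF n] z1 z2
        using cancel fp[OF 2(1)] by (simp only: if_True if_False simp_thms add_0_left add_0_right)
    next
      case 3 then show ?thesis unfolding S s2 hterm_p_left[OF n] hterm_p_right[OF n] z1 z2
        by (simp only: if_False simp_thms add_0_left)
    qed
  qed
qed

lemma Ainf_rel_H_zero:
  assumes "compat ds cbs"
  shows "Ainf_rel_H p ds (map el cbs) = (0 :: 'p Hel)"
proof (rule Ainf_rel_H_basis_imp[OF assms])
  have "(\<Sum>x\<leftarrow>rst_triples (length ls). hterm ls x) = 0" for ls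
    using hterm_sum_3[of ls] hterm_sum_other[of ls] hterm_sum_Suc_p[of ls] by blast
  from this[of "map snd cbs"] show "(\<Sum>(r, s, t)\<leftarrow>rst_triples (length cbs). el (of_int (sgn_rst (map (hdeg p) (map snd cbs)) r s t) *
       (mcoef (take s (drop r (map snd cbs))) * mcoef (outer (map snd cbs) r s)), mlab (outer (map snd cbs) r s))) = (0 :: 'p Hel)"
    unfolding hterm_def length_map .
qed

end

subsection \<open>The morphism relations in coordinates\<close>

declare comps.simps [simp del]

lemma comps_0: "comps 0 = [[]]"
  by (simp add: comps.simps)

lemma comps_pos: "n \<ge> 1 \<Longrightarrow> comps n = concat (map (\<lambda>i. map ((#) i) (comps (n - i))) [1..<Suc n])"
  by (subst comps.simps) simp

lemma comps_sound: "is \<in> set (comps n) \<Longrightarrow> sum_list is = n \<and> (\<forall>i\<in>set is. 1 \<le> i)"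
proof (induction n arbitrary: "is" rule: less_induct)
  case (less n)
  show ?case
  proof (cases "n = 0")
    case True then show ?thesis using less.prems by (simp add: comps_0)
  next
    case False
    then obtain i js where "1 \<le> i" "i \<le> n" "js \<in> set (comps (n - i))" "is = i # js"
      using less.prems by (subst (asm) comps_pos) auto
    then show ?thesis using less.IH[of "n - i" js] by auto
  qed
qed

text \<open>A is a dg-algebra: m_r vanishes for r at least 3, so only compositions with one or two
  parts remain.\<close>

lemma comps_sum:
  fixes h :: "nat list \<Rightarrow> 'b::comm_monoid_add"
  assumes n: "n \<ge> 1" and h: "\<And>i j k ks. h (i # j # k # ks) = 0"
  shows "(\<Sum>is\<leftarrow>comps n. h is) = h [n] + (\<Sum>i\<in>{1..<n}. h [i, n - i])"
proof -
  have step: "(\<Sum>is\<leftarrow>comps m. f is) = (\<Sum>i\<in>{1..<Suc m}. \<Sum>js\<leftarrow>comps (m - i). f (i # js))"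
    if "m \<ge> 1" for m and f :: "nat list \<Rightarrow> 'b"
    unfolding comps_pos[OF that] sum_list_concat_map map_map o_def
    by (simp only: interv_sum_list_conv_sum_set_nat set_upt)
  have split: "(\<Sum>i\<in>{1..<Suc m}. g i) = (\<Sum>i\<in>{1..<m}. g i) + g m" if "m \<ge> 1" for m and g :: "nat \<Rightarrow> 'b"
    using that by (simp add: sum.atLeastLessThan_Suc)
  have two: "(\<Sum>js\<leftarrow>comps m. h (i # js)) = h [i, m]" if "m \<ge> 1" for i m
  proof -
    have "(\<Sum>js\<leftarrow>comps (m - j). h (i # j # js)) = 0" if j: "j \<in> {1..<m}" for j
    proof -
      have z: "h (i # j # js) = 0" if "js \<in> set (comps (m - j))" for js
        using comps_sound[OF that] j h by (cases js) auto
      have zz: "(\<Sum>x\<leftarrow>xs. f x) = 0" if "\<And>x. x \<in> set xs \<Longrightarrow> f x = 0" for xs and f :: "nat list \<Rightarrow> 'b"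
        using that by (induction xs) simp_all
      show ?thesis by (rule zz) (rule z)
    qed
    then show ?thesis unfolding step[OF that] split[OF that] by (simp add: comps_0)
  qed
  have "(\<Sum>i\<in>{1..<n}. \<Sum>js\<leftarrow>comps (n - i). h (i # js)) = (\<Sum>i\<in>{1..<n}. h [i, n - i])"
    by (intro sum.cong) (auto intro!: two)
  then show ?thesis unfolding step[OF n] split[OF n] by (simp add: comps_0 add.commute)
qed

lemma sum_list_take_drop:
  fixes xs :: "'b::monoid_add list"
  shows "sum_list (take i xs) + sum_list (drop i xs) = sum_list xs"
  by (simp flip: sum_list_append)

lemma list_cases_3:
  obtains "xs = []" | i where "xs = [i]" | i j where "xs = [i, j]" | i j k ks where "xs = i # j # k # ks"
proof (cases xs)
  case (Cons i ys)
  note 1 = Cons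
  show thesis
  proof (cases ys)
    case (Cons j zs)
    then show thesis using that 1 by (cases zs) simp_all
  qed (use that 1 in simp)
qed (use that in simp)

lemma block_starts_Cons: "block_starts (i # is) = 0 # map ((+) i) (block_starts is)"
  unfolding block_starts_def
  by (simp add: upt_conv_Cons map_Suc_upt[symmetric] o_def del: upt_Suc)

lemma length_block_starts [simp]: "length (block_starts is) = length is"
  by (simp add: block_starts_def)

text \<open>The total degree of the arguments of m_r. It matters even for r at least 3, since the
  zero element of A is a different function in each degree.\<close>

lemma sum_blocks:
  "sum_list is = length ds \<Longrightarrow>
    (\<Sum>s\<leftarrow>[0..<length is]. sum_list (take (is ! s) (drop (block_starts is ! s) ds)) + 1 - int (is ! s))
      = sum_list ds + int (length is) - int (length ds)"
proof (induction "is" arbitrary: ds)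
  case (Cons i "is")
  let ?f = "\<lambda>is ds s. sum_list (take (is ! s) (drop (block_starts is ! s) ds)) + 1 - int (is ! s)"
  have "[0..<length (i # is)] = 0 # map Suc [0..<length is]"
    by (simp add: upt_conv_Cons map_Suc_upt del: upt_Suc)
  then have "(\<Sum>s\<leftarrow>[0..<length (i # is)]. ?f (i # is) ds s)
    = ?f (i # is) ds 0 + (\<Sum>s\<leftarrow>[0..<length is]. ?f (i # is) ds (Suc s))"
    by (simp only: list.map sum_list.Cons map_map o_def)
  also have "map (\<lambda>s. ?f (i # is) ds (Suc s)) [0..<length is] = map (?f is (drop i ds)) [0..<length is]"
    by (intro map_cong) (simp_all add: block_starts_Cons add.commute)
  also have "sum_list (map (?f is (drop i ds)) [0..<length is])
      = sum_list (drop i ds) + int (length is) - int (length (drop i ds))"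
    by (rule Cons.IH) (use Cons.prems in simp)
  also have "?f (i # is) ds 0 = sum_list (take i ds) + 1 - int i" by (simp add: block_starts_Cons)
  finally show ?case using Cons.prems sum_list_take_drop[of i ds] by simp
qed simp

context symmetric_group_prime
begin

lemma fsc_fsc: "fsc a (fsc b G) = fsc (a * b) G"
  by (simp add: fsc_def smult2_def mult.assoc)

lemma fsc_add: "fsc a (G + H) = fsc a G + fsc a H"
  by (simp add: fsc_def smult2_def fun_eq_iff prod_eq_iff distrib_left)

lemma fsc_0_left: "fsc 0 G = 0" and fsc_0_right: "fsc a 0 = 0"
  by (simp_all add: fsc_def smult2_def fun_eq_iff prod_eq_iff)

lemma fsc_sum: "fsc a (\<Sum>x\<in>X. G x) = (\<Sum>x\<in>X. fsc a (G x))"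
  by (induction X rule: infinite_finite_induct)
    (simp_all only: sum.infinite sum.empty sum.insert fsc_0_right fsc_add simp_thms not_False_eq_True)

lemma fsc_sum_list: "fsc a (\<Sum>x\<leftarrow>xs. G x) = (\<Sum>x\<leftarrow>xs. fsc a (G x))"
  by (induction xs) (simp_all only: list.map sum_list.Nil sum_list.Cons fsc_0_right fsc_add)

lemma fcomp_fsc: "fcomp y z (fsc a G) (fsc b H) = fsc (a * b) (fcomp y z G H)"
  by (simp add: fcomp_def fsc_def smult2_def cmul_def fun_eq_iff prod_eq_iff algebra_simps)

lemma fcomp_0: "fcomp y z 0 H = 0" "fcomp y z G 0 = 0"
  using fcomp_fsc[of y z 0 0 1 H] fcomp_fsc[of y z 1 G 0 0] by (simp_all add: fsc_0_left fsc_0_right fsc_1)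

lemma fdiff_fsc: "fdiff z (fsc a G) = fsc a (fdiff z G)"
  using fcomp_fsc[of 1 z 1 dc a G] fcomp_fsc[of z 1 a G 1 dc]
  by (simp add: fdiff_def fsc_1 fsc_fsc fsc_add mult.commute)

lemma fdiff_0: "fdiff z 0 = 0"
  by (simp add: fdiff_def fcomp_0 fsc_0_right)

lemma coords_zero_smult2: "coords_zero m k c \<Longrightarrow> coords_zero m k (smult2 a c)"
  by (auto simp: coords_zero_def smult2_def)

lemma fam_eq_fsc: "fam_eq z G H \<Longrightarrow> fam_eq z (fsc a G) (fsc a H)"
proof -
  assume "fam_eq z G H"
  moreover have "fsc a G i - fsc a H i = smult2 a (G i - H i)" for i
    by (simp add: fsc_def smult2_def prod_eq_iff right_diff_distrib)
  ultimately show ?thesis unfolding fam_eq_def by (simp add: coords_zero_smult2)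
qed

definition lterm :: "lab list \<Rightarrow> nat \<times> nat \<times> nat \<Rightarrow> nat \<Rightarrow> 'p coord" where
  "lterm ls = (\<lambda>(r, s, t). fsc (of_int (sgn_rst (map (hdeg p) ls) r s t) * mcoef (take s (drop r ls))) (fcoef (outer ls r s)))"

definition rterm :: "lab list \<Rightarrow> nat \<Rightarrow> nat \<Rightarrow> 'p coord" where
  "rterm ls i = fsc (of_int (sgn_comp (map (hdeg p) ls) [i, length ls - i]))
     (fcomp (sum_list (map (hdeg p) (take i ls)) + 1 - int i)
        (sum_list (map (hdeg p) (drop i ls)) + 1 - int (length ls - i)) (fcoef (take i ls)) (fcoef (drop i ls)))"

lemma morph_lhs_coords:
  assumes c: "compat ds cbs"
  shows "morph_lhs p ds (map el cbs) = Phi (sum_list ds + 2 - int (length cbs))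
    (fsc (prod_list (map fst cbs)) (\<Sum>x\<leftarrow>rst_triples (length cbs). lterm (map snd cbs) x))"
proof -
  let ?ls = "map snd cbs" and ?C = "prod_list (map fst cbs)" and ?z = "sum_list ds + 2 - int (length cbs)"
  have len: "length ds = length cbs" by (rule compat_length[OF c])
  have "(case x of (r, s, t) \<Rightarrow> smulA p ?z (sgn_rst ds r s t)
      (fA p (take r ds @ [sum_list (take s (drop r ds)) + 2 - int s] @ drop (r + s) ds)
        (take r (map el cbs) @ [mH p (take s (drop r (map el cbs)))] @ drop (r + s) (map el cbs))))
     = Phi ?z (fsc ?C (lterm ?ls x))" if x: "x \<in> set (rst_triples (length cbs))" for x
  proof -
    obtain r s t where rst: "x = (r, s, t)" by (cases x)
    then have rs: "1 \<le> s" "r + s + t = length cbs" using x by (simp_all add: rst_triples_mem)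
    let ?mid = "take s (drop r cbs)"
    let ?cb = "(prod_list (map fst ?mid) * mcoef (map snd ?mid), mlab (map snd ?mid))"
    let ?ds = "take r ds @ [sum_list (take s (drop r ds)) + 2 - int s] @ drop (r + s) ds"
    have 1: "take r (map el cbs) @ [mH p (take s (drop r (map el cbs)))] @ drop (r + s) (map el cbs)
      = map el (outer_with ?cb cbs r s)"
      unfolding take_map drop_map mH_el outer_with_def by simp
    have 2: "map snd (outer_with ?cb cbs r s) = outer ?ls r s"
      unfolding map_outer_with outer_def by (simp add: take_map drop_map)
    have 3: "prod_list (map fst (outer_with ?cb cbs r s)) = ?C * mcoef (take s (drop r ?ls))"
      unfolding map_outer_with fst_conv by (simp add: prod_list_outer_with flip: take_map drop_map)
    have 4: "compat ?ds (outer_with ?cb cbs r s)"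
      unfolding outer_with_def by (rule compat_mid[OF c]) (use rs in simp)
    have "sum_list ds = sum_list (take r ds) + (sum_list (take s (drop r ds)) + sum_list (drop (r + s) ds))"
      using sum_list_take_drop[of r ds] sum_list_take_drop[of s "drop r ds"] by (simp add: add.commute)
    then have 5: "sum_list ?ds + 1 - int (length (outer_with ?cb cbs r s)) = ?z"
      using rs by (simp add: length_outer_with)
    have 6: "outer_with ?cb cbs r s \<noteq> []" by (simp add: outer_with_def)
    have "fA p ?ds (map el (outer_with ?cb cbs r s)) = Phi ?z (fsc (?C * mcoef (take s (drop r ?ls))) (fcoef (outer ?ls r s)))"
      using fA_el[OF 4 6] unfolding 2 3 5 .
    then have "smulA p ?z (sgn_rst ds r s t) (fA p ?ds (map el (outer_with ?cb cbs r s)))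
      = Phi ?z (fsc (of_int (sgn_rst ds r s t) * (?C * mcoef (take s (drop r ?ls)))) (fcoef (outer ?ls r s)))"
      by (simp add: smulA_Phi fsc_fsc)
    also have "fsc (of_int (sgn_rst ds r s t) * (?C * mcoef (take s (drop r ?ls)))) (fcoef (outer ?ls r s))
      = fsc ?C (lterm ?ls (r, s, t))"
    proof (cases "?C = 0")
      case False
      have "ds = map (hdeg p) ?ls" by (rule compat_degrees[OF c False])
      then show ?thesis by (simp add: lterm_def fsc_fsc mult_ac)
    next
      case True
      show ?thesis unfolding True by (simp add: fsc_0_left)
    qed
    finally show ?thesis unfolding rst prod.case 1 .
  qed
  then show ?thesis unfolding morph_lhs_def Let_def length_map fsc_sum_list
    by (rule sumA_Phi)
qed

lemma morph_rhs_coords: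
  assumes c: "compat ds cbs" and ne: "cbs \<noteq> []"
  shows "morph_rhs p ds (map el cbs) = Phi (sum_list ds + 2 - int (length cbs))
    (fsc (prod_list (map fst cbs)) (fdiff (sum_list ds + 1 - int (length cbs)) (fcoef (map snd cbs))
      + (\<Sum>i\<in>{1..<length cbs}. rterm (map snd cbs) i)))"
proof -
  let ?ls = "map snd cbs" and ?C = "prod_list (map fst cbs)" and ?z = "sum_list ds + 2 - int (length cbs)"
  let ?n = "length cbs"
  have len: "length ds = ?n" by (rule compat_length[OF c])
  have n1: "?n \<ge> 1" using ne by (simp add: Suc_le_eq)
  define h where "h is = (case is of [i] \<Rightarrow> fsc ?C (fdiff (sum_list ds + 1 - int ?n) (fcoef ?ls))
    | [i, j] \<Rightarrow> fsc ?C (rterm ?ls i) | _ \<Rightarrow> 0)" for "is" :: "nat list"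
  have block: "fA p (take i (drop a ds)) (take i (drop a (map el cbs))) =
      Phi (sum_list (take i (drop a ds)) + 1 - int i)
        (fsc (prod_list (map fst (take i (drop a cbs)))) (fcoef (take i (drop a ?ls))))"
    if "1 \<le> i" "a + i \<le> ?n" for a i
  proof -
    have "take i (drop a cbs) \<noteq> []" using that by auto
    then show ?thesis using fA_el[OF compat_take[OF compat_drop[OF c]], of i a] that
      by (simp add: take_map drop_map)
  qed
  have "smulA p ?z (sgn_comp ds is)
      (mA p (map (\<lambda>s. let a = block_starts is ! s; bds = take (is ! s) (drop a ds) in
          (sum_list bds + 1 - int (is ! s), fA p bds (take (is ! s) (drop a (map el cbs))))) [0..<length is]))
    = Phi ?z (h is)" (is "smulA p ?z _ (mA p ?bl) = _") if isc: "is \<in> set (comps ?n)" for "is"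
  proof -
    have s: "sum_list is = ?n" "\<forall>i\<in>set is. 1 \<le> i" using comps_sound[OF isc] by auto
    consider (0) "is = []" | (1) i where "is = [i]" | (2) i j where "is = [i, j]" | (3) i j k ks where "is = i # j # k # ks"
      by (rule list_cases_3)
    then show ?thesis
    proof cases
      case 0 then show ?thesis using s n1 by simp
    next
      case (1 i)
      then have i: "i = ?n" using s by simp
      have "?bl = [(sum_list ds + 1 - int ?n, fA p ds (map el cbs))]"
        unfolding 1 i by (simp add: block_starts_def len)
      moreover have "sgn_comp ds is = 1" unfolding 1 by (simp add: sgn_comp_def sgn_def block_starts_def)
      moreover have "m1A p (sum_list ds + 1 - int ?n) (fA p ds (map el cbs)) = Phi ?z (h is)"
        unfolding fA_el[OF c ne] m1A_Phi by (simp add: h_def 1 fdiff_fsc algebra_simps)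
      ultimately show ?thesis by (simp add: mA_def smulA_Phi fsc_1)
    next
      case (2 i j)
      then have ij: "j = ?n - i" "1 \<le> i" "1 \<le> j" "i + j = ?n" using s by auto
      let ?y = "sum_list (take i ds) + 1 - int i" and ?w = "sum_list (drop i ds) + 1 - int j"
      let ?D = "prod_list (map fst (take i cbs))" and ?E = "prod_list (map fst (drop i cbs))"
      have b1: "fA p (take i ds) (take i (map el cbs)) = Phi ?y (fsc ?D (fcoef (take i ?ls)))"
        using block[of i 0] ij by simp
      have tk: "take j (drop i ds) = drop i ds" "take j (drop i (map el cbs)) = drop i (map el cbs)"
        "take j (drop i cbs) = drop i cbs" "take j (drop i ?ls) = drop i ?ls" using ij len by simp_all
      have b2: "fA p (drop i ds) (drop i (map el cbs)) = Phi ?w (fsc ?E (fcoef (drop i ?ls)))"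
        using block[of j i] ij unfolding tk by simp
      have "?bl = [(?y, fA p (take i ds) (take i (map el cbs))), (?w, fA p (drop i ds) (drop i (map el cbs)))]"
        unfolding 2 using tk by (simp add: block_starts_def numeral_2_eq_2 Let_def)
      then have "mA p ?bl = Phi (?y + ?w) (fcomp ?y ?w (fsc ?D (fcoef (take i ?ls))) (fsc ?E (fcoef (drop i ?ls))))"
        unfolding b1 b2 by (simp add: mA_def compA_Phi)
      moreover have yw: "?y + ?w = ?z"
      proof -
        have "sum_list ds = sum_list (take i ds) + sum_list (drop i ds)" by (rule sum_list_take_drop[symmetric])
        then show ?thesis using ij by simp
      qed
      moreover have DE: "?D * ?E = ?C" by (metis append_take_drop_id map_append prod_list.append)
      ultimately have "smulA p ?z (sgn_comp ds is) (mA p ?bl) =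
         Phi ?z (fsc (of_int (sgn_comp ds is)) (fsc ?C (fcomp ?y ?w (fcoef (take i ?ls)) (fcoef (drop i ?ls)))))"
        by (simp only: fcomp_fsc smulA_Phi)
      also have "fsc (of_int (sgn_comp ds is)) (fsc ?C (fcomp ?y ?w (fcoef (take i ?ls)) (fcoef (drop i ?ls)))) = h is"
      proof (cases "?C = 0")
        case True
        show ?thesis unfolding h_def 2 list.case True fsc_0_left fsc_0_right ..
      next
        case False
        have "ds = map (hdeg p) ?ls" by (rule compat_degrees[OF c False])
        then show ?thesis unfolding h_def 2 list.case rterm_def
          by (simp add: fsc_fsc mult.commute take_map drop_map ij(1))
      qed
      finally show ?thesis .
    next
      case (3 i j k ks)
      have "sum_list (map fst ?bl) = sum_list ds + int (length is) - int (length ds)"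
        using sum_blocks[of "is" ds] s len by (simp add: Let_def o_def)
      then have deg: "sum_list (map fst ?bl) + 2 - int (length ?bl) = ?z" using len by simp
      have zero: "mA p bl = zeroA p (sum_list (map fst bl) + 2 - int (length bl))" if "length bl \<ge> 3" for bl
        using that by (auto simp: mA_def algebra_simps split: list.splits prod.splits)
      have l3: "length ?bl \<ge> 3" unfolding 3 by simp
      have "mA p ?bl = zeroA p ?z" unfolding zero[OF l3] deg ..
      then show ?thesis by (simp add: zeroA_Phi smulA_Phi fsc_0_right h_def 3)
    qed
  qed
  then have "morph_rhs p ds (map el cbs) = Phi ?z (\<Sum>is\<leftarrow>comps ?n. h is)"
    unfolding morph_rhs_def Let_def length_map by (intro sumA_Phi) simp
  also have "(\<Sum>is\<leftarrow>comps ?n. h is) = h [?n] + (\<Sum>i\<in>{1..<?n}. h [i, ?n - i])"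
    by (rule comps_sum[OF n1]) (simp add: h_def)
  finally show ?thesis unfolding h_def list.case fsc_add fsc_sum .
qed

subsection \<open>The relations between the cochains gamma\<close>

abbreviation gg :: "nat \<Rightarrow> nat \<Rightarrow> nat \<Rightarrow> nat \<Rightarrow> nat \<Rightarrow> 'p coord" where
  "gg a J b K \<equiv> fcomp (gd a J) (gd b K) (gc a) (gc b)"

text \<open>The support of gamma_a as an indicator. For a = 1 it differs from \<open>gc 1\<close>:
  it marks the two residues just behind a turning point of the indices, which appear in the
  differential of gamma_2 and in chi chi.\<close>

definition iv :: "nat \<Rightarrow> nat \<Rightarrow> 'p coord" where
  "iv a i = (if i mod l = a - 1 \<or> i mod l = a + p - 2 then (1, 0) else 0)"

text \<open>The source index, up to a multiple of l, of the i-th component of gamma a composed with a power of iota.\<close>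
definition sh :: "nat \<Rightarrow> nat \<Rightarrow> nat" where
  "sh a i = i + (a * (l - 2) + 1)"

lemma gc_iv: "a \<noteq> 1 \<Longrightarrow> gc a = iv a"
  by (simp add: gc_def iv_def fun_eq_iff)

lemma gc_add_l: "gc a (i + j * l) = gc a i"
  by (simp add: gc_def)

lemma dc_add_l: "dc (i + j * l) = dc i"
  by (simp add: dc_def)

lemma int_sh: "int i + (gd a J) = int (sh a i + J * l)"
proof -
  have "int (l - 2) = int l - 2" using l_ge_4 by simp
  then have "gamma_deg p a = int (a * (l - 2) + 1)" by (simp add: gamma_deg_def)
  then show ?thesis unfolding sh_def by linarith
qed

lemma nat_sh: "nat (int i + (gd a J)) = sh a i + J * l"
  "\<not> int i + (gd a J) < 0"
  unfolding int_sh by linarith+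

lemma sh_add_l: "sh b (i + J * l) = sh b i + J * l"
  by (simp add: sh_def)

lemma fcomp_gc:
  "gg a J b K i
    = cmul (om i) (om (sh a i)) (om (sh b (sh a i))) (gc a i) (gc b (sh a i))"
proof -
  have "nat (int i + (gd a J) + (gd b K))
    = sh b (sh a i + J * l) + K * l"
    unfolding int_sh[of i] int_sh[of _ b] by linarith
  then show ?thesis
    using nat_sh[of i a J] by (simp add: fcomp_def sh_add_l omega_add_mult_l gc_add_l)
qed

lemma sh_1: "sh 1 i = i + (l - 1)"
  using l_ge_4 by (simp add: sh_def)

lemma sh_mod:
  assumes a: "1 \<le> a" "a \<le> p - 1"
  shows "i mod l = a - 1 \<Longrightarrow> sh a i mod l = l - a" "i mod l = a + p - 2 \<Longrightarrow> sh a i mod l = p - 1 - a"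
  using gamma_source_mod[OF a, of "sh a i" i] by (simp_all add: sh_def)

lemma omega_sh:
  assumes a: "1 \<le> a" "a \<le> p - 1" and "i mod l = a - 1 \<or> i mod l = a + p - 2"
  shows "om (sh a i) = om i"
  using assms(3)
proof
  assume i: "i mod l = a - 1"
  have "om i = a" using omega_lower[of i] i a by simp
  moreover have "p - 1 \<le> l - a" "l - (l - a) = a" using a l_eq by auto
  ultimately show ?thesis using omega_upper[of "sh a i"] sh_mod(1)[OF a i] by simp
next
  assume i: "i mod l = a + p - 2"
  have "l - (a + p - 2) = p - a" "p - 1 \<le> a + p - 2" using a l_eq by linarith+
  then have "om i = p - a" using omega_upper[of i] i by simp
  moreover have "p - 1 - a \<le> p - 2" "p - 1 - a + 1 = p - a" using a by auto
  ultimately show ?thesis using omega_lower[of "sh a i"] sh_mod(2)[OF a i] by simp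
qed

lemma cmul_0: "cmul m k n 0 d = 0" "cmul m k n c 0 = 0"
  by (simp_all add: cmul_def prod_eq_iff)

text \<open>The sources of the nonzero components of gamma_a have residues l - a and p - 1 - a,
  which form the support of gamma_(p-a). Supports for different indices are disjoint, so gamma_b
  meets them only for b = p - a, while chi is nonzero everywhere.\<close>

lemma fcomp_gc_ge_2:
  assumes a: "2 \<le> a" "a \<le> p - 1" and b: "1 \<le> b" "b \<le> p - 1"
  shows "gg a J b K =
    (if b = 1 \<or> a + b = p then iv a else 0)"
proof
  fix i
  have a1: "1 \<le> a" using a by simp
  have g: "gc a = iv a" using a by (intro gc_iv) simp
  show "gg a J b K i =
    (if b = 1 \<or> a + b = p then iv a else 0) i"
  proof (cases "i mod l = a - 1 \<or> i mod l = a + p - 2")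
    case False
    then have "iv a i = 0" by (simp add: iv_def)
    then show ?thesis unfolding fcomp_gc unfolding g by (simp add: cmul_0)
  next
    case True
    then have "iv a i = (1, 0)" by (simp add: iv_def)
    then have v: "gg a J b K i = gc b (sh a i)"
      unfolding fcomp_gc unfolding g omega_sh[OF a1 a(2) True] by (simp add: cmul_def gc_def zero_prod_def)
    have "gc b (sh a i) = (if b = 1 \<or> a + b = p then (1, 0) else 0)"
    proof (cases "b = 1")
      case b1: False
      have "sh a i mod l = b - 1 \<or> sh a i mod l = b + p - 2 \<longleftrightarrow> a + b = p"
        using True
      proof
        assume "i mod l = a - 1"
        then have "sh a i mod l = l - a" by (rule sh_mod(1)[OF a1 a(2)])
        then show ?thesis using a b l_eq by auto
      next
        assume "i mod l = a + p - 2"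
        then have "sh a i mod l = p - 1 - a" by (rule sh_mod(2)[OF a1 a(2)])
        then show ?thesis using a b by auto
      qed
      then show ?thesis using b1 by (simp add: gc_def)
    qed (simp add: gc_def)
    then show ?thesis unfolding v using \<open>iv a i = (1, 0)\<close> by simp
  qed
qed

lemma fcomp_gc_1:
  assumes b: "2 \<le> b" "b \<le> p - 1"
  shows "gg 1 J b K = (\<lambda>i. iv b (i + (l - 1)))"
proof
  fix i
  let ?j = "i + (l - 1)"
  have b1: "1 \<le> b" using b by simp
  have g: "gc b = iv b" using b by (intro gc_iv) simp
  have g1: "gc 1 i = (1, 0)" by (simp add: gc_def)
  show "gg 1 J b K i = iv b ?j"
  proof (cases "?j mod l = b - 1 \<or> ?j mod l = b + p - 2")
    case True
    then have "iv b ?j = (1, 0)" by (simp add: iv_def)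
    then show ?thesis unfolding fcomp_gc unfolding g sh_1 g1 omega_sh[OF b1 b(2) True] by (simp add: cmul_def)
  next
    case False
    then have "iv b ?j = 0" by (simp add: iv_def)
    then show ?thesis unfolding fcomp_gc unfolding g sh_1 by (simp add: cmul_0)
  qed
qed

text \<open>A shift of the position by one lowers the index of the support by one. Such shifts come
  from d, and in the opposite direction from chi, whose degree is -1 modulo l.\<close>

lemma iv_Suc:
  assumes "2 \<le> n" "n \<le> p - 1"
  shows "iv n (Suc i) = iv (n - 1) i"
proof -
  have "Suc i mod l = n - 1 \<longleftrightarrow> i mod l = n - 1 - 1"
    using Suc_mod_l[of i] assms l_bounds(3) by auto
  moreover have "Suc i mod l = n + p - 2 \<longleftrightarrow> i mod l = n - 1 + p - 2"
  proof -
    have "n + p - 2 < l" using assms l_eq by linarith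
    then show ?thesis using Suc_mod_l[of i] assms p_ge_3 by auto
  qed
  ultimately show ?thesis by (simp add: iv_def)
qed

lemma iv_add_l: "iv n (i + l) = iv n i"
  by (simp add: iv_def)

lemma iv_shift:
  assumes "2 \<le> n" "n \<le> p - 1"
  shows "iv (n - 1) (i + (l - 1)) = iv n i"
  using iv_Suc[OF assms, of "i + (l - 1)"] iv_add_l[of n i] l_pos by simp

lemma odd_gamma_deg: "(- 1 :: int) ^ nat \<bar>gd n J\<bar> = - 1"
proof -
  have "odd (gd n J)" using l_eq by (simp add: gamma_deg_def)
  then show ?thesis by (simp add: even_nat_iff)
qed

lemma fdiff_odd:
  "fdiff (gd n J) G
    = fcomp 1 (gd n J) dc G + fcomp (gd n J) 1 G dc"
proof -
  have "(- 1 :: 'p mod_ring) ^ nat \<bar>gd n J\<bar> = - 1"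
    using arg_cong[OF odd_gamma_deg[of n J], of "of_int :: int \<Rightarrow> 'p mod_ring"] by simp
  then show ?thesis by (simp add: fdiff_def fsc_1)
qed

lemma fcomp_dc_left:
  "fcomp 1 (gd n J) dc G i =
    cmul (om i) (om (Suc i)) (om (sh n (Suc i))) (dc i) (G (Suc i))"
proof -
  have "nat (int i + 1) = Suc i" "nat (int i + 1 + (gd n J)) = sh n (Suc i) + J * l"
    using nat_sh(1)[of "Suc i" n J] by (simp_all add: add.commute add.left_commute)
  then show ?thesis by (simp add: fcomp_def omega_add_mult_l)
qed

lemma fcomp_dc_right:
  "fcomp (gd n J) 1 G dc i =
    cmul (om i) (om (sh n i)) (om (Suc (sh n i))) (G i) (dc (sh n i))"
proof -
  have "nat (int i + (gd n J) + 1) = Suc (sh n i) + J * l"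
    using nat_sh[of i n J] by linarith
  then show ?thesis using nat_sh[of i n J] omega_add_mult_l[of "Suc (sh n i)" J]
    by (simp add: fcomp_def omega_add_mult_l dc_add_l)
qed

lemma dc_off: "i mod l \<noteq> p - 2 \<Longrightarrow> i mod l \<noteq> l - 1 \<Longrightarrow> dc i = (1, 0)"
  by (simp add: dc_def)

text \<open>The summands come from d gamma_n and gamma_n d. Neither meets a turning point, so every
  coordinate of d involved is (1, 0). For n at least 3, \<open>fcomp_gc_ge_2\<close> and
  \<open>fcomp_gc_1\<close> identify them with gamma_(n-1) chi and chi gamma_(n-1).\<close>

lemma fdiff_gc:
  assumes n: "2 \<le> n" "n \<le> p - 1"
  shows "fdiff (gd n J) (gc n) = (\<lambda>i. iv (n - 1) i + iv (n - 1) (i + (l - 1)))"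
proof
  fix i
  have n1: "1 \<le> n" using n by simp
  have g: "gc n = iv n" using n by (intro gc_iv) simp
  have "cmul (om i) (om (Suc i)) (om (sh n (Suc i))) (dc i) (iv n (Suc i)) = iv (n - 1) i"
  proof (cases "Suc i mod l = n - 1 \<or> Suc i mod l = n + p - 2")
    case True
    then have v: "iv n (Suc i) = (1, 0)" by (simp add: iv_def)
    then have "iv (n - 1) i = (1, 0)" using iv_Suc[OF n] by simp
    then have "i mod l = n - 1 - 1 \<or> i mod l = n - 1 + p - 2" by (auto simp: iv_def zero_prod_def split: if_splits)
    then have "dc i = (1, 0)" using n l_eq by (intro dc_off) linarith+
    then show ?thesis unfolding omega_sh[OF n1 n(2) True] v \<open>iv (n - 1) i = (1, 0)\<close> by (simp add: cmul_def)
  next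
    case False
    then have v: "iv n (Suc i) = 0" by (simp add: iv_def)
    then show ?thesis using iv_Suc[OF n] by (simp add: cmul_0)
  qed
  moreover have "cmul (om i) (om (sh n i)) (om (Suc (sh n i))) (iv n i) (dc (sh n i)) = iv n i"
  proof (cases "i mod l = n - 1 \<or> i mod l = n + p - 2")
    case True
    then have v: "iv n i = (1, 0)" by (simp add: iv_def)
    have "sh n i mod l = l - n \<or> sh n i mod l = p - 1 - n" using True sh_mod[OF n1 n(2)] by blast
    then have "dc (sh n i) = (1, 0)" using n l_eq p_ge_3 by (intro dc_off) linarith+
    then show ?thesis unfolding omega_sh[OF n1 n(2) True] v by (simp add: cmul_def)
  qed (simp add: iv_def cmul_0)
  ultimately show "fdiff (gd n J) (gc n) i = iv (n - 1) i + iv (n - 1) (i + (l - 1))"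
    unfolding fdiff_odd g plus_fun_def fcomp_dc_left fcomp_dc_right iv_shift[OF n] by simp
qed

lemma fdiff_iota: "fdiff (int (j * l)) one = 0"
proof
  fix i
  have "even (j * l)" using l_eq by simp
  then have "(- 1 :: 'p mod_ring) ^ nat \<bar>int (j * l)\<bar> = 1" by (simp only: abs_of_nat nat_int) simp
  then have e: "fdiff (int (j * l)) one = fcomp 1 (int (j * l)) dc one + fsc (- 1) (fcomp (int (j * l)) 1 one dc)"
    by (simp add: fdiff_def)
  have n: "nat (int i + 1) = Suc i" "nat (int i + 1 + int (j * l)) = Suc i + j * l"
    "nat (int i + int (j * l)) = i + j * l" "nat (int i + int (j * l) + 1) = Suc i + j * l" by linarith+
  have nn: "\<not> int i + int (j * l) < 0" "\<not> int i + 1 < 0" by linarith+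
  have "fcomp 1 (int (j * l)) dc one i = cmul (om i) (om (Suc i)) (om (Suc i)) (dc i) (1, 0)"
    unfolding fcomp_def n omega_add_mult_l one_def using nn by simp
  moreover have "fcomp (int (j * l)) 1 one dc i = cmul (om i) (om i) (om (Suc i)) (1, 0) (dc i)"
    unfolding fcomp_def n omega_add_mult_l one_def dc_add_l using nn(1) by simp
  ultimately show "fdiff (int (j * l)) one i = 0 i"
    unfolding e by (simp add: cmul_def fsc_def smult2_def prod_eq_iff)
qed

text \<open>The composites d chi and chi d are the two ways around through the neighbouring indices,
  or one of them is a radical endomorphism at a turning point; the signs in \<open>cmul\<close> and
  \<open>dc\<close> make them cancel.\<close>

lemma fdiff_chi: "fdiff (gd 1 J) one = 0"
proof
  fix i
  define j where "j = i + (l - 1)"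
  have "Suc j = i + l" using l_pos by (simp add: j_def)
  then have om: "om i = om (Suc j)" and e: "dc i = dc (Suc j)" "om (Suc i) = om (Suc (Suc j))"
    using omega_add_l[of i] dc_add_l[of i 1] omega_add_l[of "Suc i"] by simp_all
  have sj: "sh 1 i = j" unfolding sh_1 j_def ..
  have "Suc i + (l - 1) = i + l" using l_pos by simp
  then have ssj: "om (sh 1 (Suc i)) = om i" unfolding sh_1 by (simp only: omega_add_l)
  have "fdiff (gd 1 J) one i =
    cmul (om i) (om (Suc i)) (om i) (dc i) (1, 0) + cmul (om i) (om j) (om i) (1, 0) (dc j)"
    unfolding fdiff_odd plus_fun_def fcomp_dc_left fcomp_dc_right sj ssj om[symmetric] by (simp add: one_def)
  also have "\<dots> = 0"
    unfolding e om by (cases rule: two_steps[of j]) (use p_ge_3 in \<open>auto simp: cmul_def prod_eq_iff\<close>)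
  finally show "fdiff (gd 1 J) one i = 0 i" by simp
qed

text \<open>The residues a - 1 fill the first half of a period, the residues a + p - 2 the second
  half, each exactly once.\<close>

lemma sum_iv: "(\<Sum>a\<in>{1..p - 1}. iv a i) = (1, 0)"
proof -
  define r where "r = i mod l"
  have r: "r < 2 * p - 2" using mod_l_less[of i] l_eq unfolding r_def by linarith
  define a0 where "a0 = (if r \<le> p - 2 then r + 1 else r + 2 - p)"
  have a0: "a0 \<in> {1..p - 1}" using r p_ge_3 by (auto simp: a0_def)
  have "iv a i = (if a = a0 then (1, 0) else 0)" if "a \<in> {1..p - 1}" for a
  proof -
    have "r = a - 1 \<or> r = a + p - 2 \<longleftrightarrow> a = a0"
      using that r p_ge_3 unfolding a0_def by auto
    then show ?thesis unfolding iv_def r_def[symmetric] by simp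
  qed
  then have "(\<Sum>a\<in>{1..p - 1}. iv a i) = (\<Sum>a\<in>{1..p - 1}. if a = a0 then (1, 0) else 0)" by (intro sum.cong) auto
  then show ?thesis using a0 by simp
qed

lemma iv_1_Suc: "iv 1 (Suc k) = (if dc k = (1, 0) then 0 else (1, 0))"
  using Suc_mod_l[of k] l_bounds(2) p_ge_3 by (auto simp: iv_def dc_def)

text \<open>Without a turning point two steps connect indices at distance 2, where every
  homomorphism is 0. Otherwise exactly one of the steps is a turn, at which chi is an identity, and
  exactly one of the two indicators is (1, 0).\<close>

lemma fcomp_chi_chi:
  "fam_eq (gd 1 J + (gd 1 K))
    (gg 1 J 1 K)
    (\<lambda>i. iv 1 i + iv 1 (i + (l - 1)))"
  unfolding fam_eq_def
proof (intro allI impI)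
  fix i
  define j where "j = sh 1 (sh 1 i)"
  have s1: "sh 1 i = i + (l - 1)" by (rule sh_1)
  have Sj: "Suc j = sh 1 i + l" using l_pos unfolding j_def sh_1[of "sh 1 i"] by simp
  have SSj: "Suc (Suc j) = i + 2 * l" using Sj l_pos unfolding s1 by simp
  have o1: "om (sh 1 i) = om (Suc j)" unfolding Sj omega_add_l ..
  have o2: "om i = om (Suc (Suc j))" unfolding SSj omega_add_mult_l ..
  have deg: "nat (int i + (gd 1 J + (gd 1 K))) = sh 1 (sh 1 i + J * l) + K * l"
    unfolding add.assoc[symmetric, of "int i"] int_sh by linarith
  have o0: "om (nat (int i + (gd 1 J + (gd 1 K)))) = om j"
    unfolding deg sh_add_l omega_add_mult_l j_def ..
  have g1: "gc 1 i = (1, 0)" for i by (simp add: gc_def)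
  have lhs: "gg 1 J 1 K i
    = cmul (om (Suc (Suc j))) (om (Suc j)) (om j) (1, 0) (1, 0)"
    unfolding fcomp_gc g1 j_def[symmetric] o1 o2 ..
  have i1: "iv 1 i = iv 1 (Suc (Suc j))" unfolding SSj iv_def by simp
  have i2: "iv 1 (i + (l - 1)) = iv 1 (Suc j)" unfolding Sj s1 iv_def by simp
  have main: "coords_zero (om (Suc (Suc j))) (om j)
     (cmul (om (Suc (Suc j))) (om (Suc j)) (om j) (1, 0) (1, 0) - (iv 1 (Suc (Suc j)) + iv 1 (Suc j)))"
    by (cases rule: two_steps[of j]) (use p_ge_3 in \<open>auto simp: iv_1_Suc[unfolded One_nat_def] coords_zero_def cmul_def\<close>)
  show "coords_zero (om i) (om (nat (int i + (gd 1 J + (gd 1 K)))))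
     (gg 1 J 1 K i - (iv 1 i + iv 1 (i + (l - 1))))"
    unfolding o0 lhs i1 i2 o2 by (rule main)
qed

subsection \<open>The morphism relations\<close>

lemma fam_eq_refl: "fam_eq z G G"
  by (simp add: fam_eq_def coords_zero_def)

lemma fam_sum_apply: "(\<Sum>x\<in>X. G x) i = (\<Sum>x\<in>X. G x i)" for G :: "'b \<Rightarrow> nat \<Rightarrow> 'p coord"
  by (induction X rule: infinite_finite_induct) simp_all

definition tc :: "nat \<Rightarrow> nat \<Rightarrow> 'p coord" where
  "tc n = (if 1 \<le> n \<and> n \<le> p - 1 then fsc ((-1) ^ (n - 1)) (gc n) else 0)"

lemma tc_snd: "snd (tc n i) = 0"
  by (simp add: tc_def fsc_def smult2_def gc_def)

lemma tc_add_l: "tc n (i + j * l) = tc n i"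
  by (simp add: tc_def fsc_def gc_add_l)

lemma fcoef_true: "falses ls = 0 \<Longrightarrow> fcoef ls = tc (length ls)"
  unfolding falses_0_iff by (cases ls) (auto simp: fcoef_def tc_def)

lemma fcoef_single: "fcoef [b] = one"
  using p_ge_3 gc_1 by (auto simp: fcoef_def fsc_1)

lemma fcoef_false: "falses ls \<noteq> 0 \<Longrightarrow> 2 \<le> length ls \<Longrightarrow> fcoef ls = 0"
  unfolding falses_0_iff by (auto simp: fcoef_def)

lemma fcomp_one_left:
  assumes "\<And>i. snd (G i) = 0" "\<And>i. G (i + j * l) = G i"
  shows "fcomp (int (j * l)) z one G = G"
proof
  fix i
  have n: "nat (int i + int (j * l)) = i + j * l" "\<not> int i + int (j * l) < 0" by linarith+
  show "fcomp (int (j * l)) z one G i = G i"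
    unfolding fcomp_def n(1) omega_add_mult_l assms(2) one_def using assms(1) n(2)
    by (simp add: cmul_def prod_eq_iff)
qed

lemma sgn_comp_two: "sgn_comp ds [i, j] = sgn ((1 - int j) * (int i + sum_list (take i ds)))"
  by (simp add: sgn_comp_def block_starts_def numeral_2_eq_2 algebra_simps)

lemma lterm_eq_0:
  "mcoef (take s (drop r ls)) = 0 \<or> fcoef (outer ls r s) = 0 \<Longrightarrow> lterm ls (r, s, t) = 0"
  by (auto simp only: lterm_def prod.case mult_zero_right fsc_0_left fsc_0_right)

lemma lterm_sum:
  "(\<Sum>x\<leftarrow>rst_triples (length ls). lterm ls x) =
    (\<Sum>r<length ls - 1. lterm ls (r, 2, length ls - r - 2)) + (\<Sum>r<length ls + 1 - p. lterm ls (r, p, length ls - r - p))"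
proof -
  have "(\<Sum>x\<leftarrow>rst_triples (length ls). lterm ls x) =
    (\<Sum>r<length ls + 1 - 2. lterm ls (r, 2, length ls - r - 2)) + (\<Sum>r<length ls + 1 - p. lterm ls (r, p, length ls - r - p))"
  proof (rule rst_triples_sum_two)
    fix r s assume "r + s \<le> length ls" "s \<noteq> 2" "s \<noteq> p"
    then show "lterm ls (r, s, length ls - r - s) = 0" by (intro lterm_eq_0 disjI1 mcoef_length) auto
  qed (use p_ge_3 in auto)
  moreover have "length ls + 1 - 2 = length ls - 1" by simp
  ultimately show ?thesis by simp
qed

text \<open>An inner m'_p yields a power of iota, on which only f_1 is nonzero; so the tuple has
  exactly p entries, all of them with chi.\<close>

lemma lterm_p:
  assumes r: "r < length ls + 1 - p"
  shows "lterm ls (r, p, length ls - r - p) = (if falses ls = 0 \<and> length ls = p then fsc (- 1) one else 0)"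
proof (cases "mcoef (take p (drop r ls)) = 0")
  case True
  have "\<not> (falses ls = 0 \<and> length ls = p)"
  proof
    assume h: "falses ls = 0 \<and> length ls = p"
    then have "take p (drop r ls) = ls" using r by simp
    then show False using True h mcoef_p_nonzero[of ls] unfolding falses_0_iff by simp
  qed
  then show ?thesis unfolding if_not_P[OF \<open>\<not> (falses ls = 0 \<and> length ls = p)\<close>]
    by (intro lterm_eq_0 disjI1 True)
next
  case False
  have rp: "r + p \<le> length ls" using r by simp
  note f = outer_has_false[OF False rp]
  have lo: "length (outer ls r p) = length ls - p + 1" by (rule length_outer[OF rp])
  show ?thesis
  proof (cases "length ls = p")
    case True
    then have r0: "r = 0" and tk: "take p (drop r ls) = ls" using r by simp_all
    have ft: "falses ls = 0" using f(2) unfolding tk falses_0_iff .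
    have mc: "mcoef ls = - 1" using mcoef_p_nonzero[OF True] f(2) unfolding tk by simp
    obtain b where b: "outer ls r p = [b]" using lo True by (auto simp: length_Suc_conv)
    have "lterm ls (r, p, length ls - r - p) = fsc (of_int (sgn_rst (map (hdeg p) ls) 0 p 0) * - 1) one"
      unfolding lterm_def prod.case tk mc b fcoef_single using r0 True by simp
    also have "sgn_rst (map (hdeg p) ls) 0 p 0 = 1" by (simp add: sgn_rst_def sgn_def)
    finally show ?thesis using ft True by simp
  next
    case F: False
    have "falses (outer ls r p) \<noteq> 0" using f(1) unfolding falses_0_iff by blast
    then have "fcoef (outer ls r p) = 0" by (rule fcoef_false) (use lo rp F in simp)
    then show ?thesis using F lterm_eq_0 by simp
  qed
qed

lemma lterm_p_sum:
  "(\<Sum>r<length ls + 1 - p. lterm ls (r, p, length ls - r - p)) = (if falses ls = 0 \<and> length ls = p then fsc (- 1) one else 0)"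
proof -
  have "(\<Sum>r<length ls + 1 - p. lterm ls (r, p, length ls - r - p)) =
    (\<Sum>r<length ls + 1 - p. if falses ls = 0 \<and> length ls = p then fsc (- 1) one else 0)"
    by (intro sum.cong refl lterm_p) simp
  also have "\<dots> = (if falses ls = 0 \<and> length ls = p then fsc (- 1) one else 0)"
    by (cases "falses ls = 0 \<and> length ls = p") (simp_all only: if_True if_False sum.neutral_const, simp)
  finally show ?thesis .
qed

lemma lterm_two:
  assumes "Suc r < length ls" "3 \<le> length ls"
  shows "lterm ls (r, 2, length ls - r - 2) = (if falses ls = 1 \<and> \<not> (fst (ls ! r) \<and> fst (ls ! Suc r))
    then fsc ((-1) ^ (length ls + r)) (tc (length ls - 1)) else 0)"
proof (cases "fst (ls ! r) \<and> fst (ls ! Suc r)")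
  case True
  then have "mcoef (take 2 (drop r ls)) = 0" using merge_all_true(1)[OF assms(1)] by simp
  then show ?thesis using True lterm_eq_0 by simp
next
  case False
  note m = merge_all_true[OF assms(1)]
  have len: "length (outer ls r 2) = length ls - 1" using assms by (subst length_outer) auto
  show ?thesis
  proof (cases "falses ls = 1")
    case True
    then have "falses (outer ls r 2) = 0" using m(2)[OF False] unfolding falses_0_iff by blast
    then have fo: "fcoef (outer ls r 2) = tc (length ls - 1)" using fcoef_true[of "outer ls r 2"] unfolding len by blast
    have mc: "mcoef (take 2 (drop r ls)) = 1" using m(1) False by simp
    have "even (int (r * 2 + (length ls - r - 2)) + (2 - int 2) * x) \<longleftrightarrow> even (length ls + r)" for x
      using assms(1) by auto
    then have sg: "(of_int (sgn_rst (map (hdeg p) ls) r 2 (length ls - r - 2)) :: 'p mod_ring) = (-1) ^ (length ls + r)"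
      unfolding sgn_rst_def sgn_mod_ring by simp
    show ?thesis unfolding lterm_def prod.case fo mc sg using False True by simp
  next
    case F: False
    then have "falses (outer ls r 2) \<noteq> 0" using m(2)[OF False] unfolding falses_0_iff by blast
    then have "fcoef (outer ls r 2) = 0" by (rule fcoef_false) (use len assms in simp)
    then show ?thesis using F lterm_eq_0 by simp
  qed
qed

lemma falses_take_drop: "falses ls = falses (take i ls) + falses (drop i ls)"
proof -
  have "falses (take i ls @ drop i ls) = falses (take i ls) + falses (drop i ls)" unfolding filter_append length_append ..
  then show ?thesis unfolding append_take_drop_id .
qed

definition morph_basis :: "lab list \<Rightarrow> bool" where
  "morph_basis ls \<longleftrightarrow> fam_eq (sum_list (map (hdeg p) ls) + 2 - int (length ls))
    (\<Sum>x\<leftarrow>rst_triples (length ls). lterm ls x)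
    (fdiff (sum_list (map (hdeg p) ls) + 1 - int (length ls)) (fcoef ls) + (\<Sum>i\<in>{1..<length ls}. rterm ls i))"

lemma hdeg_eqs: "hdeg p (False, j) = int (j * l)" "hdeg p (True, j) = gd 1 j"
  by (simp_all add: hdeg_def gamma_deg_def)

lemma hdeg_false: "\<not> fst b \<Longrightarrow> hdeg p b = int (snd b * l)"
  and hdeg_true: "fst b \<Longrightarrow> hdeg p b = gamma_deg p 1 + int (snd b * l)"
  by (cases b, simp add: hdeg_eqs)+

lemma fdiff_one_hdeg: "fdiff (hdeg p b) one = 0"
proof (cases "fst b")
  case True show ?thesis unfolding hdeg_true[OF True] by (rule fdiff_chi)
next
  case False show ?thesis unfolding hdeg_false[OF False] by (rule fdiff_iota)
qed

lemma morph_basis_1: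
  assumes "length ls = 1"
  shows "morph_basis ls"
proof -
  obtain b where ls: "ls = [b]" using assms by (auto simp: length_Suc_conv)
  have "fdiff (hdeg p b) one = 0" by (rule fdiff_one_hdeg)
  moreover have "(\<Sum>x\<leftarrow>rst_triples (length ls). lterm ls x) = 0"
    unfolding lterm_sum lterm_p_sum using assms p_ge_3 by simp
  moreover have "sum_list (map (hdeg p) ls) + 1 - int (length ls) = hdeg p b" by (simp add: ls)
  moreover have "(\<Sum>i\<in>{1..<length ls}. rterm ls i) = 0" unfolding assms by simp
  moreover have "fcoef ls = one" unfolding ls by (rule fcoef_single)
  ultimately show ?thesis unfolding morph_basis_def by (simp only: fam_eq_refl add_0_right)
qed

text \<open>Supplies the support for a = 1 in the sum at length p, where it comes from chi
  gamma_(p-1).\<close>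

lemma iv_last_shift: "iv (p - 1) (i + (l - 1)) = iv 1 i"
proof -
  have "Suc (i + (l - 1)) = i + l" using l_pos by simp
  then have "iv 1 i = iv 1 (Suc (i + (l - 1)))" using iv_add_l by simp
  moreover have "p - 1 - 1 = p - 2" "p - 1 + p - 2 = l - 1" using l_eq by linarith+
  ultimately show ?thesis unfolding iv_1_Suc unfolding iv_def dc_def by auto
qed

text \<open>The sign v and the Koszul sign multiply to 1: the degree of f_i on i entries with chi is
  odd, which makes the second factor of the exponent in \<open>sgn_comp_two\<close> even. There
  remain the signs of the two values of f, with total exponent n - 2.\<close>

lemma rterm_true:
  assumes t: "falses ls = 0" and i: "1 \<le> i" "i < length ls"
  shows "\<exists>J K. rterm ls i = (if i \<le> p - 1 \<and> length ls - i \<le> p - 1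
    then fsc ((-1) ^ length ls) (gg i J (length ls - i) K)
    else 0)
    \<and> sum_list (map (hdeg p) (take i ls)) + 1 - int i = gd i J
    \<and> sum_list (map (hdeg p) (drop i ls)) + 1 - int (length ls - i) = gd (length ls - i) K"
proof -
  let ?n = "length ls"
  let ?J = "sum_list (map snd (take i ls))" and ?K = "sum_list (map snd (drop i ls))"
  have f: "falses (take i ls) = 0" "falses (drop i ls) = 0" using t falses_take_drop[of ls i] by simp_all
  have len: "length (take i ls) = i" "length (drop i ls) = ?n - i" using i by simp_all
  have d1: "sum_list (map (hdeg p) (take i ls)) + 1 - int i = gd i ?J"
    using sum_hdeg_true[of "take i ls"] f(1) unfolding falses_0_iff len by blast
  have d2: "sum_list (map (hdeg p) (drop i ls)) + 1 - int (?n - i) = gd (?n - i) ?K"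
    using sum_hdeg_true[of "drop i ls"] f(2) unfolding falses_0_iff len by blast
  have "int i + sum_list (take i (map (hdeg p) ls)) = gd i ?J - 1 + 2 * int i"
    using d1 unfolding take_map by linarith
  moreover have "even (gd i ?J - 1 + 2 * int i)"
    using l_eq by (simp add: gamma_deg_def)
  ultimately have "even (int i + sum_list (take i (map (hdeg p) ls)))" by (simp only:)
  then have sg: "sgn_comp (map (hdeg p) ls) [i, ?n - i] = 1" unfolding sgn_comp_two sgn_def by simp
  have tcs: "fcoef (take i ls) = tc i" "fcoef (drop i ls) = tc (?n - i)"
    using fcoef_true[OF f(1)] fcoef_true[OF f(2)] unfolding len by simp_all
  have r: "rterm ls i = fcomp (gd i ?J) (gd (?n - i) ?K) (tc i) (tc (?n - i))"
    unfolding rterm_def sg d1 d2 tcs of_int_1 fsc_1 ..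
  have pw: "((-1) ^ (i - 1) * (-1) ^ (?n - i - 1) :: 'p mod_ring) = (-1) ^ ?n"
  proof -
    have "?n = (i - 1) + (?n - i - 1) + 2" using i by simp
    then have "((-1) ^ ?n :: 'p mod_ring) = (-1) ^ ((i - 1) + (?n - i - 1) + 2)" by (rule arg_cong)
    then show ?thesis by (simp only: power_add power2_minus power_one mult_1_right)
  qed
  have "rterm ls i = (if i \<le> p - 1 \<and> ?n - i \<le> p - 1
    then fsc ((-1) ^ ?n) (gg i ?J (?n - i) ?K)
    else 0)"
  proof (cases "i \<le> p - 1 \<and> ?n - i \<le> p - 1")
    case True
    moreover have "1 \<le> ?n - i" using i by simp
    ultimately have "tc i = fsc ((-1) ^ (i - 1)) (gc i)" "tc (?n - i) = fsc ((-1) ^ (?n - i - 1)) (gc (?n - i))"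
      using i by (simp_all add: tc_def)
    then show ?thesis unfolding r using True by (simp only: fcomp_fsc pw if_True simp_thms)
  next
    case False
    then have "tc i = 0 \<or> tc (?n - i) = 0" by (auto simp: tc_def)
    then show ?thesis unfolding r using False by (auto simp only: fcomp_0 if_False)
  qed
  then show ?thesis using d1 d2 by blast
qed

lemma lterm_two_true:
  assumes "falses ls = 0"
  shows "(\<Sum>r<length ls - 1. lterm ls (r, 2, length ls - r - 2)) = 0"
proof (rule sum.neutral, rule ballI)
  fix r assume "r \<in> {..<length ls - 1}"
  then have r: "Suc r < length ls" by simp
  then have "fst (ls ! r) \<and> fst (ls ! Suc r)" using assms unfolding falses_0_iff by simp
  then have "mcoef (take 2 (drop r ls)) = 0" using merge_all_true(1)[OF r] by simp
  then show "lterm ls (r, 2, length ls - r - 2) = 0" using lterm_eq_0 by blast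
qed

text \<open>The differential does not contribute, as f_n = 0. For n = p the product of f_i and
  f_(p-i) is minus the i-th indicator, and together they give the f_1-image of m'_p. For n > p a
  factor with index 1 has a partner f_(n-1) = 0, and otherwise the indices do not add up to
  p.\<close>

lemma morph_basis_true_ge:
  assumes t: "falses ls = 0" and n: "p \<le> length ls"
  shows "morph_basis ls"
proof -
  let ?n = "length ls"
  have L: "(\<Sum>x\<leftarrow>rst_triples ?n. lterm ls x) = (if ?n = p then fsc (- 1) one else 0)"
    unfolding lterm_sum lterm_p_sum lterm_two_true[OF t] using t by (simp only: simp_thms add_0_left)
  have "\<not> ?n \<le> p - 1" using n p_pos by simp
  then have "fcoef ls = 0" unfolding fcoef_true[OF t] tc_def by (simp only: simp_thms if_False)
  then have D: "fdiff z (fcoef ls) = 0" for z by (simp only: fdiff_0)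
  have R: "(\<Sum>i\<in>{1..<?n}. rterm ls i) = (if ?n = p then fsc (- 1) one else 0)"
  proof (cases "?n = p")
    case True
    have ri: "rterm ls i = fsc (- 1) (iv i)" if "i \<in> {1..<?n}" for i
    proof -
      have i: "1 \<le> i" "i < ?n" "i \<le> p - 1" "?n - i \<le> p - 1" using that True by auto
      obtain J K where r: "rterm ls i = fsc ((-1) ^ ?n) (gg i J (?n - i) K)"
        using rterm_true[OF t i(1,2)] i(3,4) by auto
      have "((-1) ^ ?n :: 'p mod_ring) = - 1" using True odd_p by simp
      moreover have "gg i J (?n - i) K = iv i"
      proof (cases "i = 1")
        case i1: True
        have "2 \<le> p - 1" using p_ge_3 by simp
        moreover have "?n - 1 = p - 1" using True by simp
        ultimately show ?thesis unfolding i1 using fcomp_gc_1[of "p - 1" J K] iv_last_shift by (simp only: order_refl)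
      next
        case False
        then have "2 \<le> i" "1 \<le> ?n - i" "i + (?n - i) = p" using i True by auto
        then show ?thesis using fcomp_gc_ge_2[of i "?n - i" J K] i by simp
      qed
      ultimately show ?thesis unfolding r by simp
    qed
    have "(\<Sum>i\<in>{1..<?n}. rterm ls i) = fsc (- 1) (\<Sum>i\<in>{1..<?n}. iv i)"
      unfolding fsc_sum by (intro sum.cong refl ri)
    also have "(\<Sum>i\<in>{1..<?n}. iv i) = one"
    proof
      fix k
      have "{1..<?n} = {1..p - 1}" using True p_pos by auto
      then show "(\<Sum>i\<in>{1..<?n}. iv i) k = one k" using sum_iv[of k] by (simp add: one_def fam_sum_apply)
    qed
    finally show ?thesis using True by simp
  next
    case False
    then have n': "p < ?n" using n by simp
    have "rterm ls i = 0" if "i \<in> {1..<?n}" for i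
    proof -
      have i: "1 \<le> i" "i < ?n" using that by auto
      show ?thesis
      proof (cases "i \<le> p - 1 \<and> ?n - i \<le> p - 1")
        case True
        obtain J K where r: "rterm ls i = fsc ((-1) ^ ?n) (gg i J (?n - i) K)"
          using rterm_true[OF t i] True by auto
        have "2 \<le> i" "1 \<le> ?n - i" "?n - i \<noteq> 1" "i + (?n - i) \<noteq> p" using True n' i by auto
        then show ?thesis unfolding r using fcomp_gc_ge_2[of i "?n - i" J K] True by (simp add: fsc_0_right)
      next
        case False then show ?thesis using rterm_true[OF t i] by auto
      qed
    qed
    then have "(\<Sum>i\<in>{1..<?n}. rterm ls i) = 0" by (intro sum.neutral ballI)
    then show ?thesis using False by (simp only: if_False)
  qed
  show ?thesis unfolding morph_basis_def L D R add_0_left by (rule fam_eq_refl)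
qed

text \<open>As n is less than p, only the splittings that cut off a single chi contribute; they
  cancel the differential of f_n because (-1)^(n-1) and (-1)^n are opposite.\<close>

lemma morph_basis_true_small:
  assumes t: "falses ls = 0" and n: "3 \<le> length ls" "length ls < p"
  shows "morph_basis ls"
proof -
  let ?n = "length ls"
  let ?T = "\<lambda>i. iv (?n - 1) i + iv (?n - 1) (i + (l - 1))"
  have n': "2 \<le> ?n" "?n \<le> p - 1" using n by auto
  have L: "(\<Sum>x\<leftarrow>rst_triples ?n. lterm ls x) = 0"
    unfolding lterm_sum lterm_p_sum lterm_two_true[OF t] using n by simp
  have f: "fcoef ls = fsc ((-1) ^ (?n - 1)) (gc ?n)" using fcoef_true[OF t] n' n by (simp add: tc_def)
  have deg: "sum_list (map (hdeg p) ls) + 1 - int ?n = gamma_deg p ?n + int (sum_list (map snd ls) * l)"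
    using sum_hdeg_true[of ls] t unfolding falses_0_iff by blast
  have D: "fdiff (sum_list (map (hdeg p) ls) + 1 - int ?n) (fcoef ls) = fsc ((-1) ^ (?n - 1)) ?T"
    unfolding deg f fdiff_fsc fdiff_gc[OF n'] ..
  have r: "rterm ls i = (if i = 1 then fsc ((-1) ^ ?n) (\<lambda>i. iv (?n - 1) (i + (l - 1))) else 0)
      + (if i = ?n - 1 then fsc ((-1) ^ ?n) (iv (?n - 1)) else 0)" if "i \<in> {1..<?n}" for i
  proof -
    have i: "1 \<le> i" "i < ?n" "i \<le> p - 1" "?n - i \<le> p - 1" "1 \<le> ?n - i" using that n by auto
    obtain J K where r: "rterm ls i = fsc ((-1) ^ ?n) (gg i J (?n - i) K)"
      using rterm_true[OF t i(1,2)] i(3,4) by auto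
    show ?thesis
    proof (cases "i = 1")
      case True
      have "2 \<le> ?n - 1" "?n - 1 \<le> p - 1" "1 \<noteq> ?n - 1" using n by auto
      then show ?thesis using r fcomp_gc_1[of "?n - 1" J K] unfolding True by (simp only: if_False simp_thms if_True add_0_right)
    next
      case False
      then have "2 \<le> i" "?n - i = 1 \<or> i + (?n - i) = p \<longleftrightarrow> i = ?n - 1" using i n by auto
      then have "rterm ls i = fsc ((-1) ^ ?n) (if i = ?n - 1 then iv i else 0)"
        unfolding r using fcomp_gc_ge_2[of i "?n - i" J K] i by (simp only:)
      then show ?thesis using False by (simp add: fsc_0_right)
    qed
  qed
  have "(\<Sum>i\<in>{1..<?n}. rterm ls i) = (\<Sum>i\<in>{1..<?n}. (if i = 1 then fsc ((-1) ^ ?n) (\<lambda>i. iv (?n - 1) (i + (l - 1))) else 0)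
      + (if i = ?n - 1 then fsc ((-1) ^ ?n) (iv (?n - 1)) else 0))" by (intro sum.cong refl r)
  also have "\<dots> = fsc ((-1) ^ ?n) (\<lambda>i. iv (?n - 1) (i + (l - 1))) + fsc ((-1) ^ ?n) (iv (?n - 1))"
  proof -
    have m: "1 \<in> {1..<?n}" "?n - 1 \<in> {1..<?n}" "finite {1..<?n}" using n by auto
    show ?thesis unfolding sum.distrib sum.delta[OF m(3)] using m(1,2) by (simp only: if_True)
  qed
  finally have R: "(\<Sum>i\<in>{1..<?n}. rterm ls i) = fsc ((-1) ^ ?n) ?T"
    by (simp add: fsc_def smult2_def fun_eq_iff prod_eq_iff algebra_simps)
  have "((-1) ^ ?n :: 'p mod_ring) = - ((-1) ^ (?n - 1))" using n by (cases ?n) simp_all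
  then have "fsc ((-1) ^ (?n - 1)) ?T + fsc ((-1) ^ ?n) ?T = 0"
    by (simp add: fsc_def smult2_def fun_eq_iff prod_eq_iff)
  then show ?thesis unfolding morph_basis_def L D R by (simp only: fam_eq_refl)
qed

text \<open>The two splittings that cut off a single chi coincide here, and chi chi alone has to
  produce both indicators.\<close>

lemma morph_basis_true_2:
  assumes t: "falses ls = 0" and n: "length ls = 2"
  shows "morph_basis ls"
proof -
  let ?T = "\<lambda>i. iv 1 i + iv 1 (i + (l - 1))"
  have p2: "2 \<le> p - 1" using p_ge_3 by simp
  have L: "(\<Sum>x\<leftarrow>rst_triples (length ls). lterm ls x) = 0"
    unfolding lterm_sum lterm_p_sum lterm_two_true[OF t] using n p_ge_3 by simp
  have f: "fcoef ls = fsc (- 1) (gc 2)" using fcoef_true[OF t] n p2 by (simp add: tc_def)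
  have deg: "sum_list (map (hdeg p) ls) + 1 - int (length ls) = gamma_deg p 2 + int (sum_list (map snd ls) * l)"
    using sum_hdeg_true[of ls] t unfolding falses_0_iff n by blast
  have D: "fdiff (sum_list (map (hdeg p) ls) + 1 - int (length ls)) (fcoef ls) = fsc (- 1) ?T"
    using fdiff_gc[of 2 "sum_list (map snd ls)"] p2 unfolding deg f fdiff_fsc by simp
  have i: "(1::nat) \<le> 1" "1 < length ls" "1 \<le> p - 1 \<and> length ls - 1 \<le> p - 1" "length ls - 1 = 1" using n p2 by auto
  obtain J K where r: "rterm ls 1 = fsc ((-1) ^ length ls) (gg 1 J 1 K)"
    and d: "sum_list (map (hdeg p) (take 1 ls)) + 1 - int 1 = gd 1 J"
      "sum_list (map (hdeg p) (drop 1 ls)) + 1 - int 1 = gd 1 K"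
    using rterm_true[OF t i(1,2)] unfolding if_P[OF i(3)] unfolding i(4) by blast
  have z: "sum_list (map (hdeg p) ls) + 2 - int (length ls) = gd 1 J + (gd 1 K)"
    using d sum_list_take_drop[of 1 "map (hdeg p) ls"] n unfolding take_map drop_map by linarith
  let ?F = "gg 1 J 1 K"
  have "{1..<length ls} = {1}" using n by auto
  then have R: "(\<Sum>i\<in>{1..<length ls}. rterm ls i) = ?F" using r n by (simp add: fsc_1)
  have "fam_eq (gd 1 J + (gd 1 K)) ?F ?T" by (rule fcomp_chi_chi)
  then have "fam_eq (gd 1 J + (gd 1 K)) 0 (fsc (- 1) ?T + ?F)"
    unfolding fam_eq_def by (auto simp: coords_zero_def fsc_def smult2_def)
  then show ?thesis unfolding morph_basis_def L D R z .
qed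

lemma morph_basis_false_2:
  assumes t: "falses ls \<noteq> 0" and n: "length ls = 2"
  shows "morph_basis ls"
proof -
  obtain a b where ls: "ls = [a, b]" using n by (auto simp: numeral_2_eq_2 length_Suc_conv)
  have ab: "\<not> (fst a \<and> fst b)" using t by (auto simp: ls)
  have "(\<Sum>r<length ls - 1. lterm ls (r, 2, length ls - r - 2)) = lterm ls (0, 2, 0)" by (simp add: ls)
  also have "\<dots> = one"
  proof -
    have "take 2 (drop 0 ls) = [a, b]" "outer ls 0 2 = [mlab [a, b]]" by (simp_all add: ls outer_def outer_with_def)
    moreover have "sgn_rst (map (hdeg p) ls) 0 2 0 = 1" by (simp add: sgn_rst_def sgn_def)
    ultimately show ?thesis using ab
      by (simp only: lterm_def prod.case mcoef_two fcoef_single) (simp add: fsc_1)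
  qed
  finally have L: "(\<Sum>x\<leftarrow>rst_triples (length ls). lterm ls x) = one"
    unfolding lterm_sum lterm_p_sum using t by (simp only: if_False simp_thms add_0_right)
  have f: "fcoef ls = 0" using fcoef_false[OF t] n by simp
  have "fcomp (hdeg p a) (hdeg p b) one one = one"
  proof (cases "fst b")
    case True
    then have "\<not> fst a" using ab by simp
    then show ?thesis unfolding hdeg_false[OF \<open>\<not> fst a\<close>] by (intro fcomp_one_left) (simp_all add: one_def)
  next
    case False
    have "0 \<le> hdeg p a" using l_pos by (simp add: hdeg_def)
    then show ?thesis unfolding hdeg_false[OF False] by (intro fcomp_one_right) (simp_all add: one_def)
  qed
  moreover have "sgn_comp (map (hdeg p) ls) [1, length ls - 1] = 1" unfolding sgn_comp_two by (simp add: n sgn_def)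
  ultimately have r: "rterm ls 1 = one"
    unfolding rterm_def by (simp add: ls fcoef_single fsc_1)
  have "{1..<length ls} = {1}" using n by auto
  then have R: "(\<Sum>i\<in>{1..<length ls}. rterm ls i) = one" using r by simp
  show ?thesis unfolding morph_basis_def L R f fdiff_0 add_0_left by (rule fam_eq_refl)
qed

lemma rterm_eq_0: "fcoef (take i ls) = 0 \<or> fcoef (drop i ls) = 0 \<Longrightarrow> rterm ls i = 0"
  by (auto simp only: rterm_def fcomp_0 fsc_0_right)

lemma rterm_inner_false:
  assumes "falses ls \<noteq> 0" "2 \<le> i" "i + 2 \<le> length ls"
  shows "rterm ls i = 0"
proof -
  have "falses (take i ls) \<noteq> 0 \<or> falses (drop i ls) \<noteq> 0" using assms(1) falses_take_drop[of ls i] by linarith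
  then show ?thesis
    using fcoef_false[of "take i ls"] fcoef_false[of "drop i ls"] assms by (intro rterm_eq_0) auto
qed

text \<open>On tuples with a power of iota f_n vanishes unless n = 1, so on the right only
  splittings cutting off an end entry remain. They match the end terms on the left, where merging an
  inner power of iota with both neighbours cancels.\<close>

lemma morph_basis_false:
  assumes t: "falses ls \<noteq> 0" and n: "3 \<le> length ls"
  shows "morph_basis ls"
proof -
  let ?n = "length ls"
  have f: "fcoef ls = 0" using fcoef_false[OF t] n by simp
  have L: "(\<Sum>x\<leftarrow>rst_triples ?n. lterm ls x) =
    (\<Sum>r<?n - 1. if falses ls = 1 \<and> \<not> (fst (ls ! r) \<and> fst (ls ! Suc r)) then fsc ((-1) ^ (?n + r)) (tc (?n - 1)) else 0)"
  proof -
    have "(\<Sum>r<?n - 1. lterm ls (r, 2, ?n - r - 2)) = (\<Sum>r<?n - 1. if falses ls = 1 \<and> \<not> (fst (ls ! r) \<and> fst (ls ! Suc r)) then fsc ((-1) ^ (?n + r)) (tc (?n - 1)) else 0)"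
      by (intro sum.cong refl lterm_two) (use n in auto)
    then show ?thesis unfolding lterm_sum lterm_p_sum using t by (simp only: if_False simp_thms add_0_right)
  qed
  have R: "(\<Sum>i\<in>{1..<?n}. rterm ls i) = rterm ls 1 + rterm ls (?n - 1)"
  proof -
    have "(\<Sum>i\<in>{1..<?n}. rterm ls i) = (\<Sum>i\<in>{1, ?n - 1}. rterm ls i)"
    proof (rule sum.mono_neutral_right)
      show "\<forall>i\<in>{1..<?n} - {1, ?n - 1}. rterm ls i = 0"
        by (intro ballI rterm_inner_false[OF t]) auto
    qed (use n in auto)
    also have "\<dots> = rterm ls 1 + rterm ls (?n - 1)" using n by (subst sum.insert) auto
    finally show ?thesis .
  qed
  have left: "falses (drop 1 ls) \<noteq> 0 \<Longrightarrow> rterm ls 1 = 0"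
    using fcoef_false[of "drop 1 ls"] n by (intro rterm_eq_0 disjI2) simp
  have right: "falses (take (?n - 1) ls) \<noteq> 0 \<Longrightarrow> rterm ls (?n - 1) = 0"
    using fcoef_false[of "take (?n - 1) ls"] n by (intro rterm_eq_0 disjI1) simp
  obtain b bs where lb: "ls = b # bs" using n by (cases ls) auto
  have fl: "falses ls = falses (drop 1 ls) + (if fst b then 0 else 1)" unfolding lb by simp
  define c where "c = ls ! (?n - 1)"
  have cs: "drop (?n - 1) ls = [c]" using Cons_nth_drop_Suc[of "?n - 1" ls] n by (simp add: c_def)
  have fr: "falses ls = falses (take (?n - 1) ls) + (if fst c then 0 else 1)"
    unfolding falses_take_drop[of ls "?n - 1"] cs by simp
  show ?thesis
  proof (cases "falses ls = 1")
    case False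
    then have "falses ls \<ge> 2" using t by linarith
    then have "falses (drop 1 ls) \<noteq> 0" "falses (take (?n - 1) ls) \<noteq> 0" using fl fr by (auto split: if_splits)
    then have "(\<Sum>i\<in>{1..<?n}. rterm ls i) = 0" unfolding R using left right by simp
    moreover have "(\<Sum>x\<leftarrow>rst_triples ?n. lterm ls x) = 0" unfolding L using False by (simp only: simp_thms if_False sum.neutral_const)
    ultimately show ?thesis unfolding morph_basis_def f fdiff_0 by (simp only: add_0_left fam_eq_refl)
  next
    case True
    obtain k where k: "k < ?n" "\<And>r. r < ?n \<Longrightarrow> \<not> fst (ls ! r) \<longleftrightarrow> r = k"
      using single_false_position[OF True] by blast
    let ?T = "\<lambda>c. fsc c (tc (?n - 1))"
    have cnd: "falses ls = 1 \<and> \<not> (fst (ls ! r) \<and> fst (ls ! Suc r)) \<longleftrightarrow> r = k \<or> Suc r = k" if "r < ?n - 1" for r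
    proof -
      have "r < ?n" "Suc r < ?n" using that by auto
      then show ?thesis using k(2)[of r] k(2)[of "Suc r"] True by blast
    qed
    have "(\<Sum>x\<leftarrow>rst_triples ?n. lterm ls x) = (\<Sum>r<?n - 1. if r = k \<or> Suc r = k then ?T ((-1) ^ (?n + r)) else 0)"
      unfolding L by (intro sum.cong refl) (simp only: cnd lessThan_iff)
    also have "\<dots> = (if k = 0 then ?T ((-1) ^ (?n + 0)) else 0) + (if k = ?n - 1 then ?T ((-1) ^ (?n + (?n - 1 - 1))) else 0)"
      by (rule alternating_pair_sum[where g = "\<lambda>r. (-1) ^ (?n + r)" and T = ?T])
        (use k(1) n in \<open>auto simp: fsc_def smult2_def fun_eq_iff prod_eq_iff\<close>)
    finally have L': "(\<Sum>x\<leftarrow>rst_triples ?n. lterm ls x) = (if k = 0 then ?T ((-1) ^ ?n) else 0) + (if k = ?n - 1 then ?T 1 else 0)"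
    proof -
      assume e: "(\<Sum>x\<leftarrow>rst_triples ?n. lterm ls x) = (if k = 0 then ?T ((-1) ^ (?n + 0)) else 0) + (if k = ?n - 1 then ?T ((-1) ^ (?n + (?n - 1 - 1))) else 0)"
      have "even (?n + (?n - 1 - 1))" using n by simp
      then have "((-1) ^ (?n + (?n - 1 - 1)) :: 'p mod_ring) = 1" by (rule neg_one_even_power)
      then show ?thesis using e unfolding add_0_right by (simp only:)
    qed
    have os: "1 = x + (if B then 0 else 1) \<Longrightarrow> x = 0 \<longleftrightarrow> \<not> B" for x :: nat and B by auto
    have b0: "\<not> fst b \<longleftrightarrow> k = 0"
    proof -
      have "0 < ?n" using n by linarith
      then show ?thesis using k(2)[of 0] unfolding lb by auto
    qed
    have c0: "\<not> fst c \<longleftrightarrow> k = ?n - 1"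
    proof -
      have "?n - 1 < ?n" using n by simp
      then show ?thesis using k(2)[of "?n - 1"] unfolding c_def by blast
    qed
    have z1: "falses (drop 1 ls) = 0 \<longleftrightarrow> k = 0" using os[OF fl[unfolded True]] unfolding b0 .
    have z2: "falses (take (?n - 1) ls) = 0 \<longleftrightarrow> k = ?n - 1" using os[OF fr[unfolded True]] unfolding c0 .
    have r1: "rterm ls 1 = (if k = 0 then ?T ((-1) ^ ?n) else 0)"
    proof (cases "k = 0")
      case k0: True
      then have "\<not> fst b" using b0 by simp
      then have hb: "hdeg p b = int (snd b * l)" by (rule hdeg_false)
      have fd: "fcoef (drop 1 ls) = tc (?n - 1)" using fcoef_true[of "drop 1 ls"] z1 k0 by simp
      have tk: "take 1 ls = [b]" by (simp add: lb)
      have "even (hdeg p b)" using hdeg_even_iff \<open>\<not> fst b\<close> by simp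
      then have "even ((1 - int (?n - 1)) * (int 1 + sum_list (take 1 (map (hdeg p) ls)))) \<longleftrightarrow> even ?n"
        using n unfolding take_map tk by auto
      then have sg: "(of_int (sgn_comp (map (hdeg p) ls) [1, ?n - 1]) :: 'p mod_ring) = (-1) ^ ?n"
        unfolding sgn_comp_two sgn_mod_ring by simp
      have deg: "sum_list (map (hdeg p) [b]) + 1 - int 1 = int (snd b * l)" using hb by simp
      show ?thesis unfolding rterm_def sg tk fcoef_single fd deg
        using fcomp_one_left[of "tc (?n - 1)" "snd b"] tc_snd tc_add_l k0 by (simp only: if_True simp_thms)
    next
      case False
      then show ?thesis using left z1 by simp
    qed
    have r2: "rterm ls (?n - 1) = (if k = ?n - 1 then ?T 1 else 0)"
    proof (cases "k = ?n - 1")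
      case kn: True
      then have "\<not> fst c" using c0 by simp
      then have hc: "hdeg p c = int (snd c * l)" by (rule hdeg_false)
      have ft: "falses (take (?n - 1) ls) = 0" using z2 kn by simp
      have lt: "length (take (?n - 1) ls) = ?n - 1" by simp
      have fd: "fcoef (take (?n - 1) ls) = tc (?n - 1)" using fcoef_true[OF ft] unfolding lt .
      have nn: "?n - (?n - 1) = 1" using n by simp
      have sg: "sgn_comp (map (hdeg p) ls) [?n - 1, 1] = 1"
        unfolding sgn_comp_two by (simp add: sgn_def)
      have deg: "sum_list (map (hdeg p) (drop (?n - 1) ls)) + 1 - int 1 = int (snd c * l)" using hc unfolding cs by simp
      have y: "0 \<le> sum_list (map (hdeg p) (take (?n - 1) ls)) + 1 - int (?n - 1)"
        using sum_hdeg_true[of "take (?n - 1) ls"] ft gamma_deg_nonneg[of "?n - 1"] unfolding falses_0_iff lt by simp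
      show ?thesis unfolding rterm_def nn sg deg unfolding cs fcoef_single fd of_int_1 fcomp_one_right[OF y tc_snd] using kn by (simp only: if_True simp_thms)
    next
      case False
      then show ?thesis using right z2 by simp
    qed
    show ?thesis unfolding morph_basis_def L' R r1 r2 f fdiff_0 add_0_left by (rule fam_eq_refl)
  qed
qed

lemma morph_basis_all: "ls \<noteq> [] \<Longrightarrow> morph_basis ls"
proof -
  assume "ls \<noteq> []"
  then have "1 \<le> length ls" by (simp add: Suc_le_eq)
  then consider "length ls = 1" | "length ls = 2" | "3 \<le> length ls" by linarith
  then show ?thesis
  proof cases
    case 1 then show ?thesis by (rule morph_basis_1)
  next
    case 2 then show ?thesis using morph_basis_true_2 morph_basis_false_2 by blast
  next
    case 3 then show ?thesis using morph_basis_false[of ls] morph_basis_true_small[of ls] morph_basis_true_ge[of ls]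
      by (metis linorder_not_le)
  qed
qed

lemma morph_relation:
  assumes c: "compat ds cbs" and ne: "cbs \<noteq> []"
  shows "morph_lhs p ds (map el cbs) = morph_rhs p ds (map el cbs)"
proof -
  let ?C = "prod_list (map fst cbs)"
  show ?thesis
  proof (cases "?C = 0")
    case True
    show ?thesis unfolding morph_lhs_coords[OF c] morph_rhs_coords[OF c ne] True fsc_0_left ..
  next
    case False
    have ds: "ds = map (hdeg p) (map snd cbs)" by (rule compat_degrees[OF c False])
    have "morph_basis (map snd cbs)" using ne by (intro morph_basis_all) simp
    then show ?thesis unfolding morph_lhs_coords[OF c] morph_rhs_coords[OF c ne] Phi_eq_iff
      unfolding morph_basis_def ds[symmetric] length_map by (rule fam_eq_fsc)
  qed
qed

subsection \<open>The induced map on homology\<close>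

lemma hm_cong_add: "hm (om i) (om j) a = hm (om i) (om j) a' \<Longrightarrow>
    hm (om i) (om j) (a + b) = hm (om i) (om j) (a' + b)"
  unfolding hm_eq_iff[OF omega_bounds omega_bounds] by simp

lemma hm_cong_smult: "hm (om i) (om j) a = hm (om i) (om j) a' \<Longrightarrow>
    hm (om i) (om j) (smult2 s a) = hm (om i) (om j) (smult2 s a')"
proof -
  have "smult2 s a - smult2 s a' = smult2 s (a - a')" by (simp add: smult2_def prod_eq_iff right_diff_distrib)
  then show "hm (om i) (om j) a = hm (om i) (om j) a' \<Longrightarrow> ?thesis"
    unfolding hm_eq_iff[OF omega_bounds omega_bounds] by (simp add: coords_zero_smult2)
qed

lemma hm_cmul_cong_left:
  assumes "hm (om i) (om j) a = hm (om i) (om j) a'"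
  shows "hm (om i) (om k) (cmul (om i) (om j) (om k) a b)
    = hm (om i) (om k) (cmul (om i) (om j) (om k) a' b)"
  unfolding hm_comp[OF omega_bounds omega_bounds omega_bounds, symmetric] assms ..

lemma hm_cmul_cong_right:
  assumes "hm (om j) (om k) b = hm (om j) (om k) b'"
  shows "hm (om i) (om k) (cmul (om i) (om j) (om k) a b)
    = hm (om i) (om k) (cmul (om i) (om j) (om k) a b')"
  unfolding hm_comp[OF omega_bounds omega_bounds omega_bounds, symmetric] assms ..

lemma hm_Pcar: "x \<in> Pcar p (om j) \<Longrightarrow> hm (om i) (om j) c x \<in> Pcar p (om i)"
  using hm_HomP[OF omega_bounds omega_bounds, of i j c] by (auto simp: HomP_def)

text \<open>Associativity is inherited from the composition of maps, which avoids a case analysis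
  over four indices.\<close>

lemma hm_assoc:
  "hm (om i) (om r) (cmul (om i) (om k) (om r) (cmul (om i) (om j) (om k) a b) c)
    = hm (om i) (om r) (cmul (om i) (om j) (om r) a (cmul (om j) (om k) (om r) b c))"
  unfolding hm_comp[OF omega_bounds omega_bounds omega_bounds, symmetric]
  by (rule ext) (simp add: restrict_def hm_Pcar)

lemma cmul_bilinear:
  "cmul m k n (a + a') b = cmul m k n a b + cmul m k n a' b"
  "cmul m k n a (b + b') = cmul m k n a b + cmul m k n a b'"
  "cmul m k n (a - a') b = cmul m k n a b - cmul m k n a' b"
  "cmul m k n a (b - b') = cmul m k n a b - cmul m k n a b'"
  "cmul m k n (smult2 s a) b = smult2 s (cmul m k n a b)"
  "cmul m k n a (smult2 s b) = smult2 s (cmul m k n a b)"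
  by (simp_all add: cmul_def smult2_def prod_eq_iff algebra_simps)

section \<open>Exactness of the resolution in coordinates\<close>

lemma dc_square:
  "hm (om j) (om (Suc (Suc j))) (cmul (om j) (om (Suc j)) (om (Suc (Suc j))) (dc j) (dc (Suc j)))
    = hm (om j) (om (Suc (Suc j))) 0"
  unfolding hm_eq_iff[OF omega_bounds omega_bounds]
  by (cases rule: two_steps[of j]) (use p_ge_3 in \<open>auto simp: coords_zero_def cmul_def\<close>)

text \<open>Composition with d never reaches an identity coordinate, reaches the radical coordinate
  in every case up to sign, and reaches a map between neighbouring indices only when its source is
  the next term of the zigzag.\<close>

lemma lift_step:
  assumes 1: "om n = om i \<Longrightarrow> fst c = 0"
    and 2: "\<lbrakk>om n = Suc (om i) \<or> om i = Suc (om n); om n \<noteq> om (Suc i)\<rbrakk> \<Longrightarrow> fst c = 0"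
  shows "\<exists>h. hm (om i) (om n) (cmul (om i) (om (Suc i)) (om n) (dc i) h) = hm (om i) (om n) c"
proof -
  \<comment> \<open>The structure constant by which the step multiplies the first entry of
    \<open>h\<close> into the radical coordinate; it is 1 or -1, hence its own inverse.\<close>
  define s :: "'p mod_ring" where "s = (if om (Suc i) = om i then snd (dc i)
    else if om (Suc i) = Suc (om i) then 1 else - 1)"
  define h :: "'p coord" where "h = (if om n = om i then (s * snd c, 0) else (fst c, 0))"
  have "coords_zero (om i) (om n) (cmul (om i) (om (Suc i)) (om n) (dc i) h - c)"
    by (cases rule: step_forms[of i]) (use 1 2 in \<open>auto simp: coords_zero_def cmul_def h_def s_def\<close>)
  then show ?thesis unfolding hm_eq_iff[OF omega_bounds omega_bounds] by blast
qed

text \<open>Kernel equals image: wherever \<open>lift_step\<close> asks for a vanishing coordinate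
  of \<open>c\<close>, the previous component of d detects that coordinate.\<close>

lemma exact_at_Suc:
  assumes "hm (om j) (om n) (cmul (om j) (om (Suc j)) (om n) (dc j) c) = hm (om j) (om n) 0"
  shows "\<exists>h. hm (om (Suc j)) (om n) (cmul (om (Suc j)) (om (Suc (Suc j))) (om n) (dc (Suc j)) h)
    = hm (om (Suc j)) (om n) c"
proof (rule lift_step)
  have z: "coords_zero (om j) (om n) (cmul (om j) (om (Suc j)) (om n) (dc j) c)"
    using assms unfolding hm_eq_iff[OF omega_bounds omega_bounds] by simp
  note b = omega_bounds[of n] omega_bounds[of j] omega_bounds[of "Suc j"]
  {
    assume n: "om n = om (Suc j)"
    then show "fst c = 0"
      using z by (cases rule: step_forms[of j]) (auto simp: coords_zero_def cmul_def)
  }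
  {
    assume n: "om n = Suc (om (Suc j)) \<or> om (Suc j) = Suc (om n)" "om n \<noteq> om (Suc (Suc j))"
    then have "om n = om j" "om j \<noteq> om (Suc j)"
      using b by (cases rule: two_steps[of j]; auto)+
    then show "fst c = 0" using z by (cases rule: step_forms[of j]) (auto simp: coords_zero_def cmul_def)
  }
qed

lemma omega_0: "om 0 = 1" and omega_Suc_0: "om (Suc 0) = 2"
proof -
  show 0: "om 0 = 1" using omega_lower[of 0] by simp
  have "0 mod l < p - 2" using p_ge_3 by simp
  then show "om (Suc 0) = 2" using omega_step(1)[of 0] 0 by simp
qed

text \<open>The cokernel of the lowest component of d is the trivial module, seen only by the
  identity coordinate of an endomorphism of P_1; a map from P_2, the only neighbour, lifts because
  the next term is P_2.\<close>

lemma exact_at_0: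
  assumes "om n = 1 \<Longrightarrow> fst c = 0"
  shows "\<exists>h. hm (om 0) (om n) (cmul (om 0) (om (Suc 0)) (om n) (dc 0) h) = hm (om 0) (om n) c"
  using assms omega_bounds[of n] by (intro lift_step) (auto simp: omega_0 omega_Suc_0)

text \<open>The part of the differential of a family that involves its i-th component only; the other part
  involves the component i + 1, which is what makes the contracting homotopy recursive.\<close>
definition right_d :: "int \<Rightarrow> nat \<Rightarrow> 'p coord \<Rightarrow> 'p coord" where
  "right_d z i h = (if int i + z < 0 then 0
    else cmul (om i) (om (nat (int i + z))) (om (nat (int i + z + 1))) h (dc (nat (int i + z))))"

lemma fdiff_eq:
  "fdiff z G i = cmul (om i) (om (Suc i)) (om (nat (int i + z + 1))) (dc i) (G (Suc i))
    + smult2 (- ((-1) ^ nat \<bar>z\<bar>)) (right_d z i (G i))"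
proof -
  have n: "nat (int i + 1) = Suc i" "nat (int i + 1 + z) = nat (int i + z + 1)" by (simp_all add: algebra_simps)
  show ?thesis by (simp add: fdiff_def fcomp_def fsc_def right_d_def n)
qed

lemma right_d_add: "right_d z i (a - b) = right_d z i a - right_d z i b"
  "right_d z i (smult2 s a) = smult2 s (right_d z i a)"
  by (simp_all add: right_d_def cmul_bilinear) (simp add: smult2_def prod_eq_iff)

lemma sign_pred: "(-1) ^ nat \<bar>z - 1\<bar> = (- ((-1) ^ nat \<bar>z\<bar>) :: 'p mod_ring)"
proof -
  have "(-1) ^ nat \<bar>w\<bar> = (if even w then 1 else - 1 :: 'p mod_ring)" for w :: int
    by (simp add: even_nat_iff)
  then show ?thesis by simp
qed

lemma smult2_simps: "smult2 s (a - b) = smult2 s a - smult2 s b" "smult2 s (smult2 t a) = smult2 (s * t) a"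
  "smult2 s 0 = 0" "smult2 1 a = a" "smult2 (- s) a = - smult2 s a"
  by (simp_all add: smult2_def prod_eq_iff algebra_simps)

text \<open>The usual construction of a null homotopy from a complex of projectives into an exact
  one, built upwards from position 0 by solving one lifting problem at a time.\<close>

lemma contract_cycle:
  assumes cyc: "fam_eq (z + 1) (fdiff z G) 0"
    and base: "\<lbrakk>0 \<le> z; om (nat z) = 1\<rbrakk> \<Longrightarrow> fst (G 0) = 0"
  obtains H where "fam_eq z G (fdiff (z - 1) H)"
proof -
  let ?s = "- ((-1) ^ nat \<bar>z - 1\<bar>) :: 'p mod_ring"
  have s: "?s = (-1) ^ nat \<bar>z\<bar>" unfolding sign_pred by simp
  have s2: "(-1) ^ nat \<bar>z\<bar> * (-1) ^ nat \<bar>z\<bar> = (1 :: 'p mod_ring)" by (simp flip: power_add)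
  \<comment> \<open>What component \<open>i + 1\<close> of the homotopy has to produce under d once
    component \<open>i\<close> is \<open>h\<close>.\<close>
  define R where "R i h = G i - smult2 ?s (right_d (z - 1) i h)" for i h
  define n where "n i = nat (int i + z)" for i
  \<comment> \<open>Solvability of the next lifting problem: the remainder is killed by the previous
    component of d or, at the bottom, has no identity coordinate.\<close>
  define P where "P i h \<longleftrightarrow> (0 \<le> int i + z \<longrightarrow> (case i of 0 \<Rightarrow> om (n 0) = 1 \<longrightarrow> fst (R 0 h) = 0
    | Suc j \<Rightarrow> hm (om j) (om (n i)) (cmul (om j) (om i) (om (n i)) (dc j) (R i h))
        = hm (om j) (om (n i)) 0))" for i h
  define Q where "Q i h h' \<longleftrightarrow> (0 \<le> int i + z \<longrightarrow>
    hm (om i) (om (n i)) (cmul (om i) (om (Suc i)) (om (n i)) (dc i) h')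
      = hm (om i) (om (n i)) (R i h))" for i h h'
  \<comment> \<open>Starting the homotopy with 0 leaves the remainder \<open>G 0\<close>, to which
    \<open>base\<close> applies.\<close>
  have P0: "P 0 0"
  proof -
    have "right_d (z - 1) 0 0 = 0" by (simp add: right_d_def cmul_0)
    then have "R 0 0 = G 0" by (simp add: R_def smult2_simps)
    then show ?thesis using base by (simp add: P_def n_def)
  qed
  have step: "\<exists>h'. P (Suc i) h' \<and> Q i h h'" if Ph: "P i h" for i h
  proof -
    have "\<exists>h'. Q i h h'"
    proof (cases "0 \<le> int i + z")
      case True
      show ?thesis
      proof (cases i)
        case 0
        then show ?thesis using Ph True exact_at_0[of "n 0" "R 0 h"] by (simp add: P_def Q_def)
      next
        case (Suc j)
        then show ?thesis using Ph True exact_at_Suc[of j "n i" "R i h"] by (simp add: P_def Q_def)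
      qed
    qed (simp add: Q_def)
    then obtain h' where h': "Q i h h'" by blast
    have "P (Suc i) h'"
      unfolding P_def
    proof (intro impI)
      assume nn: "0 \<le> int (Suc i) + z"
      let ?m = "om i" and ?k = "om (Suc i)" and ?n = "om (n (Suc i))"
      have ni: "n (Suc i) = nat (int i + z + 1)" by (simp add: n_def add.commute)
      have c: "hm ?m ?n (cmul ?m ?k ?n (dc i) (G (Suc i)) + smult2 (- ((-1) ^ nat \<bar>z\<bar>)) (right_d z i (G i))) = hm ?m ?n 0"
      proof -
        have "int i + (z + 1) = int i + z + 1" "0 \<le> int i + z + 1" using nn by simp_all
        then have "coords_zero ?m ?n (fdiff z G i - 0 i)" using cyc nn unfolding fam_eq_def ni by metis
        then show ?thesis unfolding hm_eq_iff[OF omega_bounds omega_bounds] fdiff_eq ni by simp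
      qed
      have eq: "cmul ?m ?k ?n (dc i) (R (Suc i) h') = cmul ?m ?k ?n (dc i) (G (Suc i))
          - smult2 ?s (cmul ?m ?k ?n (dc i) (right_d (z - 1) (Suc i) h'))"
        unfolding R_def cmul_bilinear ..
      \<comment> \<open>By associativity and the choice of \<open>h'\<close> the left side is the
        old remainder composed with d, whose correction term dies because d d = 0. With the cycle
        condition this shows that d kills the new remainder.\<close>
      have "hm ?m ?n (cmul ?m ?k ?n (dc i) (right_d (z - 1) (Suc i) h')) = hm ?m ?n (right_d z i (G i))"
      proof (cases "int i + z < 0")
        case True
        then show ?thesis by (simp add: right_d_def cmul_0)
      next
        case False
        have r: "right_d (z - 1) (Suc i) h' = cmul ?k (om (n i)) ?n h' (dc (n i))"
          using False by (simp add: right_d_def n_def algebra_simps)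
        have rg: "right_d z i x = cmul ?m (om (n i)) ?n x (dc (n i))" for x
          using False unfolding right_d_def ni by (simp add: n_def)
        have "hm ?m ?n (cmul ?m ?k ?n (dc i) (cmul ?k (om (n i)) ?n h' (dc (n i))))
          = hm ?m ?n (cmul ?m (om (n i)) ?n (cmul ?m ?k (om (n i)) (dc i) h') (dc (n i)))"
          by (rule hm_assoc[symmetric])
        also have "\<dots> = hm ?m ?n (cmul ?m (om (n i)) ?n (R i h) (dc (n i)))"
          by (rule hm_cmul_cong_left) (use h' False in \<open>simp add: Q_def\<close>)
        also have "cmul ?m (om (n i)) ?n (R i h) (dc (n i))
          = cmul ?m (om (n i)) ?n (G i) (dc (n i)) - smult2 ?s (cmul ?m (om (n i)) ?n (right_d (z - 1) i h) (dc (n i)))"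
          unfolding R_def cmul_bilinear ..
        also have "hm ?m ?n (cmul ?m (om (n i)) ?n (G i) (dc (n i)) - smult2 ?s (cmul ?m (om (n i)) ?n (right_d (z - 1) i h) (dc (n i))))
          = hm ?m ?n (cmul ?m (om (n i)) ?n (G i) (dc (n i)))"
        proof -
          have "hm ?m ?n (cmul ?m (om (n i)) ?n (right_d (z - 1) i h) (dc (n i))) = hm ?m ?n 0"
          proof (cases "int i + (z - 1) < 0")
            case True then show ?thesis by (simp add: right_d_def cmul_0)
          next
            case F: False
            define k where "k = nat (int i + (z - 1))"
            have k: "n i = Suc k" "n (Suc i) = Suc (Suc k)" "nat (int i + (z - 1) + 1) = Suc k"
              using F by (simp_all add: k_def n_def)
            have "right_d (z - 1) i h = cmul ?m (om k) (om (Suc k)) h (dc k)"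
              using F unfolding right_d_def k(3) k_def by simp
            then have "hm ?m ?n (cmul ?m (om (n i)) ?n (right_d (z - 1) i h) (dc (n i)))
              = hm ?m ?n (cmul ?m (om k) ?n h (cmul (om k) (om (Suc k)) ?n (dc k) (dc (Suc k))))"
              unfolding k by (simp only: hm_assoc)
            also have "\<dots> = hm ?m ?n (cmul ?m (om k) ?n h 0)"
              unfolding k by (rule hm_cmul_cong_right) (rule dc_square)
            finally show ?thesis by (simp add: cmul_0)
          qed
          then have "coords_zero ?m ?n (cmul ?m (om (n i)) ?n (right_d (z - 1) i h) (dc (n i)))"
            unfolding hm_eq_iff[OF omega_bounds omega_bounds] by simp
          then show ?thesis unfolding hm_eq_iff[OF omega_bounds omega_bounds]
            using coords_zero_smult2[of ?m ?n _ "- ?s"] by (simp add: smult2_simps)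
        qed
        finally show ?thesis unfolding r rg .
      qed
      then have "hm ?m ?n (smult2 (- ?s) (cmul ?m ?k ?n (dc i) (right_d (z - 1) (Suc i) h')))
        = hm ?m ?n (smult2 (- ?s) (right_d z i (G i)))" by (rule hm_cong_smult)
      then have "hm ?m ?n (smult2 (- ?s) (cmul ?m ?k ?n (dc i) (right_d (z - 1) (Suc i) h')) + cmul ?m ?k ?n (dc i) (G (Suc i)))
        = hm ?m ?n (smult2 (- ?s) (right_d z i (G i)) + cmul ?m ?k ?n (dc i) (G (Suc i)))" by (rule hm_cong_add)
      also have "smult2 (- ?s) (cmul ?m ?k ?n (dc i) (right_d (z - 1) (Suc i) h')) + cmul ?m ?k ?n (dc i) (G (Suc i))
        = cmul ?m ?k ?n (dc i) (R (Suc i) h')"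
        unfolding eq by (simp add: smult2_def prod_eq_iff)
      also have "smult2 (- ?s) (right_d z i (G i)) + cmul ?m ?k ?n (dc i) (G (Suc i))
        = cmul ?m ?k ?n (dc i) (G (Suc i)) + smult2 (- ((-1) ^ nat \<bar>z\<bar>)) (right_d z i (G i))"
        unfolding s by (rule add.commute)
      finally show "case Suc i of 0 \<Rightarrow> om (n 0) = 1 \<longrightarrow> fst (R 0 h') = 0
        | Suc j \<Rightarrow> hm (om j) ?n (cmul (om j) ?k ?n (dc j) (R (Suc i) h')) = hm (om j) ?n 0"
        unfolding c nat.case .
    qed
    then show ?thesis using h' by blast
  qed
  obtain H where H: "\<And>i. Q i (H i) (H (Suc i))"
    using dependent_nat_choice[of P Q] P0 step by blast
  have "fam_eq z G (fdiff (z - 1) H)"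
    unfolding Phi_eq_iff[symmetric] Phi_def
  proof (rule ext, rule if_cong[OF refl refl])
    fix i assume "\<not> int i + z < 0"
    then have nn: "0 \<le> int i + z" by simp
    have ni: "nat (int i + (z - 1) + 1) = n i" by (simp add: n_def)
    have "hm (om i) (om (n i)) (cmul (om i) (om (Suc i)) (om (n i)) (dc i) (H (Suc i)) + smult2 ?s (right_d (z - 1) i (H i)))
      = hm (om i) (om (n i)) (R i (H i) + smult2 ?s (right_d (z - 1) i (H i)))"
      by (rule hm_cong_add) (use H[of i] nn in \<open>simp add: Q_def\<close>)
    also have "R i (H i) + smult2 ?s (right_d (z - 1) i (H i)) = G i" by (simp add: R_def)
    finally show "hm (om i) (om (nat (int i + z))) (G i) = hm (om i) (om (nat (int i + z))) (fdiff (z - 1) H i)"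
      unfolding fdiff_eq ni n_def[symmetric] ..
  qed
  then show thesis by (rule that)
qed

section \<open>Bijectivity on homology\<close>

lemma fA_single:
  assumes "fst cb \<noteq> 0 \<longrightarrow> hdeg p (snd cb) = z"
  shows "fA p [z] [el cb] = Phi z (fsc (fst cb) one)"
  using fA_el[of "[z]" "[cb]"] assms fcoef_single[of "snd cb"] by (simp add: compat_def)

text \<open>P_1 occurs at the positions 0 and l - 1 modulo l, which are the degrees of iota^j and
  chi iota^j.\<close>

lemma omega_eq_1_degree:
  assumes "0 \<le> z" "om (nat z) = 1"
  obtains b where "hdeg p b = z"
proof -
  let ?q = "nat z div l"
  have "nat z mod l = 0 \<or> nat z mod l = l - 1"
  proof (cases "nat z mod l \<le> p - 2")
    case True then show ?thesis using omega_lower[OF True] assms(2) by simp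
  next
    case False
    then have "p - 1 \<le> nat z mod l" by simp
    then show ?thesis using omega_upper[of "nat z"] assms(2) by linarith
  qed
  moreover have "nat z = ?q * l + nat z mod l" by simp
  ultimately have "z = int (?q * l) \<or> z = int (?q * l) + (int l - 1)"
    using assms(1) l_pos by linarith
  then show thesis using that[of "(False, ?q)"] that[of "(True, ?q)"] by (auto simp: hdeg_def)
qed

lemma homology_surjective:
  assumes g: "Adeg p z g" and cyc: "m1A p z g = zeroA p (z + 1)"
  shows "\<exists>(x :: 'p Hel) h. homogH p z x \<and> Adeg p (z - 1) h \<and> g = addA p z (fA p [z] [x]) (m1A p (z - 1) h)"
proof -
  obtain G where G: "g = Phi z G" using Adeg_cases[OF g] .
  have cG: "fam_eq (z + 1) (fdiff z G) 0" using cyc unfolding G m1A_Phi zeroA_Phi Phi_eq_iff .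
  \<comment> \<open>Where P_1 sits in position z, the coefficient is the identity coordinate of the
    bottom component; otherwise it is 0 and the label arbitrary.\<close>
  obtain cb where cb: "fst cb \<noteq> 0 \<longrightarrow> hdeg p (snd cb) = z"
    and c0: "\<lbrakk>0 \<le> z; om (nat z) = 1\<rbrakk> \<Longrightarrow> fst cb = fst (G 0)"
  proof (cases "0 \<le> z \<and> om (nat z) = 1")
    case True
    then obtain b where "hdeg p b = z" using omega_eq_1_degree by blast
    then show thesis using that[of "(fst (G 0), b)"] by simp
  next
    case False then show thesis using that[of "(0, undefined)"] by auto
  qed
  let ?c = "fst cb"
  define G' where "G' = G - fsc ?c one"
  have dz: "fdiff z (fsc ?c one) = 0"
  proof (cases "?c = 0")
    case True show ?thesis unfolding True fsc_0_left by (rule fdiff_0)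
  next
    case False
    then have "z = hdeg p (snd cb)" using cb by simp
    then show ?thesis unfolding fdiff_fsc using fdiff_one_hdeg by (simp only: fsc_0_right)
  qed
  have "fdiff z G' i = fdiff z G i - fdiff z (fsc ?c one) i" for i
    unfolding fdiff_eq G'_def fun_diff_def right_d_add cmul_bilinear by (simp add: smult2_simps)
  then have "fdiff z G' = fdiff z G" unfolding dz by (simp add: fun_eq_iff)
  then have cyc': "fam_eq (z + 1) (fdiff z G') 0" using cG by (simp only:)
  have "fst (G' 0) = 0" if "0 \<le> z" "om (nat z) = 1"
    using c0[OF that] by (simp add: G'_def fsc_def smult2_def one_def)
  then obtain H where H: "fam_eq z G' (fdiff (z - 1) H)" using contract_cycle[OF cyc'] by blast
  have "addA p z (fA p [z] [el cb]) (m1A p (z - 1) (Phi (z - 1) H)) = Phi z (fsc ?c one + fdiff (z - 1) H)"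
    unfolding fA_single[OF cb] m1A_Phi diff_add_cancel addA_Phi ..
  also have "\<dots> = g" unfolding G Phi_eq_iff
  proof -
    have "(fsc ?c one + fdiff (z - 1) H) i - G i = - (G' i - fdiff (z - 1) H i)" for i by (simp add: G'_def)
    moreover have "coords_zero m k (- c) \<longleftrightarrow> coords_zero m k c" for m k c by (simp add: coords_zero_def)
    ultimately show "fam_eq z (fsc ?c one + fdiff (z - 1) H) G" using H unfolding fam_eq_def by (simp only:)
  qed
  finally have "g = addA p z (fA p [z] [el cb]) (m1A p (z - 1) (Phi (z - 1) H))" ..
  moreover have "homogH p z (el cb)" using cb by (simp add: homogH_def)
  ultimately show ?thesis using Adeg_Phi by blast
qed

text \<open>A boundary has no identity coordinate at the bottom, since each of its two parts passes
  through P_2 or through a radical endomorphism of P_1, whereas f_1 puts the coefficient of the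
  label there.\<close>

lemma homology_injective:
  assumes x: "homogH p z (x :: 'p Hel)" and h: "Adeg p (z - 1) h" and eq: "fA p [z] [x] = m1A p (z - 1) h"
  shows "x = 0"
proof -
  obtain cb where cb: "x = el cb" "fst cb \<noteq> 0 \<longrightarrow> hdeg p (snd cb) = z" using homogH_cases[OF x] .
  obtain H where H: "h = Phi (z - 1) H" using Adeg_cases[OF h] .
  have fe: "fam_eq z (fsc (fst cb) one) (fdiff (z - 1) H)"
    using eq unfolding cb(1) fA_single[OF cb(2)] H m1A_Phi diff_add_cancel Phi_eq_iff .
  have "fst cb = 0"
  proof (rule ccontr)
    assume c: "fst cb \<noteq> 0"
    then have z: "z = hdeg p (snd cb)" using cb by simp
    then have z0: "0 \<le> z" using l_pos by (simp add: hdeg_def)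
    have om: "om (nat z) = 1"
    proof (cases "fst (snd cb)")
      case False
      then have "nat z = 0 + snd (snd cb) * l" unfolding z hdeg_false[OF False] by (simp only: nat_int add_0_left)
      then show ?thesis using omega_add_mult_l[of 0] omega_0 by simp
    next
      case True
      have "z = int ((l - 1) + snd (snd cb) * l)" unfolding z hdeg_true[OF True] gamma_deg_1 using l_pos by simp
      then have "nat z = (l - 1) + snd (snd cb) * l" by (simp only: nat_int)
      moreover have "om (l - 1) = 1" using omega_step(4)[of "l - 1"] l_pos by simp
      ultimately show ?thesis using omega_add_mult_l[of "l - 1"] by simp
    qed
    have "coords_zero 1 1 (fsc (fst cb) one 0 - fdiff (z - 1) H 0)"
      using fe z0 om omega_0 unfolding fam_eq_def by (metis add_0 of_nat_0)
    then have e: "fst cb = fst (fdiff (z - 1) H 0)" by (simp add: coords_zero_def fsc_def smult2_def one_def)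
    have nz: "nat (int 0 + (z - 1) + 1) = nat z" by simp
    have "fst (right_d (z - 1) 0 (H 0)) = 0"
    proof (cases "z - 1 < 0")
      case True then show ?thesis by (simp add: right_d_def)
    next
      case False
      define k where "k = nat (z - 1)"
      have k: "nat z = Suc k" using False by (simp add: k_def)
      have ok: "om (Suc k) = 1" using om unfolding k .
      have r: "right_d (z - 1) 0 (H 0) = cmul 1 (om k) 1 (H 0) (dc k)"
        using False ok unfolding right_d_def nz k omega_0 by (simp add: k_def)
      show ?thesis unfolding r
        by (cases rule: step_forms[of k]) (use ok in \<open>auto simp: cmul_def\<close>)
    qed
    moreover have "fst (cmul (om 0) (om (Suc 0)) (om (nat z)) (dc 0) (H (Suc 0))) = 0"
      unfolding omega_0 omega_Suc_0 om by (simp add: cmul_def)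
    ultimately have "fst (fdiff (z - 1) H 0) = 0" unfolding fdiff_eq nz by (simp add: smult2_def)
    then show False using e c by simp
  qed
  then show ?thesis unfolding cb(1) by simp
qed

abbreviation homog_tuple :: "int list \<Rightarrow> 'p Hel list \<Rightarrow> bool" where
  "homog_tuple ds xs \<equiv> length ds = length xs \<and> length xs \<ge> 1 \<and> (\<forall>i < length xs. homogH p (ds ! i) (xs ! i))"

lemma
  fixes xs :: "'p Hel list"
  assumes "homog_tuple ds xs"
  shows mH_degree: "homogH p (sum_list ds + 2 - int (length xs)) (mH p xs)"
    and Ainf_relation: "Ainf_rel_H p ds xs = 0"
    and fA_degree: "Adeg p (sum_list ds + 1 - int (length xs)) (fA p ds xs)"
    and Ainf_morphism: "morph_lhs p ds xs = morph_rhs p ds xs"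
proof -
  have "length ds = length xs" "\<forall>i < length xs. homogH p (ds ! i) (xs ! i)" using assms by blast+
  then obtain cbs where cbs: "xs = map el cbs" "compat ds cbs" by (rule homogH_list_cases)
  moreover have "xs \<noteq> []" using assms by auto
  ultimately have ne: "cbs \<noteq> []" by blast
  show "homogH p (sum_list ds + 2 - int (length xs)) (mH p xs)"
    unfolding cbs(1) mH_el using mH_homog[OF cbs(2)] by (auto simp: homogH_def)
  show "Ainf_rel_H p ds xs = 0" unfolding cbs(1) by (rule Ainf_rel_H_zero[OF cbs(2)])
  show "Adeg p (sum_list ds + 1 - int (length xs)) (fA p ds xs)"
    unfolding cbs(1) fA_el[OF cbs(2) ne] length_map by (rule Adeg_Phi)
  show "morph_lhs p ds xs = morph_rhs p ds xs" unfolding cbs(1) by (rule morph_relation[OF cbs(2) ne])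
qed

end

theorem theorem2:
  fixes p :: nat
  assumes "p = CARD('p::prime_card)" and "p \<ge> 3"
  shows
    \<comment> \<open>m'_n has degree 2 - n\<close>
    "(\<forall>(ds :: int list) (xs :: 'p Hel list). length ds = length xs \<and> length xs \<ge> 1 \<and>
        (\<forall>i < length xs. homogH p (ds ! i) (xs ! i)) \<longrightarrow>
        homogH p (sum_list ds + 2 - int (length xs)) (mH p xs))
   \<comment> \<open>A-infinity relations for (H^*A, m')\<close>
   \<and> (\<forall>(ds :: int list) (xs :: 'p Hel list). length ds = length xs \<and> length xs \<ge> 1 \<and>
        (\<forall>i < length xs. homogH p (ds ! i) (xs ! i)) \<longrightarrow> Ainf_rel_H p ds xs = 0)
   \<comment> \<open>minimality, and m'_n = 0 for n not in {2, p}\<close>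
   \<and> (\<forall>x :: 'p Hel. mH p [x] = 0)
   \<and> (\<forall>xs :: 'p Hel list. length xs \<ge> 1 \<and> length xs \<noteq> 2 \<and> length xs \<noteq> p \<longrightarrow> mH p xs = 0)
   \<comment> \<open>f_n has degree 1 - n\<close>
   \<and> (\<forall>(ds :: int list) (xs :: 'p Hel list). length ds = length xs \<and> length xs \<ge> 1 \<and>
        (\<forall>i < length xs. homogH p (ds ! i) (xs ! i)) \<longrightarrow>
        Adeg p (sum_list ds + 1 - int (length xs)) (fA p ds xs))
   \<comment> \<open>A-infinity morphism relations\<close>
   \<and> (\<forall>(ds :: int list) (xs :: 'p Hel list). length ds = length xs \<and> length xs \<ge> 1 \<and>
        (\<forall>i < length xs. homogH p (ds ! i) (xs ! i)) \<longrightarrow>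
        morph_lhs p ds xs = morph_rhs p ds xs)
   \<comment> \<open>f_1 is a quasi-isomorphism: the induced map H^*A \<rightarrow> H(A, m_1) is surjective ...\<close>
   \<and> (\<forall>z g. Adeg p z g \<and> m1A p z g = zeroA p (z + 1) \<longrightarrow>
        (\<exists>(x :: 'p Hel) h. homogH p z x \<and> Adeg p (z - 1) h \<and>
           g = addA p z (fA p [z] [x]) (m1A p (z - 1) h)))
   \<comment> \<open>... and injective\<close>
   \<and> (\<forall>z (x :: 'p Hel) h. homogH p z x \<and> Adeg p (z - 1) h \<and> fA p [z] [x] = m1A p (z - 1) h
        \<longrightarrow> x = 0)"
proof -
  interpret symmetric_group_prime p "TYPE('p)" using assms by unfold_locales
  have "mH p [x] = 0" for x :: "'p Hel" using mH_eq_0 p_ge_3 by simp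
  then show ?thesis
    using mH_degree Ainf_relation mH_eq_0 fA_degree Ainf_morphism homology_surjective homology_injective
    by (intro conjI) blast+
qed

end
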